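(* Let $k$ be a perfect field of characteristic $p>0$ and let $A$ be a $k$-algebra. The following properties are equivalent: (a) The ring $A$ is noetherian and for every prime ideal $\mathfrak{p}\in\operatorname{Spec}(A)$, the field $Qt(A/\mathfrak{p})^{\sharp}$ is algebraic over $k$. (b) The ring $A_{(\infty)}$ is noetherian.
   Context: All rings and algebras are commutative with unit. $Qt(D)$ denotes the quotient field of an integral domain $D$. For an $\mathbb{F}_p$-algebra $B$, $B^{\sharp}=\bigcap_{m\ge 0}B^{p^m}$, where $B^{p^m}=\{b^{p^m}: b\in B\}$. Let $t$ be an indeterminate and $t_m=t^{1/p^m}$ (so $t_0=t$ and $t_{m+1}^p=t_m$). Put $k_{(\infty)}=\bigcup_{m\ge 0}k(t_m)$; since $k$ is perfect this is the perfect closure $k(t)_{per}$ of $k(t)$. Then $A_{(\infty)}:=A\otimes_k k_{(\infty)}=\bigcup_{m\ge 0}\left(A\otimes_k k(t_m)\right)$. *)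

theory Defs
  imports "HOL-Algebra.Algebra" "HOL-Computational_Algebra.Primes"
begin

text \<open>\<open>p \<sdot> 1 = 0\<close> in a field, with \<open>p\<close> prime, says that the characteristic is \<open>p\<close>; perfect then means \<open>k\<^sup>p = k\<close>.\<close>

definition perfect_field_of_char :: "nat \<Rightarrow> ('k, 'c) ring_scheme \<Rightarrow> bool" where
  "perfect_field_of_char p k \<longleftrightarrow>
     field k \<and> Factorial_Ring.prime p \<and> add_pow k p \<one>\<^bsub>k\<^esub> = \<zero>\<^bsub>k\<^esub> \<and>
     (\<lambda>x. x [^]\<^bsub>k\<^esub> p) ` carrier k = carrier k"

definition sharp :: "nat \<Rightarrow> ('b, 'c) ring_scheme \<Rightarrow> 'b set" where
  "sharp p B = (\<Inter>m::nat. (\<lambda>b. b [^]\<^bsub>B\<^esub> (p ^ m)) ` carrier B)"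

text \<open>\<open>fraction D a b\<close> is the class of \<open>a / b\<close>, that is, the set of all pairs \<open>(x, y)\<close> with
  \<open>y \<noteq> 0\<close> and \<open>a y = x b\<close>.\<close>

definition fraction :: "('a, 'c) ring_scheme \<Rightarrow> 'a \<Rightarrow> 'a \<Rightarrow> ('a \<times> 'a) set" where
  "fraction D a b =
     {(x, y). x \<in> carrier D \<and> y \<in> carrier D - {\<zero>\<^bsub>D\<^esub>} \<and> a \<otimes>\<^bsub>D\<^esub> y = x \<otimes>\<^bsub>D\<^esub> b}"

text \<open>In a domain the unions below are unions of equal sets: the operations do not depend on the
  representatives.\<close>

definition Qt :: "('a, 'c) ring_scheme \<Rightarrow> ('a \<times> 'a) set ring" where
  "Qt D =
     \<lparr>carrier = {fraction D a b | a b. a \<in> carrier D \<and> b \<in> carrier D - {\<zero>\<^bsub>D\<^esub>}},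
      monoid.mult = (\<lambda>U V. \<Union>x\<in>U. \<Union>y\<in>V.
               fraction D (fst x \<otimes>\<^bsub>D\<^esub> fst y) (snd x \<otimes>\<^bsub>D\<^esub> snd y)),
      one = fraction D \<one>\<^bsub>D\<^esub> \<one>\<^bsub>D\<^esub>,
      ring.zero = fraction D \<zero>\<^bsub>D\<^esub> \<one>\<^bsub>D\<^esub>,
      ring.add = (\<lambda>U V. \<Union>x\<in>U. \<Union>y\<in>V.
               fraction D (fst x \<otimes>\<^bsub>D\<^esub> snd y \<oplus>\<^bsub>D\<^esub> fst y \<otimes>\<^bsub>D\<^esub> snd x) (snd x \<otimes>\<^bsub>D\<^esub> snd y))\<rparr>"

text \<open>The structure map \<open>k \<rightarrow> A \<rightarrow> A/P \<rightarrow> Qt(A/P)\<close> of a \<open>k\<close>-algebra \<open>A\<close>.\<close>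

definition residue_map :: "('k, 'a, 'd) module_scheme \<Rightarrow> 'a set \<Rightarrow> 'k \<Rightarrow> ('a set \<times> 'a set) set" where
  "residue_map A P c = fraction (A Quot P) (P +>\<^bsub>A\<^esub> (c \<odot>\<^bsub>A\<^esub> \<one>\<^bsub>A\<^esub>)) \<one>\<^bsub>A Quot P\<^esub>"

text \<open>\<open>R[M]\<close>, realised as the finitely supported functions from \<open>M\<close> to \<open>R\<close> under convolution.\<close>

definition monomial :: "('r, 'c) ring_scheme \<Rightarrow> 'm \<Rightarrow> 'r \<Rightarrow> 'm \<Rightarrow> 'r" where
  "monomial R m c = (\<lambda>x. if x = m then c else \<zero>\<^bsub>R\<^esub>)"

definition monoid_algebra ::
    "('r, 'c) ring_scheme \<Rightarrow> ('m, 'e) monoid_scheme \<Rightarrow> ('m \<Rightarrow> 'r) ring" where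
  "monoid_algebra R M =
     \<lparr>carrier = {f. range f \<subseteq> carrier R \<and> finite {x. f x \<noteq> \<zero>\<^bsub>R\<^esub>} \<and>
                    {x. f x \<noteq> \<zero>\<^bsub>R\<^esub>} \<subseteq> carrier M},
      monoid.mult = (\<lambda>f g z. \<Oplus>\<^bsub>R\<^esub>u \<in> {(x, y). f x \<noteq> \<zero>\<^bsub>R\<^esub> \<and> g y \<noteq> \<zero>\<^bsub>R\<^esub> \<and> x \<otimes>\<^bsub>M\<^esub> y = z}.
                f (fst u) \<otimes>\<^bsub>R\<^esub> g (snd u)),
      one = monomial R \<one>\<^bsub>M\<^esub> \<one>\<^bsub>R\<^esub>,
      ring.zero = (\<lambda>x. \<zero>\<^bsub>R\<^esub>),
      ring.add = (\<lambda>f g x. f x \<oplus>\<^bsub>R\<^esub> g x)\<rparr>"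

text \<open>The free \<open>k\<close>-module on \<open>A \<times> B\<close> modulo the bilinearity relations. Its ring structure is given by
  \<open>(a \<otimes> b)(a' \<otimes> b') = aa' \<otimes> bb'\<close>, that is, the free module is the monoid algebra of the
  multiplicative monoid \<open>A \<times> B\<close>; a product of a relation with a basis element is again a relation,
  so the submodule spanned by the relations is the ideal they generate.\<close>

definition bilinearity_relations ::
    "('k, 'c) ring_scheme \<Rightarrow> ('k, 'a, 'd) module_scheme \<Rightarrow> ('k, 'b, 'e) module_scheme \<Rightarrow>
     ('a \<times> 'b \<Rightarrow> 'k) set" where
  "bilinearity_relations k A B =
     (let F = monoid_algebra k (A \<times>\<times> B); e = (\<lambda>a b. monomial k (a, b) \<one>\<^bsub>k\<^esub>) in
      {e (a \<oplus>\<^bsub>A\<^esub> a') b \<ominus>\<^bsub>F\<^esub> (e a b \<oplus>\<^bsub>F\<^esub> e a' b) | a a' b.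
         a \<in> carrier A \<and> a' \<in> carrier A \<and> b \<in> carrier B} \<union>
      {e a (b \<oplus>\<^bsub>B\<^esub> b') \<ominus>\<^bsub>F\<^esub> (e a b \<oplus>\<^bsub>F\<^esub> e a b') | a b b'.
         a \<in> carrier A \<and> b \<in> carrier B \<and> b' \<in> carrier B} \<union>
      {e (c \<odot>\<^bsub>A\<^esub> a) b \<ominus>\<^bsub>F\<^esub> monomial k (a, b) c | a b c.
         a \<in> carrier A \<and> b \<in> carrier B \<and> c \<in> carrier k} \<union>
      {e a (c \<odot>\<^bsub>B\<^esub> b) \<ominus>\<^bsub>F\<^esub> monomial k (a, b) c | a b c.
         a \<in> carrier A \<and> b \<in> carrier B \<and> c \<in> carrier k})"

definition algebra_tensor_product ::
    "('k, 'c) ring_scheme \<Rightarrow> ('k, 'a, 'd) module_scheme \<Rightarrow> ('k, 'b, 'e) module_scheme \<Rightarrow>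
     ('a \<times> 'b \<Rightarrow> 'k) set ring" where
  "algebra_tensor_product k A B =
     monoid_algebra k (A \<times>\<times> B) Quot (Idl\<^bsub>monoid_algebra k (A \<times>\<times> B)\<^esub> (bilinearity_relations k A B))"

text \<open>To speak of \<open>t\<close> and of all its roots \<open>t\<^sub>m\<close> at once, the fields \<open>k(t\<^sub>m)\<close> are formed inside the
  quotient field \<open>\<Omega>\<close> of the domain \<open>k[t\<^sup>q : q \<in> \<rat>, q \<ge> 0]\<close>, in which \<open>t\<close> is transcendental
  over \<open>k\<close> and \<open>t\<^sub>m\<close> is \<open>t\<^sup>q\<close> for \<open>q = 1/p\<^sup>m\<close>.\<close>

definition nonneg_rat_monoid :: "rat monoid" where
  "nonneg_rat_monoid = \<lparr>carrier = {q. 0 \<le> q}, monoid.mult = (+), one = 0\<rparr>"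

definition root_polys :: "('k, 'c) ring_scheme \<Rightarrow> (rat \<Rightarrow> 'k) ring" where
  "root_polys k = monoid_algebra k nonneg_rat_monoid"

definition ambient :: "('k, 'c) ring_scheme \<Rightarrow> ((rat \<Rightarrow> 'k) \<times> (rat \<Rightarrow> 'k)) set ring" where
  "ambient k = Qt (root_polys k)"

definition ambient_const :: "('k, 'c) ring_scheme \<Rightarrow> 'k \<Rightarrow> ((rat \<Rightarrow> 'k) \<times> (rat \<Rightarrow> 'k)) set" where
  "ambient_const k c = fraction (root_polys k) (monomial k 0 c) \<one>\<^bsub>root_polys k\<^esub>"

definition t_root :: "nat \<Rightarrow> ('k, 'c) ring_scheme \<Rightarrow> nat \<Rightarrow> ((rat \<Rightarrow> 'k) \<times> (rat \<Rightarrow> 'k)) set" where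
  "t_root p k m =
     fraction (root_polys k) (monomial k (1 / of_nat p ^ m) \<one>\<^bsub>k\<^esub>) \<one>\<^bsub>root_polys k\<^esub>"

definition k_infty ::
    "nat \<Rightarrow> ('k, 'c) ring_scheme \<Rightarrow> ('k, ((rat \<Rightarrow> 'k) \<times> (rat \<Rightarrow> 'k)) set) module" where
  "k_infty p k =
     \<lparr>carrier =
        (\<Union>m. generate_field (ambient k) (ambient_const k ` carrier k \<union> {t_root p k m})),
      monoid.mult = monoid.mult (ambient k), one = one (ambient k),
      ring.zero = ring.zero (ambient k), ring.add = ring.add (ambient k),
      smult = (\<lambda>c x. ambient_const k c \<otimes>\<^bsub>ambient k\<^esub> x)\<rparr>"

definition A_infty ::
    "nat \<Rightarrow> ('k, 'c) ring_scheme \<Rightarrow> ('k, 'a, 'd) module_scheme \<Rightarrow>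
     ('a \<times> ((rat \<Rightarrow> 'k) \<times> (rat \<Rightarrow> 'k)) set \<Rightarrow> 'k) set ring" where
  "A_infty p k A = algebra_tensor_product k A (k_infty p k)"

end

theory Submission
  imports Defs
begin

text \<open>
  Write \<open>T\<close> for \<open>A \<otimes> k\<^sub>\<infinity>\<close> and \<open>U\<^sub>m\<close> for its subring \<open>A[t\<^sub>m]\<close>. The rings \<open>U\<^sub>m\<close> increase with \<open>m\<close>, and
  every element of \<open>T\<close> lies in some \<open>U\<^sub>m\<close> after multiplication by a unit of \<open>T\<close>.

  Let \<open>T\<close> be noetherian. A \<open>k\<close>-linear functional on \<open>k\<^sub>\<infinity>\<close> with value \<open>1\<close> at \<open>1\<close> makes \<open>A\<close> a direct
  summand of the \<open>A\<close>-module \<open>T\<close>, so that chains of ideals of \<open>A\<close> can be read off from chains of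
  ideals of \<open>T\<close> (\<open>noetherian_descends\<close>). Suppose that \<open>x \<in> K = Qt(A/P)\<close> has \<open>p\<^sup>m\<close>-th roots \<open>x\<^sub>m\<close> in \<open>K\<close>
  for all \<open>m\<close> and is transcendental over \<open>k\<close>. In the quotient field of \<open>K[e\<^sup>q : q \<in> \<rat>, q \<ge> 0]\<close> the
  elements \<open>x\<^sub>m + e\<^sup>r\<close> with \<open>r = 1/p\<^sup>m\<close> are again successive \<open>p\<close>-th roots, so
  \<open>t\<^sub>m \<mapsto> x\<^sub>m + e\<^sup>r\<close> defines a homomorphism \<open>\<Psi>\<close> on \<open>T\<close>. A nonzero polynomial in \<open>x\<^sub>m + e\<^sup>r\<close> over \<open>k\<close> has
  a nonzero constant term in \<open>e\<close>, because \<open>x\<^sub>m\<close> is transcendental; so all values of \<open>\<Psi>\<close> have order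
  at least \<open>0\<close> in \<open>e\<close>. If \<open>x\<^sub>m = a/b\<close> with \<open>a, b \<in> A\<close>, then \<open>b t\<^sub>m - a\<close> is mapped to \<open>b e\<^sup>r\<close>, of order
  exactly \<open>1/p\<^sup>m\<close>. The ideals of the \<open>y\<close> such that \<open>\<Psi>(y)\<close> has order at least \<open>1/p\<^sup>m\<close> therefore form a strictly
  increasing sequence, a contradiction (\<open>sharp_algebraic_of_noetherian\<close>).

  Conversely, by Cohen's theorem (\<open>noetherian_from_prime_ideals\<close>) it suffices that every prime ideal
  \<open>P\<close> of \<open>T\<close> is finitely generated. Let \<open>K \<subseteq> Qt(T/P)\<close> be the residue field of \<open>P \<inter> A\<close>, and let \<open>\<tau>\<^sub>m\<close> be
  the image of \<open>t\<^sub>m\<close>. If \<open>\<tau>\<^sub>m\<^sub>+\<^sub>1 \<in> K(\<tau>\<^sub>m)\<close> for all \<open>m\<close>, then \<open>\<tau>\<^sub>0\<close> is algebraic over \<open>K\<close>, the fields \<open>K(\<tau>\<^sub>m)\<close>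
  coincide, and comparing degrees shows that the minimal polynomial of \<open>\<tau>\<^sub>0\<close> arises from that of \<open>\<tau>\<^sub>m\<close> by
  raising the coefficients to the power \<open>p\<^sup>m\<close>. The coefficients thus lie in \<open>K\<^sup>\<sharp>\<close>, so they
  are algebraic over \<open>k\<close>, and so is \<open>\<tau>\<^sub>0\<close> (\<open>root_chain_algebraic\<close>); this is absurd, since the field \<open>k\<^sub>\<infinity>\<close>
  embeds into \<open>Qt(T/P)\<close>. So \<open>\<tau>\<^sub>m\<^sub>+\<^sub>1 \<notin> K(\<tau>\<^sub>m)\<close> for some \<open>m\<close>, and then for all larger
  \<open>m\<close>, because Frobenius maps \<open>K(\<tau>\<^sub>m\<^sub>+\<^sub>1)\<close> into \<open>K(\<tau>\<^sub>m)\<close>. For such \<open>m\<close> the powers of \<open>\<tau>\<^sub>m\<^sub>+\<^sub>1\<close> with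
  exponents below \<open>p\<close> are linearly independent over \<open>K(\<tau>\<^sub>m)\<close> (\<open>bounded_polys_independent\<close>). An element of
  \<open>P \<inter> U\<^sub>m\<^sub>+\<^sub>1\<close>, written as a polynomial in \<open>t\<^sub>m\<^sub>+\<^sub>1\<close> of degree below \<open>p\<close> over \<open>U\<^sub>m\<close>, then has all its
  coefficients in \<open>P\<close>, so \<open>P \<inter> U\<^sub>m\<close> generates \<open>P \<inter> U\<^sub>m\<^sub>+\<^sub>1\<close>. Thus \<open>P\<close> is generated by \<open>P \<inter> U\<^sub>m\<close> for one
  \<open>m\<close>, and Hilbert's basis theorem for \<open>U\<^sub>m = A[t\<^sub>m]\<close> provides finitely many generators
  (\<open>polynomial_ideal_finitely_generated\<close>).
\<close>

section \<open>The Frobenius map in characteristic p\<close>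

lemma (in cring) binomial_expansion:
  assumes x: "x \<in> carrier R" and y: "y \<in> carrier R"
  shows "(x \<oplus> y) [^] (n::nat) =
           (\<Oplus>k\<in>{..n}. add_pow R (n choose k) (x [^] k \<otimes> y [^] (n - k)))"
proof (induction n)
  case 0
  then show ?case by simp
next
  case (Suc n)
  define f where "f k = add_pow R (n choose k) (x [^] k \<otimes> y [^] (n - k))" for k
  define g where "g k = add_pow R (n choose k) (x [^] Suc k \<otimes> y [^] (n - k))" for k
  define h where "h k = add_pow R (n choose Suc k) (x [^] Suc k \<otimes> y [^] (n - k))" for k
  have closed: "f \<in> A \<rightarrow> carrier R" "g \<in> A \<rightarrow> carrier R" "h \<in> A \<rightarrow> carrier R" for A
    using x y by (auto simp: f_def g_def h_def)
  have xf: "x \<otimes> finsum R f {..n} = finsum R g {..n}"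
  proof -
    have "x \<otimes> finsum R f {..n} = (\<Oplus>k\<in>{..n}. x \<otimes> f k)"
      using closed x by (intro finsum_rdistr) auto
    also have "\<dots> = finsum R g {..n}"
    proof (intro finsum_cong')
      fix k
      have "x \<otimes> (x [^] k \<otimes> y [^] (n - k)) = x [^] Suc k \<otimes> y [^] (n - k)"
        using x y by (simp only: nat_pow_Suc2 m_assoc nat_pow_closed m_closed)
      then show "x \<otimes> f k = g k"
        using x y by (simp only: f_def g_def add_pow_rdistr m_closed nat_pow_closed)
    qed (use closed in auto)
    finally show ?thesis .
  qed
  have yf: "y \<otimes> finsum R f {..n} = y [^] Suc n \<oplus> finsum R h {..n}"
  proof -
    have "y \<otimes> finsum R f {..n} = (\<Oplus>k\<in>{..n}. y \<otimes> f k)"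
      using closed y by (intro finsum_rdistr) auto
    also have "\<dots> = (\<Oplus>k\<in>{..n}. add_pow R (n choose k) (x [^] k \<otimes> y [^] (Suc n - k)))"
    proof (intro finsum_cong')
      fix k assume "k \<in> {..n}"
      then have "Suc n - k = Suc (n - k)" by auto
      then show "y \<otimes> f k = add_pow R (n choose k) (x [^] k \<otimes> y [^] (Suc n - k))"
        using x y by (simp add: f_def add_pow_rdistr m_lcomm m_comm)
    qed (use x y in auto)
    also have "\<dots> = (\<Oplus>k\<in>{..Suc n}. add_pow R (n choose k) (x [^] k \<otimes> y [^] (Suc n - k)))"
      using finsum_Suc[of "\<lambda>k. add_pow R (n choose k) (x [^] k \<otimes> y [^] (Suc n - k))" n] x y
      by (simp add: Pi_def binomial_eq_0 del: nat_pow_Suc)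
    also have "\<dots> = (\<Oplus>k\<in>{..n}. add_pow R (n choose Suc k) (x [^] Suc k \<otimes> y [^] (Suc n - Suc k)))
                      \<oplus> add_pow R (n choose 0) (x [^] (0::nat) \<otimes> y [^] (Suc n - 0))"
      using x y by (subst finsum_Suc2) auto
    also have "\<dots> = y [^] Suc n \<oplus> finsum R h {..n}"
      using x y closed by (simp add: h_def[abs_def] a_comm)
    finally show ?thesis .
  qed
  have "(x \<oplus> y) [^] Suc n = (x \<oplus> y) \<otimes> finsum R f {..n}"
    using x y by (simp only: nat_pow_Suc2 a_closed Suc f_def[abs_def])
  also have "\<dots> = finsum R g {..n} \<oplus> (y [^] Suc n \<oplus> finsum R h {..n})"
    using x y closed xf yf by (simp add: l_distr del: nat_pow_Suc)
  also have "\<dots> = (finsum R g {..n} \<oplus> finsum R h {..n}) \<oplus> y [^] Suc n"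
    using x y closed by (simp add: a_ac del: nat_pow_Suc)
  also have "finsum R g {..n} \<oplus> finsum R h {..n} = (\<Oplus>k\<in>{..n}. g k \<oplus> h k)"
    using closed by (intro finsum_addf[symmetric])
  also have "\<dots> = (\<Oplus>k\<in>{..n}. add_pow R (Suc n choose Suc k) (x [^] Suc k \<otimes> y [^] (Suc n - Suc k)))"
    using x y by (intro finsum_cong') (auto simp: g_def h_def add.nat_pow_mult)
  also have "\<dots> \<oplus> y [^] Suc n = (\<Oplus>k\<in>{..Suc n}. add_pow R (Suc n choose k) (x [^] k \<otimes> y [^] (Suc n - k)))"
    using x y by (subst finsum_Suc2) (auto simp del: nat_pow_Suc)
  finally show ?case .
qed

lemma (in ring) add_pow_multiple_zero:
  assumes "add_pow R (n::nat) \<one> = \<zero>" "x \<in> carrier R" "n dvd j"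
  shows "add_pow R j x = \<zero>"
proof -
  obtain i where j: "j = n * i" using assms(3) by auto
  have "add_pow R n x = add_pow R n \<one> \<otimes> x"
    using assms by (subst add_pow_ldistr) auto
  then have "add_pow R n x = \<zero>" using assms by simp
  then show ?thesis unfolding j using assms(2) by (simp add: add.nat_pow_pow[symmetric])
qed

text \<open>All binomial coefficients except the two outermost are divisible by \<open>p\<close>.\<close>

lemma (in cring) frobenius_add:
  assumes p: "Factorial_Ring.prime p" "add_pow R (p::nat) \<one> = \<zero>"
    and x: "x \<in> carrier R" and y: "y \<in> carrier R"
  shows "(x \<oplus> y) [^] p = x [^] p \<oplus> y [^] p"
proof -
  obtain q where q: "p = Suc (Suc q)"
    using prime_ge_2_nat[OF p(1)] by (metis add_2_eq_Suc le_Suc_ex)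
  let ?f = "\<lambda>k. add_pow R (p choose k) (x [^] k \<otimes> y [^] (p - k))"
  have f: "?f \<in> A \<rightarrow> carrier R" for A using x y by auto
  have mid: "(\<Oplus>k\<in>{..q}. ?f (Suc k)) = \<zero>"
  proof -
    have "(\<Oplus>k\<in>{..q}. ?f (Suc k)) = (\<Oplus>k\<in>{..q}. \<zero>)"
    proof (intro finsum_cong')
      fix k assume "k \<in> {..q}"
      then have "p dvd (p choose Suc k)"
        using p(1) q by (intro dvd_choose_prime) auto
      then show "?f (Suc k) = \<zero>"
        using p x y by (auto intro!: add_pow_multiple_zero[OF p(2)] simp del: nat_pow_Suc)
    qed auto
    then show ?thesis by simp
  qed
  have "(x \<oplus> y) [^] p = finsum R ?f {..Suc (Suc q)}"
    using binomial_expansion[OF x y, of p] q by simp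
  also have "\<dots> = ?f (Suc (Suc q)) \<oplus> finsum R ?f {..Suc q}"
    using f by (intro finsum_Suc)
  also have "finsum R ?f {..Suc q} = (\<Oplus>k\<in>{..q}. ?f (Suc k)) \<oplus> ?f 0"
    using f by (intro finsum_Suc2)
  finally show ?thesis unfolding mid using x y q by simp
qed

lemma (in cring) frobenius_power_add:
  assumes "Factorial_Ring.prime p" "add_pow R (p::nat) \<one> = \<zero>"
    and "x \<in> carrier R" "y \<in> carrier R"
  shows "(x \<oplus> y) [^] (p ^ m) = x [^] (p ^ m) \<oplus> y [^] (p ^ m)"
proof (induction m)
  case (Suc m)
  have "(x \<oplus> y) [^] (p ^ Suc m) = ((x \<oplus> y) [^] (p ^ m)) [^] p"
    using assms by (simp add: nat_pow_pow mult.commute)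
  also have "\<dots> = (x [^] (p ^ m)) [^] p \<oplus> (y [^] (p ^ m)) [^] p"
    unfolding Suc using assms by (intro frobenius_add) auto
  finally show ?case using assms by (simp add: nat_pow_pow mult.commute)
qed (use assms in simp)

lemma (in cring) frobenius_minus:
  assumes "Factorial_Ring.prime p" "add_pow R (p::nat) \<one> = \<zero>" "x \<in> carrier R"
  shows "(\<ominus> x) [^] (p ^ m) = \<ominus> (x [^] (p ^ m))"
proof -
  have "(\<ominus> x) [^] (p ^ m) \<oplus> x [^] (p ^ m) = (\<ominus> x \<oplus> x) [^] (p ^ m)"
    using assms by (intro frobenius_power_add[symmetric]) auto
  also have "\<dots> = \<zero>"
    using assms prime_gt_0_nat[OF assms(1)] by (simp add: l_neg nat_pow_zero)
  finally show ?thesis using assms by (metis minus_equality nat_pow_closed a_inv_closed)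
qed

lemma (in domain) nat_pow_eq_zero_imp:
  assumes "x \<in> carrier R" "x [^] (n::nat) = \<zero>"
  shows "x = \<zero>"
  using assms(2) by (induction n) (auto simp: integral_iff assms(1))

lemma (in domain) frobenius_inj:
  assumes "Factorial_Ring.prime p" "add_pow R (p::nat) \<one> = \<zero>"
    and xy: "x \<in> carrier R" "y \<in> carrier R" and eq: "x [^] (p ^ m) = y [^] (p ^ m)"
  shows "x = y"
proof -
  have "(x \<ominus> y) [^] (p ^ m) = x [^] (p ^ m) \<oplus> (\<ominus> y) [^] (p ^ m)"
    unfolding a_minus_def using assms by (intro frobenius_power_add) auto
  also have "\<dots> = \<zero>" using assms eq by (simp add: frobenius_minus r_neg)
  finally have "x \<ominus> y = \<zero>" using xy nat_pow_eq_zero_imp minus_closed by blast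
  then show ?thesis using xy by simp
qed

section \<open>Cohen's theorem\<close>

definition finitely_generated_ideal :: "('a, 'b) ring_scheme \<Rightarrow> 'a set \<Rightarrow> bool" where
  "finitely_generated_ideal R I \<longleftrightarrow> (\<exists>S\<subseteq>carrier R. finite S \<and> I = Idl\<^bsub>R\<^esub> S)"

lemma (in cring) mult_genideal_mem:
  assumes G: "G \<subseteq> carrier R" and a: "a \<in> carrier R" and r: "r \<in> Idl G"
  shows "a \<otimes> r \<in> Idl ((\<otimes>) a ` G)"
proof -
  have aG: "(\<otimes>) a ` G \<subseteq> carrier R" using G a by auto
  interpret J: ideal "Idl ((\<otimes>) a ` G)" R using genideal_ideal[OF aG] .
  have "ideal {x \<in> carrier R. a \<otimes> x \<in> Idl ((\<otimes>) a ` G)} R"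
    by (rule J.helper_max_prime[OF cring_axioms a])
  moreover have "G \<subseteq> {x \<in> carrier R. a \<otimes> x \<in> Idl ((\<otimes>) a ` G)}"
    using G genideal_self[OF aG] by auto
  ultimately have "Idl G \<subseteq> {x \<in> carrier R. a \<otimes> x \<in> Idl ((\<otimes>) a ` G)}"
    by (rule genideal_minimal)
  then show ?thesis using r by auto
qed

lemma (in ring) ideal_sum_incl:
  assumes I: "ideal I R" and J: "ideal J R"
  shows "I \<subseteq> I <+> J" "J \<subseteq> I <+> J"
proof -
  have "I \<union> J \<subseteq> carrier R"
    using ideal.Icarr[OF I] ideal.Icarr[OF J] by auto
  from genideal_self[OF this] union_genideal[OF assms]
  show "I \<subseteq> I <+> J" "J \<subseteq> I <+> J" by auto
qed

text \<open>If \<open>M + (a)\<close> is generated by elements \<open>m\<^sub>i + r\<^sub>i a\<close> with \<open>m\<^sub>i \<in> M\<close>, then every \<open>x \<in> M\<close> is \<open>f + r a\<close> with \<open>f\<close>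
  in the span of the \<open>m\<^sub>i\<close>; here \<open>r a = x - f \<in> M\<close>, so \<open>r\<close> lies in the colon ideal \<open>(M : a)\<close>. Hence the \<open>m\<^sub>i\<close>
  together with the multiples by \<open>a\<close> of generators of \<open>(M : a)\<close> generate \<open>M\<close>.\<close>

lemma (in cring) finitely_generated_from_colon:
  assumes M: "ideal M R" and a: "a \<in> carrier R"
    and sum: "finitely_generated_ideal R (M <+> PIdl a)"
    and colon: "finitely_generated_ideal R {x \<in> carrier R. a \<otimes> x \<in> M}"
  shows "finitely_generated_ideal R M"
proof -
  interpret M: ideal M R by fact
  interpret A: ideal "PIdl a" R using cgenideal_ideal[OF a] .
  obtain H where H: "H \<subseteq> carrier R" "finite H" "M <+> PIdl a = Idl H"
    using sum unfolding finitely_generated_ideal_def by auto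
  obtain G where G: "G \<subseteq> carrier R" "finite G" "{x \<in> carrier R. a \<otimes> x \<in> M} = Idl G"
    using colon unfolding finitely_generated_ideal_def by auto
  have "\<forall>h\<in>H. \<exists>m. m \<in> M \<and> (\<exists>r\<in>carrier R. h = m \<oplus> r \<otimes> a)"
  proof
    fix h assume "h \<in> H"
    then have "h \<in> M <+> PIdl a" using genideal_self[OF H(1)] H(3) by auto
    then show "\<exists>m. m \<in> M \<and> (\<exists>r\<in>carrier R. h = m \<oplus> r \<otimes> a)"
      unfolding set_add_def' cgenideal_def by blast
  qed
  then obtain m where m: "\<And>h. h \<in> H \<Longrightarrow> m h \<in> M \<and> (\<exists>r\<in>carrier R. h = m h \<oplus> r \<otimes> a)"
    by metis
  define F where "F = m ` H"
  have F: "F \<subseteq> M" "finite F" using m H(2) by (auto simp: F_def)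
  have FR: "F \<subseteq> carrier R" using F M.Icarr by auto
  have aG: "(\<otimes>) a ` G \<subseteq> M" using genideal_self[OF G(1)] G(3) by auto
  have aGR: "(\<otimes>) a ` G \<subseteq> carrier R" using G(1) a by auto
  define S where "S = F \<union> (\<otimes>) a ` G"
  have S: "S \<subseteq> carrier R" "finite S" "S \<subseteq> M"
    using FR aGR F aG G by (auto simp: S_def)
  interpret IF: ideal "Idl F" R using genideal_ideal[OF FR] .
  interpret IS: ideal "Idl S" R using genideal_ideal[OF S(1)] .
  have "M \<subseteq> Idl S"
  proof
    fix x assume x: "x \<in> M"
    have "H \<subseteq> Idl F <+> PIdl a"
    proof
      fix h assume "h \<in> H"
      with m[OF this] genideal_self[OF FR] show "h \<in> Idl F <+> PIdl a"
        unfolding set_add_def' cgenideal_def F_def by blast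
    qed
    then have "Idl H \<subseteq> Idl F <+> PIdl a"
      by (intro genideal_minimal add_ideals IF.is_ideal A.is_ideal)
    moreover have "x \<in> M <+> PIdl a"
      using x ideal_sum_incl(1)[OF M.is_ideal A.is_ideal] by auto
    ultimately obtain f r where fr: "f \<in> Idl F" "r \<in> carrier R" "x = f \<oplus> r \<otimes> a"
      using H(3) unfolding set_add_def' cgenideal_def by blast
    have fM: "f \<in> M" using fr(1) genideal_minimal[OF M.is_ideal F(1)] by auto
    have fR: "f \<in> carrier R" using IF.Icarr[OF fr(1)] .
    have "x \<ominus> f = (a \<otimes> r \<oplus> f) \<oplus> \<ominus> f"
      unfolding fr(3) minus_eq using fR fr(2) a by (simp only: a_comm m_comm m_closed)
    also have "\<dots> = a \<otimes> r"
      using fR fr(2) a by (simp only: a_assoc r_neg r_zero m_closed a_inv_closed)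
    finally have "a \<otimes> r = x \<ominus> f" by simp
    moreover have "x \<ominus> f \<in> M"
      unfolding minus_eq by (rule M.a_closed[OF x M.a_inv_closed[OF fM]])
    ultimately have "a \<otimes> r \<in> M" by (simp only:)
    with fr(2) have "r \<in> {x \<in> carrier R. a \<otimes> x \<in> M}" by blast
    then have "r \<in> Idl G" unfolding G(3) .
    then have "a \<otimes> r \<in> Idl ((\<otimes>) a ` G)" by (rule mult_genideal_mem[OF G(1) a])
    also have "\<dots> \<subseteq> Idl S" using S(1) by (intro subset_Idl_subset) (auto simp: S_def)
    finally have "r \<otimes> a \<in> Idl S" using fr a by (simp add: m_comm)
    moreover have "f \<in> Idl S"
      using fr(1) subset_Idl_subset[OF S(1), of F] by (auto simp: S_def)
    ultimately show "x \<in> Idl S" using fr(3) IS.a_closed by simp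
  qed
  moreover have "Idl S \<subseteq> M" by (rule genideal_minimal[OF M.is_ideal S(3)])
  ultimately show ?thesis
    using S unfolding finitely_generated_ideal_def by blast
qed

text \<open>Cohen's theorem. An ideal \<open>M\<close> maximal among those that are not finitely generated is prime: if
  \<open>a b \<in> M\<close> but \<open>a, b \<notin> M\<close>, then \<open>M + (a)\<close> and \<open>(M : a)\<close>, which contains \<open>b\<close>, are strictly larger than \<open>M\<close>, so
  they are finitely generated, and hence so is \<open>M\<close>.\<close>

theorem (in cring) noetherian_from_prime_ideals:
  assumes prime: "\<And>P. primeideal P R \<Longrightarrow> finitely_generated_ideal R P"
  shows "noetherian_ring R"
proof (rule ccontr)
  assume "\<not> noetherian_ring R"
  define Fam where "Fam = {I. ideal I R \<and> \<not> finitely_generated_ideal R I}"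
  have ne: "Fam \<noteq> {}"
    using \<open>\<not> noetherian_ring R\<close> noetherian_ringI
    unfolding Fam_def finitely_generated_ideal_def by blast
  have "\<exists>M\<in>Fam. \<forall>J\<in>Fam. M \<subseteq> J \<longrightarrow> J = M"
  proof (rule subset_Zorn_nonempty[OF ne])
    fix C assume C: "C \<noteq> {}" "subset.chain Fam C"
    have chain: "subset.chain {I. ideal I R} C"
      using C(2) unfolding pred_on.chain_def Fam_def by auto
    have id: "ideal (\<Union>C) R"
      using chain_Union_is_ideal[OF chain] C(1) by simp
    moreover have "\<not> finitely_generated_ideal R (\<Union>C)"
    proof
      assume "finitely_generated_ideal R (\<Union>C)"
      then obtain S where S: "S \<subseteq> carrier R" "finite S" "\<Union>C = Idl S"
        unfolding finitely_generated_ideal_def by auto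
      then obtain I where I: "I \<in> C" "S \<subseteq> I"
        using finite_subset_Union_chain[OF S(2) _ C] genideal_self[OF S(1)] by metis
      then have "ideal I R" "\<not> finitely_generated_ideal R I"
        using C(2) unfolding pred_on.chain_def Fam_def by auto
      moreover have "I = Idl S"
        using genideal_minimal[OF \<open>ideal I R\<close> I(2)] I(1) S(3) by auto
      ultimately show False using S unfolding finitely_generated_ideal_def by auto
    qed
    ultimately show "\<Union>C \<in> Fam" unfolding Fam_def by simp
  qed
  then obtain M where M: "ideal M R" "\<not> finitely_generated_ideal R M"
    and max: "\<And>J. ideal J R \<Longrightarrow> M \<subset> J \<Longrightarrow> finitely_generated_ideal R J"
    unfolding Fam_def by blast
  interpret M: ideal M R by fact
  have "carrier R \<noteq> M"
  proof
    assume "carrier R = M"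
    then have "M = Idl {\<one>}" using genideal_one by simp
    moreover have "finitely_generated_ideal R (Idl {\<one>})"
      unfolding finitely_generated_ideal_def
      by (rule exI[of _ "{\<one>}"]) (simp add: one_closed)
    ultimately show False using M(2) by simp
  qed
  moreover have "\<not> primeideal M R" using prime M(2) by auto
  ultimately obtain a b where ab: "a \<in> carrier R" "b \<in> carrier R" "a \<otimes> b \<in> M" "a \<notin> M" "b \<notin> M"
    using M.primeidealCD[OF cring_axioms] by metis
  interpret A: ideal "PIdl a" R using cgenideal_ideal[OF ab(1)] .
  have "finitely_generated_ideal R (M <+> PIdl a)"
  proof (rule max)
    show "ideal (M <+> PIdl a) R" by (rule add_ideals[OF M.is_ideal A.is_ideal])
  next
    have "M \<subseteq> M <+> PIdl a"
      by (rule ideal_sum_incl(1)[OF M.is_ideal A.is_ideal])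
    moreover have "a \<in> M <+> PIdl a"
      by (rule subsetD[OF ideal_sum_incl(2)[OF M.is_ideal A.is_ideal] cgenideal_self[OF ab(1)]])
    ultimately show "M \<subset> M <+> PIdl a" using ab(4) by (metis psubsetI)
  qed
  moreover have "finitely_generated_ideal R {x \<in> carrier R. a \<otimes> x \<in> M}"
  proof (rule max)
    show "ideal {x \<in> carrier R. a \<otimes> x \<in> M} R" by (rule M.helper_max_prime[OF cring_axioms ab(1)])
    have "M \<subseteq> {x \<in> carrier R. a \<otimes> x \<in> M}"
      by (intro subsetI CollectI conjI M.Icarr M.I_l_closed[OF _ ab(1)])
    moreover have "b \<in> {x \<in> carrier R. a \<otimes> x \<in> M}" using ab(2,3) by (intro CollectI conjI)
    ultimately show "M \<subset> {x \<in> carrier R. a \<otimes> x \<in> M}" using ab(5) by (metis psubsetI)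
  qed
  ultimately show False
    using finitely_generated_from_colon[OF M(1) ab(1)] M(2) by simp
qed

section \<open>Polynomials of bounded degree\<close>

text \<open>The polynomial expressions in \<open>t\<close> of degree below \<open>n\<close> over \<open>H\<close>. The recursion splits off the coefficient of the
  top power, on which the arguments about ideals of leading coefficients and about linear
  independence proceed.\<close>

primrec bounded_polys :: "('a, 'b) ring_scheme \<Rightarrow> 'a set \<Rightarrow> 'a \<Rightarrow> nat \<Rightarrow> 'a set" where
  "bounded_polys R H t 0 = {\<zero>\<^bsub>R\<^esub>}"
| "bounded_polys R H t (Suc n) =
     {h \<otimes>\<^bsub>R\<^esub> t [^]\<^bsub>R\<^esub> n \<oplus>\<^bsub>R\<^esub> y | h y. h \<in> H \<and> y \<in> bounded_polys R H t n}"

context cring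
begin

context
  fixes H t assumes H: "subring H R" and t: "t \<in> carrier R"
begin

lemmas H_props = subringE[OF H]

lemma bounded_polys_carrier: "y \<in> bounded_polys R H t n \<Longrightarrow> y \<in> carrier R"
  using H_props(1) t by (induction n arbitrary: y) (auto intro!: a_closed m_closed)

lemma bounded_polys_zero: "\<zero> \<in> bounded_polys R H t n"
proof (induction n)
  case (Suc n)
  have "\<zero> = \<zero> \<otimes> t [^] n \<oplus> \<zero>" using t by simp
  then show ?case using Suc H_props(2) by auto
qed simp

lemma bounded_polys_add:
  "x \<in> bounded_polys R H t n \<Longrightarrow> y \<in> bounded_polys R H t n \<Longrightarrow> x \<oplus> y \<in> bounded_polys R H t n"
proof (induction n arbitrary: x y)
  case (Suc n)
  then obtain h x' k y' where x: "x = h \<otimes> t [^] n \<oplus> x'" "h \<in> H" "x' \<in> bounded_polys R H t n"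
    and y: "y = k \<otimes> t [^] n \<oplus> y'" "k \<in> H" "y' \<in> bounded_polys R H t n" by auto
  have c: "h \<in> carrier R" "k \<in> carrier R" "x' \<in> carrier R" "y' \<in> carrier R"
    using x y H_props(1) bounded_polys_carrier by auto
  have "x \<oplus> y = (h \<oplus> k) \<otimes> t [^] n \<oplus> (x' \<oplus> y')"
    unfolding x(1) y(1) using c t by (simp add: l_distr a_ac)
  moreover have "h \<oplus> k \<in> H" using H_props(7) x y by simp
  ultimately show ?case using Suc.IH[OF x(3) y(3)] by auto
qed simp

lemma bounded_polys_smult:
  "x \<in> bounded_polys R H t n \<Longrightarrow> k \<in> H \<Longrightarrow> k \<otimes> x \<in> bounded_polys R H t n"
proof (induction n arbitrary: x)
  case 0
  then show ?case using H_props(1) by auto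
next
  case (Suc n)
  then obtain h x' where x: "x = h \<otimes> t [^] n \<oplus> x'" "h \<in> H" "x' \<in> bounded_polys R H t n" by auto
  have c: "h \<in> carrier R" "k \<in> carrier R" "x' \<in> carrier R"
    using x Suc.prems H_props(1) bounded_polys_carrier by auto
  have "k \<otimes> x = (k \<otimes> h) \<otimes> t [^] n \<oplus> k \<otimes> x'"
    unfolding x(1) using c t by (simp add: r_distr m_assoc)
  moreover have "k \<otimes> h \<in> H" using H_props(6) x Suc.prems by simp
  ultimately show ?case using Suc.IH[OF x(3) Suc.prems(2)] by auto
qed

lemma bounded_polys_uminus: "x \<in> bounded_polys R H t n \<Longrightarrow> \<ominus> x \<in> bounded_polys R H t n"
  using bounded_polys_smult[of x n "\<ominus> \<one>"] H_props(3,5) bounded_polys_carrier[of x n]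
  by (simp add: l_minus)

lemma bounded_polys_shift:
  "x \<in> bounded_polys R H t n \<Longrightarrow> x \<otimes> t \<oplus> k \<in> bounded_polys R H t (Suc n)" if "k \<in> H"
proof (induction n arbitrary: x)
  case 0
  have "\<zero> \<otimes> t \<oplus> k = k \<otimes> t [^] (0::nat) \<oplus> \<zero>" using that H_props(1) t by auto
  then show ?case using that 0 by auto
next
  case (Suc n)
  then obtain h x' where x: "x = h \<otimes> t [^] n \<oplus> x'" "h \<in> H" "x' \<in> bounded_polys R H t n" by auto
  have c: "h \<in> carrier R" "k \<in> carrier R" "x' \<in> carrier R"
    using x that H_props(1) bounded_polys_carrier by auto
  have "x \<otimes> t \<oplus> k = h \<otimes> t [^] Suc n \<oplus> (x' \<otimes> t \<oplus> k)"
    unfolding x(1) using c t by (simp add: l_distr m_assoc a_assoc)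
  then show ?case using Suc.IH[OF x(3)] x(2) by (subst bounded_polys.simps) blast
qed

lemma bounded_polys_mult_power:
  "x \<in> bounded_polys R H t n \<Longrightarrow> x \<otimes> t [^] j \<in> bounded_polys R H t (n + j)" for j :: nat
proof (induction j)
  case 0
  then show ?case using bounded_polys_carrier by simp
next
  case (Suc j)
  then have "(x \<otimes> t [^] j) \<otimes> t \<oplus> \<zero> \<in> bounded_polys R H t (Suc (n + j))"
    using bounded_polys_shift[OF H_props(2)] by auto
  then show ?case using Suc.prems bounded_polys_carrier t by (simp add: m_assoc)
qed

lemma simple_extension_bounded:
  assumes "x \<in> simple_extension H t" shows "\<exists>n. x \<in> bounded_polys R H t n"
  using assms
proof induction
  case zero
  show ?case by (intro exI[of _ 0]) simp
next
  case (lin k1 k2)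
  then show ?case using bounded_polys_shift by blast
qed

text \<open>The elements of \<open>simple_extension H t\<close> are built by Horner's scheme, along which all closure
  properties are inductions. No cancellation is involved, so zero divisors are allowed.\<close>

lemma simple_extension_subring_cring: "subring (simple_extension H t) R"
proof -
  have in_c: "simple_extension H t \<subseteq> carrier R"
    by (rule simple_extension_in_carrier[OF H_props(1) t])
  have add: "x \<oplus> y \<in> simple_extension H t"
    if "x \<in> simple_extension H t" "y \<in> simple_extension H t" for x y
    using that
  proof (induction arbitrary: y)
    case zero
    then show ?case using in_c by auto
  next
    case (lin k1 k2)
    have c: "k1 \<in> carrier R" "k2 \<in> carrier R" using lin in_c H_props(1) by auto
    from lin.prems show ?case
    proof cases
      case zero
      then show ?thesis using c t simple_extension.lin[OF lin(1,2)] by simp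
    next
      case (lin l1 l2)
      have cl: "l1 \<in> carrier R" "l2 \<in> carrier R" using lin in_c H_props(1) by auto
      have "k1 \<otimes> t \<oplus> k2 \<oplus> y = (k1 \<oplus> l1) \<otimes> t \<oplus> (k2 \<oplus> l2)"
        unfolding lin(1) using c cl t by (simp add: l_distr a_ac)
      then show ?thesis
        using simple_extension.lin[OF lin.IH H_props(7)[OF \<open>k2 \<in> H\<close> lin(3)]] lin by simp
    qed
  qed
  have smult: "k \<otimes> x \<in> simple_extension H t" if "x \<in> simple_extension H t" "k \<in> H" for k x
    using that
  proof induction
    case zero
    then show ?case using H_props(1) by auto
  next
    case (lin k1 k2)
    have "k1 \<in> carrier R" "k2 \<in> carrier R" "k \<in> carrier R" using lin in_c H_props(1) by auto
    then have "k \<otimes> (k1 \<otimes> t \<oplus> k2) = (k \<otimes> k1) \<otimes> t \<oplus> k \<otimes> k2"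
      using t by (simp add: r_distr m_assoc)
    then show ?case using lin simple_extension.lin H_props(6) by simp
  qed
  have mult: "x \<otimes> y \<in> simple_extension H t"
    if "x \<in> simple_extension H t" "y \<in> simple_extension H t" for x y
    using that
  proof induction
    case zero
    then show ?case using in_c by auto
  next
    case (lin k1 k2)
    have c: "k1 \<in> carrier R" "k2 \<in> carrier R" "y \<in> carrier R" using lin in_c H_props(1) by auto
    have "(k1 \<otimes> t \<oplus> k2) \<otimes> y = ((k1 \<otimes> y) \<otimes> t \<oplus> \<zero>) \<oplus> k2 \<otimes> y"
      using c t by (simp add: l_distr m_assoc m_comm[of t y])
    then show ?case
      using add[OF simple_extension.lin[OF lin.IH H_props(2)] smult[OF lin.prems lin(2)]]
        lin.prems by simp
  qed
  have incl: "H \<subseteq> simple_extension H t" by (rule simple_extension_incl[OF H_props(1) t])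
  show ?thesis
  proof (rule subringI[OF in_c _ _ mult add])
    show "\<one> \<in> simple_extension H t" using incl H_props(3) by auto
    fix h assume h: "h \<in> simple_extension H t"
    then show "\<ominus> h \<in> simple_extension H t"
      using smult[OF h H_props(5)[OF H_props(3)]] in_c by (auto simp: l_minus)
  qed
qed

end

text \<open>As \<open>s\<^sup>n \<in> H\<close>, multiplying an expression of degree below \<open>n\<close> by \<open>s\<close> yields one whose term of degree \<open>n\<close> is
  absorbed by the constant term.\<close>

lemma simple_extension_power_decomposition:
  assumes H: "subring H R" and s: "s \<in> carrier R" and n: "n > 0" and sn: "s [^] (n::nat) \<in> H"
    and x: "x \<in> simple_extension H s"
  shows "x \<in> bounded_polys R H s n"
  using x
proof induction
  case zero
  show ?case by (rule bounded_polys_zero[OF H s])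
next
  case (lin k1 k2)
  obtain m where m: "n = Suc m" using n by (cases n) auto
  obtain h y where hy: "k1 = h \<otimes> s [^] m \<oplus> y" "h \<in> H" "y \<in> bounded_polys R H s m"
    using lin.IH unfolding m by auto
  have c: "h \<in> carrier R" "y \<in> carrier R" "k2 \<in> carrier R"
    using hy lin subringE(1)[OF H] bounded_polys_carrier[OF H s] by auto
  have "k1 \<otimes> s \<oplus> k2 = y \<otimes> s \<oplus> (h \<otimes> s [^] n \<oplus> k2)"
    unfolding hy(1) m using c s by (simp add: l_distr m_assoc a_ac)
  moreover have "h \<otimes> s [^] n \<oplus> k2 \<in> H" using hy lin sn subringE(6,7)[OF H] by simp
  ultimately show ?case using bounded_polys_shift[OF H s _ hy(3)] unfolding m by simp
qed

end

section \<open>Hilbert's basis theorem inside a ring\<close>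

lemma (in noetherian_ring) ideal_seq_stabilizes:
  assumes I: "\<And>n. ideal (I n) R" and mono: "\<And>n. I n \<subseteq> I (Suc n)"
  obtains N where "\<And>n. I n \<subseteq> I N"
proof -
  have le: "I m \<subseteq> I n" if "m \<le> n" for m n using mono that by (rule lift_Suc_mono_le)
  have "subset.chain {J. ideal J R} (range I)"
    unfolding subset_chain_def
  proof (intro conjI ballI)
    fix J K assume "J \<in> range I" "K \<in> range I"
    then obtain m n where "J = I m" "K = I n" by auto
    then show "J \<subseteq> K \<or> K \<subseteq> J"
      using le[of m n] le[of n m] nat_le_linear[of m n] by metis
  next
    show "range I \<subseteq> {J. ideal J R}" using I by auto
  qed
  then have "\<Union> (range I) \<in> range I" by (intro ideal_chain_is_trivial) auto
  then obtain N where "\<Union> (range I) = I N" by auto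
  then have "I n \<subseteq> I N" for n by blast
  then show thesis by (rule that)
qed

lemma (in abelian_group) sum_rearrange:
  assumes "a \<in> carrier G" "b \<in> carrier G" "c \<in> carrier G"
  shows "a \<oplus> c = (a \<oplus> b) \<oplus> (c \<oplus> \<ominus> b)" and "c \<oplus> \<ominus> b = (a \<oplus> c) \<oplus> \<ominus> (a \<oplus> b)"
proof -
  have "(a \<oplus> b) \<oplus> (c \<oplus> \<ominus> b) = (a \<oplus> c) \<oplus> (b \<oplus> \<ominus> b)"
    using assms by (simp only: a_ac a_closed a_inv_closed)
  then show "a \<oplus> c = (a \<oplus> b) \<oplus> (c \<oplus> \<ominus> b)" using assms by (simp add: r_neg)
  have "(a \<oplus> c) \<oplus> \<ominus> (a \<oplus> b) = (c \<oplus> \<ominus> b) \<oplus> (a \<oplus> \<ominus> a)"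
    using assms by (simp only: minus_add a_ac a_closed a_inv_closed)
  then show "c \<oplus> \<ominus> b = (a \<oplus> c) \<oplus> \<ominus> (a \<oplus> b)" using assms by (simp add: r_neg)
qed

text \<open>The usual proof of Hilbert's basis theorem, carried out in the image \<open>A[t]\<close> of \<open>A[X]\<close> in an arbitrary
  \<open>A\<close>-algebra \<open>T\<close>. The coefficients of \<open>t\<^sup>n\<close> in the elements of \<open>Q\<close> that can be written with degree at most \<open>n\<close>
  form an ideal \<open>I n\<close> of \<open>A\<close>; these ideals increase, so they are constant from some \<open>N\<close> on, and elements
  of \<open>Q\<close> realising generators of \<open>I 0, \<dots>, I N\<close> generate \<open>Q \<inter> A[t]\<close>.\<close>

theorem polynomial_ideal_finitely_generated:
  assumes A: "noetherian_ring A" "cring A" and T: "cring T" and hom: "\<iota> \<in> ring_hom A T"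
    and t: "t \<in> carrier T" and Q: "ideal Q T"
  shows "\<exists>F\<subseteq>Q. finite F \<and> Q \<inter> ring.simple_extension T (\<iota> ` carrier A) t \<subseteq> Idl\<^bsub>T\<^esub> F"
proof -
  interpret A: noetherian_ring A by fact
  interpret A: cring A by fact
  interpret T: cring T by fact
  interpret h: ring_hom_ring A T \<iota>
    by (intro ring_hom_ringI2 A.ring_axioms T.ring_axioms hom)
  interpret Q: ideal Q T by fact
  define H where "H = \<iota> ` carrier A"
  have H: "subring H T" unfolding H_def by (rule h.img_is_subring[OF A.carrier_is_subring])
  note Hp = subringE[OF H]
  define P where "P = bounded_polys T H t"
  \<comment> \<open>The ideal of leading coefficients is formed for two ideals: for \<open>Q\<close>, and for the ideal generated by the
    candidate generators \<open>F\<close>.\<close>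
  define L where "L Q n = {a \<in> carrier A. \<exists>y\<in>P n. \<iota> a \<otimes>\<^bsub>T\<^esub> t [^]\<^bsub>T\<^esub> n \<oplus>\<^bsub>T\<^esub> y \<in> Q}"
    for n :: nat and Q
  define I where "I = L Q"
  have Pc: "y \<in> P n \<Longrightarrow> y \<in> carrier T" for y n
    unfolding P_def using T.bounded_polys_carrier[OF H t] .
  have L_ideal: "ideal (L Q n) A" if "ideal Q T" for n Q
  proof -
  interpret Q: ideal Q T by fact
  show ?thesis
  proof (rule idealI[OF A.ring_axioms])
    show "subgroup (L Q n) (add_monoid A)"
    proof (rule A.add.subgroupI)
      show "L Q n \<subseteq> carrier A" by (auto simp: L_def)
      have "\<zero>\<^bsub>A\<^esub> \<in> L Q n"
        unfolding L_def using T.bounded_polys_zero[OF H t, of n] Q.zero_closed t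
        by (auto simp: P_def intro!: bexI[of _ "\<zero>\<^bsub>T\<^esub>"])
      then show "L Q n \<noteq> {}" by auto
    next
      fix a assume "a \<in> L Q n"
      then obtain y where y: "a \<in> carrier A" "y \<in> P n" "\<iota> a \<otimes>\<^bsub>T\<^esub> t [^]\<^bsub>T\<^esub> n \<oplus>\<^bsub>T\<^esub> y \<in> Q"
        by (auto simp: L_def)
      have "\<iota> (\<ominus>\<^bsub>A\<^esub> a) \<otimes>\<^bsub>T\<^esub> t [^]\<^bsub>T\<^esub> n \<oplus>\<^bsub>T\<^esub> (\<ominus>\<^bsub>T\<^esub> y) = \<ominus>\<^bsub>T\<^esub> (\<iota> a \<otimes>\<^bsub>T\<^esub> t [^]\<^bsub>T\<^esub> n \<oplus>\<^bsub>T\<^esub> y)"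
        using y Pc t by (simp add: T.l_minus T.minus_add)
      then have "\<iota> (\<ominus>\<^bsub>A\<^esub> a) \<otimes>\<^bsub>T\<^esub> t [^]\<^bsub>T\<^esub> n \<oplus>\<^bsub>T\<^esub> (\<ominus>\<^bsub>T\<^esub> y) \<in> Q"
        using Q.a_inv_closed[OF y(3)] by (simp only:)
      moreover have "\<ominus>\<^bsub>T\<^esub> y \<in> P n" using T.bounded_polys_uminus[OF H t] y unfolding P_def by simp
      ultimately show "\<ominus>\<^bsub>A\<^esub> a \<in> L Q n" using y(1) unfolding L_def by blast
    next
      fix a b assume "a \<in> L Q n" "b \<in> L Q n"
      then obtain y z where y: "a \<in> carrier A" "y \<in> P n" "\<iota> a \<otimes>\<^bsub>T\<^esub> t [^]\<^bsub>T\<^esub> n \<oplus>\<^bsub>T\<^esub> y \<in> Q"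
        and z: "b \<in> carrier A" "z \<in> P n" "\<iota> b \<otimes>\<^bsub>T\<^esub> t [^]\<^bsub>T\<^esub> n \<oplus>\<^bsub>T\<^esub> z \<in> Q"
        by (auto simp: L_def)
      have "\<iota> (a \<oplus>\<^bsub>A\<^esub> b) \<otimes>\<^bsub>T\<^esub> t [^]\<^bsub>T\<^esub> n \<oplus>\<^bsub>T\<^esub> (y \<oplus>\<^bsub>T\<^esub> z) =
          (\<iota> a \<otimes>\<^bsub>T\<^esub> t [^]\<^bsub>T\<^esub> n \<oplus>\<^bsub>T\<^esub> y) \<oplus>\<^bsub>T\<^esub> (\<iota> b \<otimes>\<^bsub>T\<^esub> t [^]\<^bsub>T\<^esub> n \<oplus>\<^bsub>T\<^esub> z)"
        using y z Pc t by (simp add: T.l_distr T.a_ac)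
      then have "\<iota> (a \<oplus>\<^bsub>A\<^esub> b) \<otimes>\<^bsub>T\<^esub> t [^]\<^bsub>T\<^esub> n \<oplus>\<^bsub>T\<^esub> (y \<oplus>\<^bsub>T\<^esub> z) \<in> Q"
        using Q.a_closed[OF y(3) z(3)] by (simp only:)
      moreover have "y \<oplus>\<^bsub>T\<^esub> z \<in> P n" using T.bounded_polys_add[OF H t] y z unfolding P_def by simp
      ultimately show "a \<oplus>\<^bsub>A\<^esub> b \<in> L Q n" using y(1) z(1) unfolding L_def by auto
    qed
  next
    fix a x assume "a \<in> L Q n" and x: "x \<in> carrier A"
    then obtain y where y: "a \<in> carrier A" "y \<in> P n" "\<iota> a \<otimes>\<^bsub>T\<^esub> t [^]\<^bsub>T\<^esub> n \<oplus>\<^bsub>T\<^esub> y \<in> Q"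
      by (auto simp: L_def)
    have "\<iota> (x \<otimes>\<^bsub>A\<^esub> a) \<otimes>\<^bsub>T\<^esub> t [^]\<^bsub>T\<^esub> n \<oplus>\<^bsub>T\<^esub> (\<iota> x \<otimes>\<^bsub>T\<^esub> y) = \<iota> x \<otimes>\<^bsub>T\<^esub> (\<iota> a \<otimes>\<^bsub>T\<^esub> t [^]\<^bsub>T\<^esub> n \<oplus>\<^bsub>T\<^esub> y)"
      using x y Pc t by (simp add: T.r_distr T.m_assoc)
    then have "\<iota> (x \<otimes>\<^bsub>A\<^esub> a) \<otimes>\<^bsub>T\<^esub> t [^]\<^bsub>T\<^esub> n \<oplus>\<^bsub>T\<^esub> (\<iota> x \<otimes>\<^bsub>T\<^esub> y) \<in> Q"
      using Q.I_l_closed[OF y(3), of "\<iota> x"] x by (simp only: h.hom_closed)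
    moreover have "\<iota> x \<otimes>\<^bsub>T\<^esub> y \<in> P n"
      using T.bounded_polys_smult[OF H t] y x unfolding P_def H_def by simp
    ultimately show *: "x \<otimes>\<^bsub>A\<^esub> a \<in> L Q n" using x y(1) unfolding L_def by blast
    then show "a \<otimes>\<^bsub>A\<^esub> x \<in> L Q n" using x y(1) by (simp add: A.m_comm)
  qed
  qed
  have I_ideal: "ideal (I n) A" for n using L_ideal[OF Q] unfolding I_def .
  have I_mono: "I n \<subseteq> I (Suc n)" for n
  proof
    fix a assume "a \<in> I n"
    then obtain y where y: "a \<in> carrier A" "y \<in> P n" "\<iota> a \<otimes>\<^bsub>T\<^esub> t [^]\<^bsub>T\<^esub> n \<oplus>\<^bsub>T\<^esub> y \<in> Q"
      by (auto simp: I_def L_def)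
    have "\<iota> a \<otimes>\<^bsub>T\<^esub> t [^]\<^bsub>T\<^esub> Suc n \<oplus>\<^bsub>T\<^esub> (y \<otimes>\<^bsub>T\<^esub> t \<oplus>\<^bsub>T\<^esub> \<zero>\<^bsub>T\<^esub>) = (\<iota> a \<otimes>\<^bsub>T\<^esub> t [^]\<^bsub>T\<^esub> n \<oplus>\<^bsub>T\<^esub> y) \<otimes>\<^bsub>T\<^esub> t"
      using y Pc t by (simp add: T.l_distr T.m_assoc)
    then have "\<iota> a \<otimes>\<^bsub>T\<^esub> t [^]\<^bsub>T\<^esub> Suc n \<oplus>\<^bsub>T\<^esub> (y \<otimes>\<^bsub>T\<^esub> t \<oplus>\<^bsub>T\<^esub> \<zero>\<^bsub>T\<^esub>) \<in> Q"
      using Q.I_r_closed[OF y(3) t] by (simp only:)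
    moreover have "y \<otimes>\<^bsub>T\<^esub> t \<oplus>\<^bsub>T\<^esub> \<zero>\<^bsub>T\<^esub> \<in> P (Suc n)"
      using T.bounded_polys_shift[OF H t Hp(2)] y unfolding P_def by blast
    ultimately show "a \<in> I (Suc n)" using y(1) unfolding I_def L_def by blast
  qed
  obtain N where N: "\<And>n. I n \<subseteq> I N" using A.ideal_seq_stabilizes[of I, OF I_ideal I_mono] by auto
  have "\<exists>G. G \<subseteq> carrier A \<and> finite G \<and> I n = Idl\<^bsub>A\<^esub> G" for n
    using A.finetely_gen[OF I_ideal[of n]] by auto
  then obtain G where G: "\<And>n. G n \<subseteq> carrier A" "\<And>n. finite (G n)" "\<And>n. I n = Idl\<^bsub>A\<^esub> (G n)"
    by metis
  have "\<exists>y. \<forall>n. \<forall>a\<in>I n. y n a \<in> P n \<and> \<iota> a \<otimes>\<^bsub>T\<^esub> t [^]\<^bsub>T\<^esub> n \<oplus>\<^bsub>T\<^esub> y n a \<in> Q"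
    unfolding I_def L_def by (intro choice allI bchoice) auto
  then obtain y where y: "\<And>n a. a \<in> I n \<Longrightarrow> y n a \<in> P n"
      "\<And>n a. a \<in> I n \<Longrightarrow> \<iota> a \<otimes>\<^bsub>T\<^esub> t [^]\<^bsub>T\<^esub> n \<oplus>\<^bsub>T\<^esub> y n a \<in> Q"
    by blast
  define F where "F = (\<Union>n\<le>N. (\<lambda>a. \<iota> a \<otimes>\<^bsub>T\<^esub> t [^]\<^bsub>T\<^esub> n \<oplus>\<^bsub>T\<^esub> y n a) ` G n)"
  have GI: "G n \<subseteq> I n" for n using A.genideal_self[OF G(1)] G(3) by auto
  have F: "F \<subseteq> Q" "finite F" using y(2)[OF subsetD[OF GI]] G(2) by (auto simp: F_def)
  have FT: "F \<subseteq> carrier T" using F Q.Icarr by auto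
  interpret J: ideal "Idl\<^bsub>T\<^esub> F" T by (rule T.genideal_ideal[OF FT])
  have JQ: "Idl\<^bsub>T\<^esub> F \<subseteq> Q" by (rule T.genideal_minimal[OF Q F(1)])
  have lead: "\<exists>z\<in>P n. \<iota> a \<otimes>\<^bsub>T\<^esub> t [^]\<^bsub>T\<^esub> n \<oplus>\<^bsub>T\<^esub> z \<in> Idl\<^bsub>T\<^esub> F" if a: "a \<in> I n" for n a
  proof -
    define m where "m = min n N"
    have m: "m \<le> N" "m \<le> n" by (auto simp: m_def)
    have "a \<in> I m" using a N[of n] unfolding m_def min_def by auto
    moreover have "I m \<subseteq> L (Idl\<^bsub>T\<^esub> F) m"
      unfolding G(3)[of m]
    proof (rule A.genideal_minimal[OF L_ideal[OF J.is_ideal]], rule subsetI)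
      fix b assume b: "b \<in> G m"
      have "\<iota> b \<otimes>\<^bsub>T\<^esub> t [^]\<^bsub>T\<^esub> m \<oplus>\<^bsub>T\<^esub> y m b \<in> F" using b m(1) by (auto simp: F_def)
      then show "b \<in> L (Idl\<^bsub>T\<^esub> F) m"
        using T.genideal_self[OF FT] b G(1) y(1) GI unfolding L_def by blast
    qed
    ultimately obtain z where z: "a \<in> carrier A" "z \<in> P m"
        "\<iota> a \<otimes>\<^bsub>T\<^esub> t [^]\<^bsub>T\<^esub> m \<oplus>\<^bsub>T\<^esub> z \<in> Idl\<^bsub>T\<^esub> F"
      unfolding L_def by blast
    define j where "j = n - m"
    have n: "n = m + j" using m by (simp add: j_def)
    have "\<iota> a \<otimes>\<^bsub>T\<^esub> t [^]\<^bsub>T\<^esub> n \<oplus>\<^bsub>T\<^esub> z \<otimes>\<^bsub>T\<^esub> t [^]\<^bsub>T\<^esub> j =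
        (\<iota> a \<otimes>\<^bsub>T\<^esub> t [^]\<^bsub>T\<^esub> m \<oplus>\<^bsub>T\<^esub> z) \<otimes>\<^bsub>T\<^esub> t [^]\<^bsub>T\<^esub> j"
      unfolding n using z Pc t by (simp add: T.l_distr T.m_assoc T.nat_pow_mult)
    then have "\<iota> a \<otimes>\<^bsub>T\<^esub> t [^]\<^bsub>T\<^esub> n \<oplus>\<^bsub>T\<^esub> z \<otimes>\<^bsub>T\<^esub> t [^]\<^bsub>T\<^esub> j \<in> Idl\<^bsub>T\<^esub> F"
      using J.I_r_closed[OF z(3), of "t [^]\<^bsub>T\<^esub> j"] t by (simp only: T.nat_pow_closed)
    moreover have "z \<otimes>\<^bsub>T\<^esub> t [^]\<^bsub>T\<^esub> j \<in> P n"
      using T.bounded_polys_mult_power[OF H t] z(2) unfolding P_def n by blast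
    ultimately show ?thesis by blast
  qed
  have "z \<in> Idl\<^bsub>T\<^esub> F" if "z \<in> P n" "z \<in> Q" for n z
    using that
  proof (induction n arbitrary: z)
    case 0
    then show ?case by (simp add: P_def)
  next
    case (Suc n)
    then obtain a z' where z: "z = \<iota> a \<otimes>\<^bsub>T\<^esub> t [^]\<^bsub>T\<^esub> n \<oplus>\<^bsub>T\<^esub> z'" "a \<in> carrier A" "z' \<in> P n"
      by (auto simp: P_def H_def)
    then have "a \<in> I n" using Suc.prems unfolding I_def L_def by auto
    then obtain w where w: "w \<in> P n" "\<iota> a \<otimes>\<^bsub>T\<^esub> t [^]\<^bsub>T\<^esub> n \<oplus>\<^bsub>T\<^esub> w \<in> Idl\<^bsub>T\<^esub> F" using lead by auto
    have cl: "z' \<in> carrier T" "w \<in> carrier T" "\<iota> a \<otimes>\<^bsub>T\<^esub> t [^]\<^bsub>T\<^esub> n \<in> carrier T" using Pc z w t by auto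
    have eq: "z = (\<iota> a \<otimes>\<^bsub>T\<^esub> t [^]\<^bsub>T\<^esub> n \<oplus>\<^bsub>T\<^esub> w) \<oplus>\<^bsub>T\<^esub> (z' \<oplus>\<^bsub>T\<^esub> \<ominus>\<^bsub>T\<^esub> w)"
      unfolding z(1) by (rule T.sum_rearrange(1)[OF cl(3,2,1)])
    have "z' \<oplus>\<^bsub>T\<^esub> \<ominus>\<^bsub>T\<^esub> w = z \<oplus>\<^bsub>T\<^esub> \<ominus>\<^bsub>T\<^esub> (\<iota> a \<otimes>\<^bsub>T\<^esub> t [^]\<^bsub>T\<^esub> n \<oplus>\<^bsub>T\<^esub> w)"
      unfolding z(1) by (rule T.sum_rearrange(2)[OF cl(3,2,1)])
    then have "z' \<oplus>\<^bsub>T\<^esub> \<ominus>\<^bsub>T\<^esub> w \<in> Q"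
      using Suc.prems(2) w(2) JQ Q.a_closed Q.a_inv_closed by auto
    moreover have "z' \<oplus>\<^bsub>T\<^esub> \<ominus>\<^bsub>T\<^esub> w \<in> P n"
      using z w T.bounded_polys_add[OF H t] T.bounded_polys_uminus[OF H t] unfolding P_def by simp
    ultimately have "z' \<oplus>\<^bsub>T\<^esub> \<ominus>\<^bsub>T\<^esub> w \<in> Idl\<^bsub>T\<^esub> F" using Suc.IH by simp
    then show ?case using eq w(2) J.a_closed by simp
  qed
  then have "Q \<inter> T.simple_extension H t \<subseteq> Idl\<^bsub>T\<^esub> F"
    using T.simple_extension_bounded[OF H t] unfolding P_def by blast
  then show ?thesis using F unfolding H_def by blast
qed

section \<open>Fields generated by one element\<close>

lemma (in field) fractions_subfield:
  assumes S: "subring S R"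
  shows "subfield {x \<in> carrier R. \<exists>z\<in>S. z \<noteq> \<zero> \<and> x \<otimes> z \<in> S} R" (is "subfield ?F R")
proof (rule subfieldI'[OF subringI])
  note Sp = subringE[OF S]
  show "?F \<subseteq> carrier R" by auto
  show "\<one> \<in> ?F" using Sp(3) by (auto intro!: bexI[of _ \<one>])
  fix x assume "x \<in> ?F"
  then obtain z where x: "x \<in> carrier R" "z \<in> S" "z \<noteq> \<zero>" "x \<otimes> z \<in> S" by auto
  have z: "z \<in> carrier R" using x Sp(1) by auto
  have "\<ominus> x \<otimes> z \<in> S" using Sp(5)[OF x(4)] x z by (simp add: l_minus)
  then show "\<ominus> x \<in> ?F" using x by auto
  fix y assume "y \<in> ?F"
  then obtain w where y: "y \<in> carrier R" "w \<in> S" "w \<noteq> \<zero>" "y \<otimes> w \<in> S" by auto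
  have w: "w \<in> carrier R" using y Sp(1) by auto
  have zw: "z \<otimes> w \<in> S" "z \<otimes> w \<noteq> \<zero>"
    using x y z w Sp(6) integral by auto
  have "(x \<otimes> y) \<otimes> (z \<otimes> w) = (x \<otimes> z) \<otimes> (y \<otimes> w)" using x y z w by (simp add: m_ac)
  then have "(x \<otimes> y) \<otimes> (z \<otimes> w) \<in> S" using Sp(6)[OF x(4) y(4)] by simp
  then show "x \<otimes> y \<in> ?F" using zw x y by auto
  have "(x \<oplus> y) \<otimes> (z \<otimes> w) = (x \<otimes> z) \<otimes> w \<oplus> (y \<otimes> w) \<otimes> z"
    using x y z w by (simp add: m_ac l_distr r_distr)
  then have "(x \<oplus> y) \<otimes> (z \<otimes> w) \<in> S"
    using Sp(7)[OF Sp(6)[OF x(4) y(2)] Sp(6)[OF y(4) x(2)]] by simp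
  then show "x \<oplus> y \<in> ?F" using zw x y by auto
next
  note Sp = subringE[OF S]
  fix x assume "x \<in> ?F - {\<zero>}"
  then obtain z where x: "x \<in> carrier R" "x \<noteq> \<zero>" "z \<in> S" "z \<noteq> \<zero>" "x \<otimes> z \<in> S" by auto
  have z: "z \<in> carrier R" using x Sp(1) by auto
  have ix: "inv x \<in> carrier R" "inv x \<otimes> x = \<one>" using x field_Units by auto
  have "inv x \<otimes> (x \<otimes> z) = z" using ix x z by (simp add: m_assoc[symmetric])
  moreover have "x \<otimes> z \<noteq> \<zero>" using x z integral by auto
  ultimately show "inv x \<in> ?F" using ix x by auto
qed

lemma (in field) generate_field_simple_fraction:
  assumes K: "subring K R" and x: "x \<in> carrier R" and y: "y \<in> generate_field R (K \<union> {x})"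
  shows "\<exists>z\<in>simple_extension K x. z \<noteq> \<zero> \<and> y \<otimes> z \<in> simple_extension K x"
proof -
  have S: "subring (simple_extension K x) R" by (rule simple_extension_subring_cring[OF K x])
  note Sp = subringE[OF S]
  have incl: "K \<union> {x} \<subseteq> simple_extension K x"
    using simple_extension_incl[OF subringE(1)[OF K] x] simple_extension_mem[OF K x] by auto
  let ?F = "{y \<in> carrier R. \<exists>z\<in>simple_extension K x. z \<noteq> \<zero> \<and> y \<otimes> z \<in> simple_extension K x}"
  have "K \<union> {x} \<subseteq> ?F"
  proof
    fix y assume "y \<in> K \<union> {x}"
    then have "y \<in> simple_extension K x" using incl by blast
    then show "y \<in> ?F" using Sp(1,3) by (auto intro!: bexI[of _ \<one>])
  qed
  moreover have "K \<union> {x} \<subseteq> carrier R" using incl Sp(1) by blast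
  ultimately have "generate_field R (K \<union> {x}) \<subseteq> ?F"
    using generate_field_min_subfield1 fractions_subfield[OF S] by blast
  then show ?thesis using y by blast
qed

section \<open>Purely inseparable elements\<close>

lemma (in domain) factor_of_prime_power:
  assumes q: "prime R q" "q \<in> carrier R" "q \<noteq> \<zero>"
    and "a \<in> carrier R" "b \<in> carrier R" "a \<otimes> b = q [^] (n::nat)"
  shows "\<exists>i\<le>n. \<exists>u\<in>Units R. a = u \<otimes> q [^] i"
  using assms(4-6)
proof (induction n arbitrary: a b)
  case 0
  then have "a divides \<one>" unfolding factor_def by (auto intro!: bexI[of _ b])
  then have "a \<in> Units R" using divides_one 0 by simp
  then show ?case using 0 by (intro exI[of _ 0]) (auto intro!: bexI[of _ a])
next
  case (Suc n)
  have "q divides a \<otimes> b"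
    unfolding factor_def Suc.prems(3) using q by (auto simp: m_comm intro!: bexI[of _ "q [^] n"])
  then have "q divides a \<or> q divides b"
    using q Suc.prems unfolding prime_def by blast
  then show ?case
  proof
    assume "q divides a"
    then obtain a' where a': "a' \<in> carrier R" "a = q \<otimes> a'" unfolding factor_def by auto
    have "q \<otimes> (a' \<otimes> b) = a \<otimes> b"
      unfolding a'(2) using Suc.prems(2) a'(1) q(2) by (simp only: m_assoc)
    also have "\<dots> = q \<otimes> q [^] n"
      unfolding Suc.prems(3) using q(2) nat_pow_Suc2 by simp
    finally have "q \<otimes> (a' \<otimes> b) = q \<otimes> q [^] n" .
    then have "a' \<otimes> b = q [^] n"
      using q a' Suc.prems by (simp add: m_lcancel)
    then obtain i u where iu: "i \<le> n" "u \<in> Units R" "a' = u \<otimes> q [^] i"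
      using Suc.IH[OF a'(1) Suc.prems(2)] by auto
    have "a = u \<otimes> q [^] Suc i"
      unfolding a'(2) iu(3) using q iu(2) by (simp add: m_ac Units_closed)
    then show ?thesis using iu by (intro exI[of _ "Suc i"]) auto
  next
    assume "q divides b"
    then obtain b' where b': "b' \<in> carrier R" "b = q \<otimes> b'" unfolding factor_def by auto
    have "q \<otimes> (a \<otimes> b') = a \<otimes> b"
      unfolding b'(2) using Suc.prems(1) b'(1) q(2) by (simp only: m_lcomm)
    also have "\<dots> = q \<otimes> q [^] n"
      unfolding Suc.prems(3) using q(2) nat_pow_Suc2 by simp
    finally have "q \<otimes> (a \<otimes> b') = q \<otimes> q [^] n" .
    then have "a \<otimes> b' = q [^] n"
      using q b' Suc.prems by (simp add: m_lcancel)
    then obtain i u where iu: "i \<le> n" "u \<in> Units R" "a = u \<otimes> q [^] i"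
      using Suc.IH[OF Suc.prems(1) b'(1)] by auto
    then show ?thesis by (intro exI[of _ i]) auto
  qed
qed

text \<open>\<open>(X + s)\<^sup>i = X\<^sup>i + i s X\<^sup>i\<^sup>-\<^sup>1 + \<dots>\<close>: the second coefficient determines \<open>s\<close> as long as \<open>i\<close> is invertible.\<close>

lemma (in domain) coeff_linear_power:
  assumes s: "s \<in> carrier R"
  defines "q \<equiv> [\<one>, s]"
  shows "coeff (q [^]\<^bsub>poly_ring R\<^esub> (i::nat)) i = \<one>"
    and "coeff (q [^]\<^bsub>poly_ring R\<^esub> Suc i) i = add_pow R (Suc i) s"
proof -
  let ?P = "poly_ring R"
  interpret P: domain ?P by (rule univ_poly_is_domain[OF carrier_is_subring])
  have qP: "q \<in> carrier ?P"
    using s by (auto simp: q_def univ_poly_def polynomial_def)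
  have rec: "coeff (q [^]\<^bsub>?P\<^esub> Suc i) n =
      (if n = 0 then \<zero> else coeff (q [^]\<^bsub>?P\<^esub> i) (n - 1)) \<oplus> coeff (q [^]\<^bsub>?P\<^esub> i) n \<otimes> s" for i n :: nat
  proof -
    have pc: "set (q [^]\<^bsub>?P\<^esub> i) \<subseteq> carrier R"
      using P.nat_pow_closed[OF qP, of i] polynomial_incl univ_poly_carrier by blast
    have "coeff (q [^]\<^bsub>?P\<^esub> Suc i) n = coeff (poly_mult (q [^]\<^bsub>?P\<^esub> i) q) n"
      by (simp add: univ_poly_mult)
    also have "\<dots> = (\<Oplus>k\<in>{..n}. coeff (q [^]\<^bsub>?P\<^esub> i) k \<otimes> coeff q (n - k))"
      using pc s by (subst poly_mult_coeff) (auto simp: q_def)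
    also have "\<dots> = (if n = 0 then \<zero> else coeff (q [^]\<^bsub>?P\<^esub> i) (n - 1)) \<oplus> coeff (q [^]\<^bsub>?P\<^esub> i) n \<otimes> s"
    proof (cases n)
      case 0
      then show ?thesis using pc s by (simp add: q_def)
    next
      case (Suc m)
      let ?f = "\<lambda>k. coeff (q [^]\<^bsub>?P\<^esub> i) k \<otimes> coeff q (n - k)"
      have fc: "?f \<in> A \<rightarrow> carrier R" for A using pc s by (auto simp: q_def)
      have "finsum R ?f {..n} = ?f (Suc m) \<oplus> finsum R ?f {..m}"
        unfolding Suc using fc unfolding Suc by (rule finsum_Suc)
      also have "finsum R ?f {..m} = coeff (q [^]\<^bsub>?P\<^esub> i) m"
      proof -
        have "finsum R ?f {..m} = (\<Oplus>k\<in>{..m}. if m = k then coeff (q [^]\<^bsub>?P\<^esub> i) k else \<zero>)"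
          using pc s Suc by (intro finsum_cong') (auto simp: q_def)
        also have "\<dots> = coeff (q [^]\<^bsub>?P\<^esub> i) m"
          using pc by (intro finsum_singleton) auto
        finally show ?thesis .
      qed
      finally show ?thesis using Suc pc s by (simp add: q_def a_comm)
    qed
    finally show ?thesis .
  qed
  have big: "coeff (q [^]\<^bsub>?P\<^esub> i) n = \<zero>" if "n > i" for i n :: nat
    using that
  proof (induction i arbitrary: n)
    case 0
    then show ?case by (simp add: univ_poly_one)
  next
    case (Suc i)
    then show ?case unfolding rec using s by simp
  qed
  have lead: "coeff (q [^]\<^bsub>?P\<^esub> i) i = \<one>" for i :: nat
  proof (induction i)
    case 0
    then show ?case by (simp add: univ_poly_one)
  next
    case (Suc i)
    then show ?case unfolding rec using s by (simp add: big)
  qed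
  then show "coeff (q [^]\<^bsub>?P\<^esub> i) i = \<one>" .
  show "coeff (q [^]\<^bsub>?P\<^esub> Suc i) i = add_pow R (Suc i) s"
  proof (induction i)
    case 0
    then show ?case unfolding rec using s lead[of 0] by simp
  next
    case (Suc i)
    then show ?case using s lead[of "Suc i"] by (subst rec) simp
  qed
qed

lemma (in ring_hom_ring) hom_add_pow:
  "x \<in> carrier R \<Longrightarrow> h (add_pow R (n::nat) x) = add_pow S n (h x)"
  by (induction n) auto

lemma (in subring) add_pow_mem:
  assumes "ring R" "x \<in> H" shows "add_pow R (n::nat) x \<in> H"
proof -
  interpret ring R by fact
  have "subring H R" by unfold_locales
  from subringE[OF this] show ?thesis using assms(2) by (induction n) auto
qed

text \<open>The minimal polynomial \<open>g\<close> of \<open>s\<close> divides \<open>X\<^sup>p - s\<^sup>p = (X - s)\<^sup>p\<close>, so \<open>g = (X - s)\<^sup>i\<close> for some \<open>i \<le> p\<close>. Its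
  second coefficient \<open>- i s\<close> lies in \<open>L\<close>; if \<open>i < p\<close>, then \<open>i\<close> is invertible in \<open>L\<close> and \<open>s \<in> L\<close>.\<close>

lemma (in field) purely_inseparable_degree:
  assumes p: "Factorial_Ring.prime p" "add_pow R (p::nat) \<one> = \<zero>"
    and L: "subfield L R" and s: "s \<in> carrier R" "s [^] p \<in> L" "s \<notin> L"
  shows "(algebraic over L) s" and "degree (Irr L s) = p"
proof -
  let ?P = "poly_ring R"
  interpret P: domain ?P by (rule univ_poly_is_domain[OF carrier_is_subring])
  have Lr: "subring L R" by (rule subfieldE(1)[OF L])
  note Lp = subringE[OF Lr]
  define q where "q = [\<one>, \<ominus> s]"
  have qP: "q \<in> carrier ?P" using s by (auto simp: q_def univ_poly_def polynomial_def)
  interpret c: ring_hom_ring R ?P poly_of_const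
    using canonical_embedding_ring_hom[OF carrier_is_subring] by simp
  have charP: "add_pow ?P p \<one>\<^bsub>?P\<^esub> = \<zero>\<^bsub>?P\<^esub>"
    using c.hom_add_pow[of \<one> p] p(2) by simp
  have q_eq: "q = X \<oplus>\<^bsub>?P\<^esub> poly_of_const (\<ominus> s)"
    using s by (simp add: q_def var_def univ_poly_add poly_of_const_def)
  have XP: "X \<in> carrier ?P" by (rule var_closed(1)[OF carrier_is_subring])
  have "q [^]\<^bsub>?P\<^esub> p = X [^]\<^bsub>?P\<^esub> p \<oplus>\<^bsub>?P\<^esub> poly_of_const (\<ominus> s) [^]\<^bsub>?P\<^esub> p"
    unfolding q_eq using s by (intro P.frobenius_add p charP XP) auto
  also have "poly_of_const (\<ominus> s) [^]\<^bsub>?P\<^esub> p = poly_of_const (\<ominus> (s [^] p))"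
    using frobenius_minus[OF p s(1), of 1] s
    by (simp only: c.hom_nat_pow[symmetric] a_inv_closed power_one_right)
  finally have qp: "q [^]\<^bsub>?P\<^esub> p = X [^]\<^bsub>L[X]\<^esub> p \<oplus>\<^bsub>L[X]\<^esub> poly_of_const (\<ominus> (s [^] p))"
    by (simp add: univ_poly_add nat_pow_def univ_poly_def)
  interpret PL: domain "L[X]" by (rule univ_poly_is_domain[OF Lr])
  have "poly_of_const (\<ominus> (s [^] p)) \<in> carrier (L[X])"
    using Lp(5)[OF s(2)] unfolding poly_of_const_def univ_poly_def
    by (auto intro: normalize_gives_polynomial)
  then have qpL: "q [^]\<^bsub>?P\<^esub> p \<in> carrier (L[X])"
    unfolding qp using var_closed(1)[OF Lr] by auto
  interpret ev: ring_hom_ring ?P R "\<lambda>f. eval f s"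
    by (rule eval_ring_hom[OF carrier_is_subring s(1)])
  have "eval q s = \<zero>" using s by (simp add: q_def r_neg)
  then have ev0: "eval (q [^]\<^bsub>?P\<^esub> p) s = \<zero>"
    using ev.hom_nat_pow[OF qP, of p] prime_gt_0_nat[OF p(1)] by (simp add: nat_pow_zero)
  have qpne: "q [^]\<^bsub>?P\<^esub> p \<noteq> []"
    using polynomial_pow_not_zero[OF qP] by (simp add: q_def)
  show alg: "(algebraic over L) s"
    by (rule algebraicI[OF qpL qpne ev0])
  define g where "g = Irr L s"
  note Irr = IrrE[OF L s(1) alg, folded g_def]
  have gP: "g \<in> carrier ?P" using carrier_polynomial_shell[OF Lr Irr(1)] .
  obtain c where c: "c \<in> carrier ?P" "g \<otimes>\<^bsub>?P\<^esub> c = q [^]\<^bsub>?P\<^esub> p"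
    using Irr_minimal[OF L s(1) alg qpL ev0] unfolding pdivides_def factor_def g_def by auto
  have qirr: "pirreducible (carrier R) q"
    by (rule degree_one_imp_pirreducible[OF carrier_is_subfield qP]) (simp add: q_def)
  have "ring_prime\<^bsub>?P\<^esub> q"
    using qirr pprime_iff_pirreducible[OF carrier_is_subfield qP] by simp
  then have qprime: "prime ?P q" "q \<noteq> \<zero>\<^bsub>?P\<^esub>" unfolding ring_prime_def by auto
  obtain i u where i: "i \<le> p" and u: "u \<in> Units ?P" and g: "g = u \<otimes>\<^bsub>?P\<^esub> q [^]\<^bsub>?P\<^esub> i"
    using P.factor_of_prime_power[OF qprime(1) qP qprime(2) gP c] by auto
  obtain k where k: "u = [k]" "k \<in> carrier R - {\<zero>}"
    using u univ_poly_carrier_units by auto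
  have qiP: "polynomial (carrier R) (q [^]\<^bsub>?P\<^esub> i)"
    using P.nat_pow_closed[OF qP, of i] univ_poly_carrier by blast
  have g': "g = map (\<lambda>b. k \<otimes> b) (q [^]\<^bsub>?P\<^esub> i)"
    unfolding g k(1) univ_poly_mult by (rule poly_mult_const(1)[OF carrier_is_subring qiP k(2)])
  have gcoeff: "coeff g n = k \<otimes> coeff (q [^]\<^bsub>?P\<^esub> i) n" for n
    unfolding g' using k(2) by (simp add: scalar_coeff)
  have deg: "degree g = i"
    unfolding g' using polynomial_pow_degree[OF qP, of i] by (simp add: q_def)
  have gne: "g \<noteq> []" using pirreducible_degree[OF L Irr(1,2)] by auto
  have "coeff g i = \<one>" using lead_coeff_simp[OF gne] Irr(3) deg by simp
  moreover have lead: "coeff (q [^]\<^bsub>?P\<^esub> i) i = \<one>"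
    unfolding q_def using s by (intro coeff_linear_power(1)) auto
  ultimately have k1: "k = \<one>" using gcoeff[of i] k(2) by simp
  have "i \<ge> 1" using pirreducible_degree[OF L Irr(1,2)] deg by simp
  then obtain j where j: "i = Suc j" by (cases i) auto
  have "coeff g j = add_pow R i (\<ominus> s)"
    using gcoeff[of j] k1 s coeff_linear_power(2)[of "\<ominus> s" j] unfolding j q_def by simp
  moreover have "coeff g j \<in> L"
  proof -
    have "set g \<subseteq> L" using Irr(1) polynomial_incl unfolding univ_poly_def by auto
    moreover have "coeff g j \<in> set g \<union> {\<zero>}" unfolding coeff_img(3)[symmetric] by simp
    ultimately show ?thesis using Lp(2) by (metis Un_iff singletonD subsetD)
  qed
  ultimately have mem: "add_pow R i \<one> \<otimes> (\<ominus> s) \<in> L"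
    using s by (simp add: add_pow_ldistr)
  have "i = p"
  proof (rule ccontr)
    assume "i \<noteq> p"
    with i j have "0 < i" "i < p" by auto
    then have "coprime i p"
      using p(1) by (metis coprime_commute nat_dvd_not_less prime_imp_coprime)
    then obtain x y where xy: "i * x = p * y + 1"
      using bezout_nat[of i p] \<open>0 < i\<close> by auto
    have "add_pow R (i * x) \<one> = \<one>"
      unfolding xy using p(2) by (simp add: add.nat_pow_mult[symmetric] add_pow_multiple_zero[OF p(2)])
    then have ne: "add_pow R i \<one> \<noteq> \<zero>"
      using add_pow_multiple_zero[of i \<one> "i * x"] by auto
    have "add_pow R i \<one> \<in> L"
      using subring.add_pow_mem[OF Lr ring_axioms Lp(3)] .
    then have "\<ominus> s \<in> L"
      using subfield_m_inv_simprule[OF L, of "add_pow R i \<one>" "\<ominus> s"] mem ne s(1) by auto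
    then have "s \<in> L" using Lp(5) s(1) by (metis minus_minus)
    then show False using s(3) by simp
  qed
  then show "degree (Irr L s) = p" using deg g_def by simp
qed

text \<open>The powers of \<open>s\<close> with exponents below the degree \<open>p\<close> of its minimal polynomial are linearly
  independent over \<open>L\<close>.\<close>

lemma (in field) bounded_polys_independent:
  assumes p: "Factorial_Ring.prime p" "add_pow R (p::nat) \<one> = \<zero>"
    and L: "subfield L R" and s: "s \<in> carrier R" "s [^] p \<in> L" "s \<notin> L"
    and n: "n < p" and h: "h \<in> L" and y: "y \<in> bounded_polys R L s n"
    and zero: "h \<otimes> s [^] n \<oplus> y = \<zero>"
  shows "h = \<zero>"
proof (rule ccontr)
  assume "h \<noteq> \<zero>"
  have LR: "L \<subseteq> carrier R" by (rule subfieldE(3)[OF L])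
  have "\<exists>l. set l \<subseteq> L \<and> length l = n \<and> eval l s = y"
    using y
  proof (induction n arbitrary: y)
    case (Suc n)
    then obtain a z where az: "y = a \<otimes> s [^] n \<oplus> z" "a \<in> L" "z \<in> bounded_polys R L s n" by auto
    from Suc.IH[OF az(3)] obtain l where "set l \<subseteq> L" "length l = n" "eval l s = z" by auto
    then show ?case using az by (intro exI[of _ "a # l"]) auto
  qed simp
  then obtain l where l: "set l \<subseteq> L" "length l = n" "eval l s = y" by auto
  have e: "eval (h # l) s = \<zero>" using l zero by simp
  have c: "h # l \<in> carrier (L[X])"
    using l h \<open>h \<noteq> \<zero>\<close> by (auto simp: univ_poly_def polynomial_def)
  note alg = purely_inseparable_degree[OF p L s]
  have "(Irr L s) pdivides (h # l)" by (rule Irr_minimal[OF L s(1) alg(1) c e])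
  then have "degree (Irr L s) \<le> degree (h # l)"
    using pdivides_imp_degree_le[OF subfieldE(1)[OF L] IrrE(1)[OF L s(1) alg(1)] c] by simp
  then show False using alg(2) l(2) n by simp
qed

text \<open>The coefficients of \<open>f\<close> generate a finite extension \<open>E\<close> of \<open>k\<close>, and \<open>E[x]\<close> is finite over \<open>E\<close>, hence over \<open>k\<close>.\<close>

lemma (in field) algebraic_over_algebraic:
  assumes k: "subfield k R" and f: "f \<in> carrier (poly_ring R)" "f \<noteq> []"
    and coeffs: "\<And>c. c \<in> set f \<Longrightarrow> (algebraic over k) c"
    and x: "x \<in> carrier R" "eval f x = \<zero>"
  shows "(algebraic over k) x"
proof -
  have fR: "set f \<subseteq> carrier R" "hd f \<noteq> \<zero>"
    using f unfolding univ_poly_def polynomial_def by auto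
  define E where "E = finite_extension k f"
  have E: "subfield E R" unfolding E_def by (rule finite_extension_is_subfield[OF k fR(1) coeffs])
  have finE: "finite_dimension k E"
    unfolding E_def by (rule finite_extension_finite_dimension(1)[OF k fR(1) coeffs])
  have "set f \<subseteq> E" unfolding E_def by (rule finite_extension_mem[OF subfieldE(1)[OF k] fR(1)])
  then have "f \<in> carrier (E[X])" using fR f by (auto simp: univ_poly_def polynomial_def)
  then have alg: "(algebraic over E) x" by (rule algebraicI[OF _ f(2) x(2)])
  have "finite_dimension E (simple_extension E x)"
    using finite_dimension_simple_extension[OF E x(1)] alg by simp
  then have "finite_dimension k (simple_extension E x)"
    using finE telescopic_base[OF k E] unfolding finite_dimension_def by blast
  then show ?thesis
    using finite_dimension_imp_algebraic[OF k simple_extension_is_subring[OF subfieldE(1)[OF E] x(1)]]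
      simple_extension_mem[OF subfieldE(1)[OF E] x(1)] by blast
qed

lemma (in cring) frobenius_hom:
  assumes "Factorial_Ring.prime p" "add_pow R (p::nat) \<one> = \<zero>"
  shows "ring_hom_ring R R (\<lambda>x. x [^] (p ^ m))"
  using assms by (intro ring_hom_ringI ring_axioms) (auto simp: frobenius_power_add nat_pow_distrib)

text \<open>For transcendental \<open>x\<close>, a \<open>p\<close>-th root \<open>g(x)/f(x)\<close> of \<open>x\<close> would give \<open>g\<^sup>p = X f\<^sup>p\<close> in \<open>K[X]\<close>, where the degrees
  differ modulo \<open>p\<close>.\<close>

lemma (in field) root_in_simple_field_imp_algebraic:
  assumes p: "Factorial_Ring.prime (p::nat)" and K: "subfield K R"
    and x: "x \<in> carrier R" and w: "w \<in> generate_field R (K \<union> {x})" "w [^] p = x"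
  shows "(algebraic over K) x"
proof (rule ccontr)
  assume "\<not> (algebraic over K) x"
  then have tr: "(transcendental over K) x" unfolding over_def by simp
  have Kr: "subring K R" by (rule subfieldE(1)[OF K])
  have "K \<union> {x} \<subseteq> carrier R" using subringE(1)[OF Kr] x by blast
  then have wR: "w \<in> carrier R" using generate_field_in_carrier w by blast
  obtain z where z: "z \<in> simple_extension K x" "z \<noteq> \<zero>" "w \<otimes> z \<in> simple_extension K x"
    using generate_field_simple_fraction[OF Kr x w(1)] by auto
  obtain f where f: "f \<in> carrier (K[X])" "z = eval f x"
    using z(1) simple_extension_as_eval_img[OF subringE(1)[OF Kr] x] by auto
  obtain g where g: "g \<in> carrier (K[X])" "w \<otimes> z = eval g x"
    using z(3) simple_extension_as_eval_img[OF subringE(1)[OF Kr] x] by auto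
  interpret P: domain "K[X]" by (rule univ_poly_is_domain[OF Kr])
  interpret ev: ring_hom_ring "K[X]" R "\<lambda>f. eval f x" by (rule eval_ring_hom[OF Kr x])
  have zR: "z \<in> carrier R" using f by simp
  have fne: "f \<noteq> []" using z f by auto
  have XK: "X \<in> carrier (K[X])" by (rule var_closed(1)[OF Kr])
  have "eval (g [^]\<^bsub>K[X]\<^esub> p) x = (w \<otimes> z) [^] p" using g ev.hom_nat_pow[OF g(1), of p] by simp
  also have "\<dots> = x \<otimes> z [^] p" using wR zR w(2) by (simp add: nat_pow_distrib)
  also have "\<dots> = eval (X \<otimes>\<^bsub>K[X]\<^esub> f [^]\<^bsub>K[X]\<^esub> p) x"
    using f XK x ev.hom_nat_pow[OF f(1), of p] ev.hom_mult[OF XK P.nat_pow_closed[OF f(1)], of p]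
    by (simp add: eval_var)
  finally have eq: "g [^]\<^bsub>K[X]\<^esub> p = X \<otimes>\<^bsub>K[X]\<^esub> f [^]\<^bsub>K[X]\<^esub> p"
    using tr f g XK unfolding over_def transcendental_def inj_on_def by auto
  have fp: "f [^]\<^bsub>K[X]\<^esub> p \<noteq> []" by (rule subring_polynomial_pow_not_zero[OF Kr f(1) fne])
  have "degree (X \<otimes>\<^bsub>K[X]\<^esub> f [^]\<^bsub>K[X]\<^esub> p) = degree X + degree (f [^]\<^bsub>K[X]\<^esub> p)"
    using poly_mult_degree_eq[OF Kr, of X "f [^]\<^bsub>K[X]\<^esub> p"] fp XK P.nat_pow_closed[OF f(1), of p]
    by (simp add: univ_poly_mult univ_poly_carrier var_def)
  then have "p * degree g = 1 + p * degree f"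
    using eq subring_polynomial_pow_degree[OF Kr f(1), of p] subring_polynomial_pow_degree[OF Kr g(1), of p]
    by (simp add: var_def)
  then have "p dvd 1" by (metis dvd_add_left_iff dvd_triv_left)
  then show False using prime_gt_1_nat[OF p] by simp
qed

text \<open>All \<open>\<tau> m\<close> lie in the finite extension \<open>K(\<tau> 0)\<close> of \<open>K\<close>. Let \<open>f\<close> and \<open>g\<close> be the minimal polynomials of \<open>\<tau> 0\<close> and
  \<open>\<tau> m\<close>. Raising the coefficients of \<open>g\<close> to the power \<open>p\<^sup>m\<close> gives a monic polynomial \<open>h\<close> with root
  \<open>(\<tau> m)^(p^m) = \<tau> 0\<close>, so \<open>f\<close> divides \<open>h\<close>; as \<open>deg h = deg g \<le> [K(\<tau> 0) : K] = deg f\<close>, the two are equal.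
  So every coefficient of \<open>f\<close> is a \<open>p\<^sup>m\<close>-th power in \<open>K\<close> for every \<open>m\<close>.\<close>

theorem (in field) root_chain_algebraic:
  assumes p: "Factorial_Ring.prime p" "add_pow R (p::nat) \<one> = \<zero>"
    and K: "subfield K R" and k: "subfield k R"
    and \<tau>: "\<And>m::nat. \<tau> m \<in> carrier R" "\<And>m. \<tau> (Suc m) [^] p = \<tau> m"
    and gen: "\<And>m. \<tau> (Suc m) \<in> generate_field R (K \<union> {\<tau> m})"
    and sharp: "\<And>c. c \<in> K \<Longrightarrow> \<forall>m. \<exists>d\<in>K. d [^] (p ^ m) = c \<Longrightarrow> (algebraic over k) c"
  shows "(algebraic over k) (\<tau> 0)"
proof -
  have Kr: "subring K R" by (rule subfieldE(1)[OF K])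
  note Kp = subringE[OF Kr]
  define E where "E = simple_extension K (\<tau> 0)"
  have alg0: "(algebraic over K) (\<tau> 0)"
    by (rule root_in_simple_field_imp_algebraic[OF p(1) K \<tau>(1) gen \<tau>(2)])
  have Er: "subring E R" unfolding E_def by (rule simple_extension_is_subring[OF Kr \<tau>(1)])
  have E: "subfield E R" unfolding E_def using simple_extension_is_subfield[OF K \<tau>(1)] alg0 by simp
  have KE: "K \<subseteq> E" unfolding E_def by (rule simple_extension_incl[OF Kp(1) \<tau>(1)])
  have tE: "\<tau> m \<in> E" for m
  proof (induction m)
    case 0
    show ?case unfolding E_def by (rule simple_extension_mem[OF Kr \<tau>(1)])
  next
    case (Suc m)
    have "generate_field R (K \<union> {\<tau> m}) \<subseteq> E"
      using KE Suc Kp(1) \<tau>(1) by (intro generate_field_min_subfield1 E) auto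
    then show ?case using gen by blast
  qed
  have tpow: "\<tau> m [^] (p ^ m) = \<tau> 0" for m
  proof (induction m)
    case 0
    then show ?case using \<tau>(1) by simp
  next
    case (Suc m)
    have "\<tau> (Suc m) [^] (p ^ Suc m) = (\<tau> (Suc m) [^] p) [^] (p ^ m)"
      using \<tau>(1) by (simp add: nat_pow_pow)
    then show ?case using Suc \<tau>(2) by simp
  qed
  define f where "f = Irr K (\<tau> 0)"
  note f = IrrE[OF K \<tau>(1) alg0, folded f_def]
  have dim: "dimension (degree f) K E"
    unfolding f_def E_def by (rule dimension_simple_extension[OF K \<tau>(1) alg0])
  have root: "\<exists>d\<in>K. d [^] (p ^ m) = c" if c: "c \<in> set f" for c m
  proof -
    have alg: "(algebraic over K) (\<tau> m)"
      using simple_extesion_mem_imp_algebraic[OF K \<tau>(1) alg0] tE unfolding E_def by blast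
    define g where "g = Irr K (\<tau> m)"
    note g = IrrE[OF K \<tau>(1) alg, folded g_def]
    have gK: "set g \<subseteq> K" and gR: "set g \<subseteq> carrier R" and gne: "g \<noteq> []"
      using g(1) pirreducible_degree[OF K g(1,2)] Kp(1) by (auto simp: univ_poly_def polynomial_def)
    have fne: "f \<noteq> []" using pirreducible_degree[OF K f(1,2)] by auto
    have "set (exp_base (\<tau> m) (degree g)) \<subseteq> E"
    proof -
      have "\<tau> m [^] i \<in> E" for i :: nat
        by (induction i) (auto simp: subringE(3)[OF Er] intro: subringE(6)[OF Er] tE)
      then show ?thesis unfolding exp_base_def by auto
    qed
    then have "length (exp_base (\<tau> m) (degree g)) \<le> degree f"
      using independent_length_le_dimension[OF K dim exp_base_independent[OF K \<tau>(1) alg]]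
      unfolding g_def by simp
    then have le: "degree g \<le> degree f" by (simp add: exp_base_def)
    interpret \<phi>: ring_hom_ring R R "\<lambda>x. x [^] (p ^ m)" by (rule frobenius_hom[OF p])
    define h where "h = map (\<lambda>x. x [^] (p ^ m)) g"
    have powK: "d [^] i \<in> K" if "d \<in> K" for d and i :: nat
      by (induction i) (auto simp: Kp(3) intro: Kp(6) that)
    have hK: "set h \<subseteq> K" using gK powK unfolding h_def by auto
    have hne: "h \<noteq> []" "hd h = \<one>" using gne g(3) unfolding h_def by (auto simp: hd_map)
    then have hc: "h \<in> carrier (K[X])" using hK by (auto simp: univ_poly_def polynomial_def)
    have "eval h (\<tau> 0) = (eval g (\<tau> m)) [^] (p ^ m)"
      using \<phi>.eval_hom'[OF \<tau>(1) gR] tpow unfolding h_def by simp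
    also have "\<dots> = \<zero>" unfolding g(4) using prime_gt_0_nat[OF p(1)] by (simp add: nat_pow_zero)
    finally have "f pdivides h"
      unfolding f_def by (intro Irr_minimal[OF K \<tau>(1) alg0 hc])
    then obtain u where u: "u \<in> carrier (K[X])" "h = f \<otimes>\<^bsub>K[X]\<^esub> u"
      using pdivides_iff_shell[OF K f(1) hc] unfolding factor_def by auto
    have une: "u \<noteq> []"
    proof
      assume "u = []"
      then have "h = []" using u(2) f(1) poly_mult_zero(2)[of f] Kp(1) polynomial_incl[of K f]
        by (auto simp: univ_poly_mult univ_poly_carrier)
      then show False using hne by simp
    qed
    have pu: "polynomial K u" "polynomial K f" using u(1) f(1) by (simp_all add: univ_poly_carrier)
    have "degree h = degree f + degree u"
      using poly_mult_degree_eq[OF Kr pu(2,1)] fne une u(2) by (simp add: univ_poly_mult)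
    then have "degree u = 0" using le unfolding h_def by simp
    then obtain a where a: "u = [a]" using une by (cases u) auto
    have "\<one> = \<one> \<otimes> a"
      using poly_mult_lead_coeff[OF Kr pu(2,1) fne une] u(2) hne(2) f(3) a by (simp add: univ_poly_mult)
    then have "u = [\<one>]" using a pu(1) Kp(1) by (auto simp: polynomial_def)
    then have "h = f"
      using u(2) poly_mult_one(2)[OF Kr pu(2)] by (simp add: univ_poly_mult)
    with c obtain d where "d \<in> set g" "c = d [^] (p ^ m)" unfolding h_def by auto
    then show ?thesis using gK by blast
  qed
  have "(algebraic over k) c" if "c \<in> set f" for c
  proof (rule sharp)
    show "c \<in> K" using that f(1) by (auto simp: univ_poly_def polynomial_def)
  qed (use root[OF that] in blast)
  moreover have "f \<noteq> []" using pirreducible_degree[OF K f(1,2)] by auto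
  ultimately show ?thesis
    using algebraic_over_algebraic[OF k carrier_polynomial_shell[OF Kr f(1)] _ _ \<tau>(1) f(4)] by blast
qed

section \<open>Quotient fields\<close>

context domain
begin

lemma fraction_self: "a \<in> carrier R \<Longrightarrow> b \<in> carrier R - {\<zero>} \<Longrightarrow> (a, b) \<in> fraction R a b"
  by (simp add: fraction_def)

lemma fraction_eq_iff:
  assumes "a \<in> carrier R" "b \<in> carrier R - {\<zero>}" "c \<in> carrier R" "d \<in> carrier R - {\<zero>}"
  shows "fraction R a b = fraction R c d \<longleftrightarrow> a \<otimes> d = c \<otimes> b"
proof
  assume "fraction R a b = fraction R c d"
  then have "(a, b) \<in> fraction R c d" using fraction_self[of a b] assms by simp
  then show "a \<otimes> d = c \<otimes> b" by (simp add: fraction_def)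
next
  have *: "fraction R a b \<subseteq> fraction R c d"
    if h: "a \<in> carrier R" "b \<in> carrier R - {\<zero>}" "c \<in> carrier R" "d \<in> carrier R - {\<zero>}"
      and eq: "a \<otimes> d = c \<otimes> b" for a b c d
  proof
    fix u assume "u \<in> fraction R a b"
    then obtain x y where u: "u = (x, y)" "x \<in> carrier R" "y \<in> carrier R - {\<zero>}" "a \<otimes> y = x \<otimes> b"
      by (auto simp: fraction_def)
    have "b \<otimes> (c \<otimes> y) = (c \<otimes> b) \<otimes> y" using h u by (simp add: m_ac)
    also have "\<dots> = d \<otimes> (a \<otimes> y)" unfolding eq[symmetric] using h u(2,3) by (simp add: m_ac)
    also have "\<dots> = b \<otimes> (x \<otimes> d)" unfolding u(4) using h u(2,3) by (simp add: m_ac)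
    finally have "c \<otimes> y = x \<otimes> d" using h u by (simp add: m_lcancel)
    then show "u \<in> fraction R c d" using u by (auto simp: fraction_def)
  qed
  assume "a \<otimes> d = c \<otimes> b"
  then show "fraction R a b = fraction R c d"
    using *[of a b c d] *[of c d a b] assms by auto
qed

lemma fraction_mem_eq:
  assumes "a \<in> carrier R" "b \<in> carrier R - {\<zero>}" "u \<in> fraction R a b"
  shows "fst u \<in> carrier R" "snd u \<in> carrier R - {\<zero>}" "a \<otimes> snd u = fst u \<otimes> b"
  using assms by (auto simp: fraction_def)

lemma fraction_mult:
  assumes ab: "a \<in> carrier R" "b \<in> carrier R - {\<zero>}" and cd: "c \<in> carrier R" "d \<in> carrier R - {\<zero>}"
  shows "fraction R a b \<otimes>\<^bsub>Qt R\<^esub> fraction R c d = fraction R (a \<otimes> c) (b \<otimes> d)"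
proof -
  have "fraction R (fst x \<otimes> fst y) (snd x \<otimes> snd y) = fraction R (a \<otimes> c) (b \<otimes> d)"
    if x: "x \<in> fraction R a b" and y: "y \<in> fraction R c d" for x y
  proof -
    note X = fraction_mem_eq[OF ab x] and Y = fraction_mem_eq[OF cd y]
    have "(fst x \<otimes> fst y) \<otimes> (b \<otimes> d) = (fst x \<otimes> b) \<otimes> (fst y \<otimes> d)"
      using X Y ab cd by (simp add: m_ac)
    also have "\<dots> = (a \<otimes> c) \<otimes> (snd x \<otimes> snd y)"
      unfolding X(3)[symmetric] Y(3)[symmetric] using X(1,2) Y(1,2) ab cd by (simp add: m_ac)
    finally show ?thesis
      using X(1,2) Y(1,2) ab cd by (subst fraction_eq_iff) (auto simp: integral_iff)
  qed
  then show ?thesis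
    using fraction_self[OF ab] fraction_self[OF cd] unfolding Qt_def by auto
qed

lemma fraction_add:
  assumes ab: "a \<in> carrier R" "b \<in> carrier R - {\<zero>}" and cd: "c \<in> carrier R" "d \<in> carrier R - {\<zero>}"
  shows "fraction R a b \<oplus>\<^bsub>Qt R\<^esub> fraction R c d = fraction R (a \<otimes> d \<oplus> c \<otimes> b) (b \<otimes> d)"
proof -
  have "fraction R (fst x \<otimes> snd y \<oplus> fst y \<otimes> snd x) (snd x \<otimes> snd y) = fraction R (a \<otimes> d \<oplus> c \<otimes> b) (b \<otimes> d)"
    if x: "x \<in> fraction R a b" and y: "y \<in> fraction R c d" for x y
  proof -
    note X = fraction_mem_eq[OF ab x] and Y = fraction_mem_eq[OF cd y]
    have "(fst x \<otimes> snd y \<oplus> fst y \<otimes> snd x) \<otimes> (b \<otimes> d) =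
        (fst x \<otimes> b) \<otimes> (snd y \<otimes> d) \<oplus> (fst y \<otimes> d) \<otimes> (snd x \<otimes> b)"
      using X Y ab cd by (simp add: m_ac l_distr r_distr)
    also have "\<dots> = (a \<otimes> d \<oplus> c \<otimes> b) \<otimes> (snd x \<otimes> snd y)"
      unfolding X(3)[symmetric] Y(3)[symmetric] using X(1,2) Y(1,2) ab cd
      by (simp add: m_ac l_distr r_distr)
    finally show ?thesis
      using X(1,2) Y(1,2) ab cd by (subst fraction_eq_iff) (auto simp: integral_iff)
  qed
  then show ?thesis
    using fraction_self[OF ab] fraction_self[OF cd] unfolding Qt_def by auto
qed

lemma Qt_one: "\<one>\<^bsub>Qt R\<^esub> = fraction R \<one> \<one>" and Qt_zero: "\<zero>\<^bsub>Qt R\<^esub> = fraction R \<zero> \<one>"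
  by (simp_all add: Qt_def)

lemma fraction_closed [intro]:
  "a \<in> carrier R \<Longrightarrow> b \<in> carrier R - {\<zero>} \<Longrightarrow> fraction R a b \<in> carrier (Qt R)"
  by (auto simp: Qt_def)

lemma Qt_cases:
  assumes "x \<in> carrier (Qt R)"
  obtains a b where "a \<in> carrier R" "b \<in> carrier R - {\<zero>}" "x = fraction R a b"
  using assms by (auto simp: Qt_def)

lemma Qt_cring: "cring (Qt R)"
proof (rule cringI)
  show "abelian_group (Qt R)"
  proof (rule abelian_groupI)
    fix x y z assume "x \<in> carrier (Qt R)" "y \<in> carrier (Qt R)" "z \<in> carrier (Qt R)"
    then obtain a b c d e f where
      "a \<in> carrier R" "b \<in> carrier R - {\<zero>}" "x = fraction R a b"
      "c \<in> carrier R" "d \<in> carrier R - {\<zero>}" "y = fraction R c d"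
      "e \<in> carrier R" "f \<in> carrier R - {\<zero>}" "z = fraction R e f"
      by (metis Qt_cases)
    then show "x \<oplus>\<^bsub>Qt R\<^esub> y \<oplus>\<^bsub>Qt R\<^esub> z = x \<oplus>\<^bsub>Qt R\<^esub> (y \<oplus>\<^bsub>Qt R\<^esub> z)"
      by (simp add: fraction_add integral_iff m_ac a_ac l_distr r_distr)
  next
    fix x y assume "x \<in> carrier (Qt R)" "y \<in> carrier (Qt R)"
    then obtain a b c d where
      "a \<in> carrier R" "b \<in> carrier R - {\<zero>}" "x = fraction R a b"
      "c \<in> carrier R" "d \<in> carrier R - {\<zero>}" "y = fraction R c d"
      by (metis Qt_cases)
    then show "x \<oplus>\<^bsub>Qt R\<^esub> y \<in> carrier (Qt R)" "x \<oplus>\<^bsub>Qt R\<^esub> y = y \<oplus>\<^bsub>Qt R\<^esub> x"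
      by (auto simp: fraction_add integral_iff m_ac a_ac intro!: fraction_closed)
  next
    show "\<zero>\<^bsub>Qt R\<^esub> \<in> carrier (Qt R)" by (auto simp: Qt_zero)
    fix x assume "x \<in> carrier (Qt R)"
    then obtain a b where x: "a \<in> carrier R" "b \<in> carrier R - {\<zero>}" "x = fraction R a b"
      by (metis Qt_cases)
    then show "\<zero>\<^bsub>Qt R\<^esub> \<oplus>\<^bsub>Qt R\<^esub> x = x" by (simp add: Qt_zero fraction_add)
    have "fraction R (\<ominus> a) b \<oplus>\<^bsub>Qt R\<^esub> x = \<zero>\<^bsub>Qt R\<^esub>"
      using x by (simp add: Qt_zero fraction_add fraction_eq_iff integral_iff l_minus l_neg)
    then show "\<exists>y\<in>carrier (Qt R). y \<oplus>\<^bsub>Qt R\<^esub> x = \<zero>\<^bsub>Qt R\<^esub>"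
      using x by (intro bexI[of _ "fraction R (\<ominus> a) b"]) auto
  qed
  show "comm_monoid (Qt R)"
  proof (rule comm_monoidI)
    fix x y z assume "x \<in> carrier (Qt R)" "y \<in> carrier (Qt R)" "z \<in> carrier (Qt R)"
    then obtain a b c d e f where
      "a \<in> carrier R" "b \<in> carrier R - {\<zero>}" "x = fraction R a b"
      "c \<in> carrier R" "d \<in> carrier R - {\<zero>}" "y = fraction R c d"
      "e \<in> carrier R" "f \<in> carrier R - {\<zero>}" "z = fraction R e f"
      by (metis Qt_cases)
    then show "x \<otimes>\<^bsub>Qt R\<^esub> y \<otimes>\<^bsub>Qt R\<^esub> z = x \<otimes>\<^bsub>Qt R\<^esub> (y \<otimes>\<^bsub>Qt R\<^esub> z)"
      by (simp add: fraction_mult integral_iff m_ac)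
  next
    fix x y assume "x \<in> carrier (Qt R)" "y \<in> carrier (Qt R)"
    then obtain a b c d where
      "a \<in> carrier R" "b \<in> carrier R - {\<zero>}" "x = fraction R a b"
      "c \<in> carrier R" "d \<in> carrier R - {\<zero>}" "y = fraction R c d"
      by (metis Qt_cases)
    then show "x \<otimes>\<^bsub>Qt R\<^esub> y \<in> carrier (Qt R)" "x \<otimes>\<^bsub>Qt R\<^esub> y = y \<otimes>\<^bsub>Qt R\<^esub> x"
      by (auto simp: fraction_mult integral_iff m_ac intro!: fraction_closed)
  next
    show "\<one>\<^bsub>Qt R\<^esub> \<in> carrier (Qt R)" by (auto simp: Qt_one)
    fix x assume "x \<in> carrier (Qt R)"
    then obtain a b where x: "a \<in> carrier R" "b \<in> carrier R - {\<zero>}" "x = fraction R a b"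
      by (metis Qt_cases)
    then show "\<one>\<^bsub>Qt R\<^esub> \<otimes>\<^bsub>Qt R\<^esub> x = x" by (simp add: Qt_one fraction_mult)
  qed
  fix x y z assume "x \<in> carrier (Qt R)" "y \<in> carrier (Qt R)" "z \<in> carrier (Qt R)"
  then obtain a b c d e f where
    "a \<in> carrier R" "b \<in> carrier R - {\<zero>}" "x = fraction R a b"
    "c \<in> carrier R" "d \<in> carrier R - {\<zero>}" "y = fraction R c d"
    "e \<in> carrier R" "f \<in> carrier R - {\<zero>}" "z = fraction R e f"
    by (metis Qt_cases)
  then show "(x \<oplus>\<^bsub>Qt R\<^esub> y) \<otimes>\<^bsub>Qt R\<^esub> z = x \<otimes>\<^bsub>Qt R\<^esub> z \<oplus>\<^bsub>Qt R\<^esub> y \<otimes>\<^bsub>Qt R\<^esub> z"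
    by (simp add: fraction_mult fraction_add fraction_eq_iff integral_iff m_ac l_distr r_distr)
qed

lemma Qt_field: "field (Qt R)"
proof -
  interpret Q: cring "Qt R" by (rule Qt_cring)
  show ?thesis
  proof (rule Q.cring_fieldI2)
    show "\<zero>\<^bsub>Qt R\<^esub> \<noteq> \<one>\<^bsub>Qt R\<^esub>" by (simp add: Qt_zero Qt_one fraction_eq_iff)
    fix x assume "x \<in> carrier (Qt R)" "x \<noteq> \<zero>\<^bsub>Qt R\<^esub>"
    then obtain a b where x: "a \<in> carrier R" "b \<in> carrier R - {\<zero>}" "x = fraction R a b" "a \<noteq> \<zero>"
      by (metis Qt_cases Qt_zero fraction_eq_iff l_null one_closed one_not_zero zero_closed
          DiffI DiffD1 singletonD)
    have "x \<otimes>\<^bsub>Qt R\<^esub> fraction R b a = \<one>\<^bsub>Qt R\<^esub>"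
      using x by (simp add: Qt_one fraction_mult fraction_eq_iff integral_iff m_comm)
    then show "\<exists>y\<in>carrier (Qt R). x \<otimes>\<^bsub>Qt R\<^esub> y = \<one>\<^bsub>Qt R\<^esub>"
      using x by (intro bexI[of _ "fraction R b a"]) auto
  qed
qed

lemma Qt_embed_hom: "(\<lambda>a. fraction R a \<one>) \<in> ring_hom R (Qt R)"
  by (rule ring_hom_memI) (auto simp: Qt_one fraction_mult fraction_add intro!: fraction_closed)

lemma Qt_embed_eq_zero_iff: "a \<in> carrier R \<Longrightarrow> fraction R a \<one> = \<zero>\<^bsub>Qt R\<^esub> \<longleftrightarrow> a = \<zero>"
  by (simp add: Qt_zero fraction_eq_iff)

lemma fraction_mult_denominator:
  "a \<in> carrier R \<Longrightarrow> b \<in> carrier R - {\<zero>} \<Longrightarrow>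
    fraction R a b \<otimes>\<^bsub>Qt R\<^esub> fraction R b \<one> = fraction R a \<one>"
  by (simp add: fraction_mult fraction_eq_iff)

end

definition fractions_over :: "('a, 'c) ring_scheme \<Rightarrow> 'a set \<Rightarrow> ('a \<times> 'a) set set" where
  "fractions_over R D = {fraction R a b | a b. a \<in> D \<and> b \<in> D - {\<zero>\<^bsub>R\<^esub>}}"

definition fraction_lift ::
    "('a, 'c) ring_scheme \<Rightarrow> 'a set \<Rightarrow> ('b, 'd) ring_scheme \<Rightarrow> ('a \<Rightarrow> 'b) \<Rightarrow> ('a \<times> 'a) set \<Rightarrow> 'b" where
  "fraction_lift R D F h U =
     (THE w. \<exists>a\<in>D. \<exists>b\<in>D - {\<zero>\<^bsub>R\<^esub>}. U = fraction R a b \<and> w = h a \<otimes>\<^bsub>F\<^esub> inv\<^bsub>F\<^esub> (h b))"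

text \<open>The quotient field of a subring \<open>D\<close> is realised inside that of \<open>R\<close>, since the map to be extended may be defined
  on \<open>D\<close> only.\<close>

lemma (in domain) fraction_lift:
  assumes D: "subring D R" and F: "cring F" and h: "h \<in> ring_hom (R\<lparr>carrier := D\<rparr>) F"
    and unit: "\<And>b. b \<in> D - {\<zero>} \<Longrightarrow> h b \<in> Units F"
  shows fraction_lift_eq: "\<And>a b. a \<in> D \<Longrightarrow> b \<in> D - {\<zero>} \<Longrightarrow>
      fraction_lift R D F h (fraction R a b) = h a \<otimes>\<^bsub>F\<^esub> inv\<^bsub>F\<^esub> (h b)"
    and fraction_lift_hom: "fraction_lift R D F h \<in> ring_hom ((Qt R)\<lparr>carrier := fractions_over R D\<rparr>) F"
proof -
  interpret F: cring F by fact
  note Dp = subringE[OF D]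
  have hc: "h a \<in> carrier F" if "a \<in> D" for a using ring_hom_closed[OF h] that by simp
  have hm: "h (a \<otimes> b) = h a \<otimes>\<^bsub>F\<^esub> h b" if "a \<in> D" "b \<in> D" for a b using ring_hom_mult[OF h] that by simp
  have ha: "h (a \<oplus> b) = h a \<oplus>\<^bsub>F\<^esub> h b" if "a \<in> D" "b \<in> D" for a b using ring_hom_add[OF h] that by simp
  have h1: "h \<one> = \<one>\<^bsub>F\<^esub>" using ring_hom_one[OF h] by simp
  have DR: "a \<in> carrier R" if "a \<in> D" for a using Dp(1) that by auto
  show eq: "fraction_lift R D F h (fraction R a b) = h a \<otimes>\<^bsub>F\<^esub> inv\<^bsub>F\<^esub> (h b)"
    if ab: "a \<in> D" "b \<in> D - {\<zero>}" for a b
    unfolding fraction_lift_def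
  proof (rule the_equality)
    show "\<exists>a'\<in>D. \<exists>b'\<in>D - {\<zero>}. fraction R a b = fraction R a' b' \<and>
        h a \<otimes>\<^bsub>F\<^esub> inv\<^bsub>F\<^esub> h b = h a' \<otimes>\<^bsub>F\<^esub> inv\<^bsub>F\<^esub> h b'"
      using ab by blast
    fix w assume "\<exists>a'\<in>D. \<exists>b'\<in>D - {\<zero>}. fraction R a b = fraction R a' b' \<and> w = h a' \<otimes>\<^bsub>F\<^esub> inv\<^bsub>F\<^esub> h b'"
    then obtain a' b' where ab': "a' \<in> D" "b' \<in> D - {\<zero>}" "fraction R a b = fraction R a' b'"
      and w: "w = h a' \<otimes>\<^bsub>F\<^esub> inv\<^bsub>F\<^esub> h b'" by blast
    have "a \<otimes> b' = a' \<otimes> b" using ab ab' DR fraction_eq_iff[of a b a' b'] by auto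
    then have e: "h a \<otimes>\<^bsub>F\<^esub> h b' = h a' \<otimes>\<^bsub>F\<^esub> h b" using hm ab ab' by (metis DiffD1)
    note u = unit[OF ab(2)] unit[OF ab'(2)]
    have c: "h a \<in> carrier F" "h a' \<in> carrier F" "h b \<in> carrier F" "h b' \<in> carrier F"
      "inv\<^bsub>F\<^esub> h b \<in> carrier F" "inv\<^bsub>F\<^esub> h b' \<in> carrier F"
      using hc ab ab' u by auto
    have "w = h a' \<otimes>\<^bsub>F\<^esub> inv\<^bsub>F\<^esub> h b' \<otimes>\<^bsub>F\<^esub> (h b \<otimes>\<^bsub>F\<^esub> inv\<^bsub>F\<^esub> h b)"
      unfolding w using c u by simp
    also have "\<dots> = (h a' \<otimes>\<^bsub>F\<^esub> h b) \<otimes>\<^bsub>F\<^esub> (inv\<^bsub>F\<^esub> h b' \<otimes>\<^bsub>F\<^esub> inv\<^bsub>F\<^esub> h b)"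
      using c by (simp only: F.m_ac F.m_closed)
    also have "\<dots> = h a \<otimes>\<^bsub>F\<^esub> inv\<^bsub>F\<^esub> h b \<otimes>\<^bsub>F\<^esub> (h b' \<otimes>\<^bsub>F\<^esub> inv\<^bsub>F\<^esub> h b')"
      unfolding e[symmetric] using c by (simp only: F.m_ac F.m_closed)
    also have "\<dots> = h a \<otimes>\<^bsub>F\<^esub> inv\<^bsub>F\<^esub> h b" using c u by simp
    finally show "w = h a \<otimes>\<^bsub>F\<^esub> inv\<^bsub>F\<^esub> h b" .
  qed
  have inv_m: "inv\<^bsub>F\<^esub> (h b \<otimes>\<^bsub>F\<^esub> h d) = inv\<^bsub>F\<^esub> (h b) \<otimes>\<^bsub>F\<^esub> inv\<^bsub>F\<^esub> (h d)"
    if "b \<in> D - {\<zero>}" "d \<in> D - {\<zero>}" for b d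
  proof (rule F.comm_inv_char)
    note u = unit[OF that(1)] unit[OF that(2)]
    have c: "h b \<in> carrier F" "h d \<in> carrier F" "inv\<^bsub>F\<^esub> h b \<in> carrier F" "inv\<^bsub>F\<^esub> h d \<in> carrier F"
      using hc that u by auto
    have "h b \<otimes>\<^bsub>F\<^esub> h d \<otimes>\<^bsub>F\<^esub> (inv\<^bsub>F\<^esub> h b \<otimes>\<^bsub>F\<^esub> inv\<^bsub>F\<^esub> h d) =
        (h b \<otimes>\<^bsub>F\<^esub> inv\<^bsub>F\<^esub> h b) \<otimes>\<^bsub>F\<^esub> (h d \<otimes>\<^bsub>F\<^esub> inv\<^bsub>F\<^esub> h d)"
      using c by (simp only: F.m_ac F.m_closed)
    then show "h b \<otimes>\<^bsub>F\<^esub> h d \<otimes>\<^bsub>F\<^esub> (inv\<^bsub>F\<^esub> h b \<otimes>\<^bsub>F\<^esub> inv\<^bsub>F\<^esub> h d) = \<one>\<^bsub>F\<^esub>"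
      using u by simp
  qed (use hc that unit in auto)
  show "fraction_lift R D F h \<in> ring_hom ((Qt R)\<lparr>carrier := fractions_over R D\<rparr>) F"
  proof (rule ring_hom_memI)
    fix x assume "x \<in> carrier ((Qt R)\<lparr>carrier := fractions_over R D\<rparr>)"
    then obtain a b where x: "a \<in> D" "b \<in> D - {\<zero>}" "x = fraction R a b"
      by (auto simp: fractions_over_def)
    show "fraction_lift R D F h x \<in> carrier F" using x hc unit by (simp add: eq)
    fix y assume "y \<in> carrier ((Qt R)\<lparr>carrier := fractions_over R D\<rparr>)"
    then obtain c d where y: "c \<in> D" "d \<in> D - {\<zero>}" "y = fraction R c d"
      by (auto simp: fractions_over_def)
    have cl: "h a \<in> carrier F" "h b \<in> carrier F" "h c \<in> carrier F" "h d \<in> carrier F"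
      "inv\<^bsub>F\<^esub> h b \<in> carrier F" "inv\<^bsub>F\<^esub> h d \<in> carrier F"
      using x y hc unit by auto
    have R: "a \<in> carrier R" "b \<in> carrier R - {\<zero>}" "c \<in> carrier R" "d \<in> carrier R - {\<zero>}"
      using x y DR by auto
    have bd: "b \<otimes> d \<in> D - {\<zero>}" using x y R Dp(6) by (auto simp: integral_iff)
    have ac: "a \<otimes> c \<in> D" "a \<otimes> d \<in> D" "c \<otimes> b \<in> D" "a \<otimes> d \<oplus> c \<otimes> b \<in> D"
      using x y Dp(6,7) by auto
    have "fraction_lift R D F h (x \<otimes>\<^bsub>Qt R\<^esub> y) = (h a \<otimes>\<^bsub>F\<^esub> h c) \<otimes>\<^bsub>F\<^esub> (inv\<^bsub>F\<^esub> h b \<otimes>\<^bsub>F\<^esub> inv\<^bsub>F\<^esub> h d)"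
      using x y bd ac R by (simp add: fraction_mult eq hm inv_m)
    also have "\<dots> = (h a \<otimes>\<^bsub>F\<^esub> inv\<^bsub>F\<^esub> h b) \<otimes>\<^bsub>F\<^esub> (h c \<otimes>\<^bsub>F\<^esub> inv\<^bsub>F\<^esub> h d)"
      using cl by (simp add: F.m_ac)
    finally show "fraction_lift R D F h (x \<otimes>\<^bsub>(Qt R)\<lparr>carrier := fractions_over R D\<rparr>\<^esub> y) =
        fraction_lift R D F h x \<otimes>\<^bsub>F\<^esub> fraction_lift R D F h y"
      using x y by (simp add: eq)
    have "fraction_lift R D F h (x \<oplus>\<^bsub>Qt R\<^esub> y) =
        (h a \<otimes>\<^bsub>F\<^esub> h d \<oplus>\<^bsub>F\<^esub> h c \<otimes>\<^bsub>F\<^esub> h b) \<otimes>\<^bsub>F\<^esub> (inv\<^bsub>F\<^esub> h b \<otimes>\<^bsub>F\<^esub> inv\<^bsub>F\<^esub> h d)"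
      using x y bd ac R by (simp add: fraction_add eq hm ha inv_m)
    also have "\<dots> = (h a \<otimes>\<^bsub>F\<^esub> inv\<^bsub>F\<^esub> h b) \<otimes>\<^bsub>F\<^esub> (h d \<otimes>\<^bsub>F\<^esub> inv\<^bsub>F\<^esub> h d) \<oplus>\<^bsub>F\<^esub>
        (h c \<otimes>\<^bsub>F\<^esub> inv\<^bsub>F\<^esub> h d) \<otimes>\<^bsub>F\<^esub> (h b \<otimes>\<^bsub>F\<^esub> inv\<^bsub>F\<^esub> h b)"
      using cl by (simp add: F.l_distr F.r_distr F.m_ac del: F.Units_r_inv F.Units_l_inv)
    also have "\<dots> = h a \<otimes>\<^bsub>F\<^esub> inv\<^bsub>F\<^esub> h b \<oplus>\<^bsub>F\<^esub> h c \<otimes>\<^bsub>F\<^esub> inv\<^bsub>F\<^esub> h d"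
      using cl unit[OF x(2)] unit[OF y(2)] by simp
    finally show "fraction_lift R D F h (x \<oplus>\<^bsub>(Qt R)\<lparr>carrier := fractions_over R D\<rparr>\<^esub> y) =
        fraction_lift R D F h x \<oplus>\<^bsub>F\<^esub> fraction_lift R D F h y"
      using x y by (simp add: eq)
  next
    show "fraction_lift R D F h \<one>\<^bsub>(Qt R)\<lparr>carrier := fractions_over R D\<rparr>\<^esub> = \<one>\<^bsub>F\<^esub>"
      using Dp(3) by (simp add: Qt_one eq h1)
  qed
qed

section \<open>Monoid algebras\<close>

locale monoid_algebra_setup = R: cring R + M: comm_monoid M
  for R :: "('r, 'c) ring_scheme" (structure) and M :: "('m, 'e) monoid_scheme"
begin

abbreviation F where "F \<equiv> monoid_algebra R M"
abbreviation supp where "supp f \<equiv> {x. f x \<noteq> \<zero>}"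

lemma carrier_iff:
  "f \<in> carrier F \<longleftrightarrow> (\<forall>x. f x \<in> carrier R) \<and> finite (supp f) \<and> supp f \<subseteq> carrier M"
  by (auto simp: monoid_algebra_def)

lemma memD:
  assumes "f \<in> carrier F"
  shows "f x \<in> carrier R" "finite (supp f)" "supp f \<subseteq> carrier M"
  using assms by (auto simp: carrier_iff)

lemma add_apply: "(f \<oplus>\<^bsub>F\<^esub> g) x = f x \<oplus> g x"
  and zero_apply: "\<zero>\<^bsub>F\<^esub> x = \<zero>"
  and one_eq: "\<one>\<^bsub>F\<^esub> = monomial R \<one>\<^bsub>M\<^esub> \<one>"
  by (simp_all add: monoid_algebra_def)

lemma monomial_closed [intro, simp]:
  "m \<in> carrier M \<Longrightarrow> a \<in> carrier R \<Longrightarrow> monomial R m a \<in> carrier F"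
  by (auto simp: carrier_iff monomial_def intro: finite_subset[of _ "{m}"])

lemma monomial_apply: "monomial R m a x = (if x = m then a else \<zero>)"
  by (simp add: monomial_def)

lemma monomial_zero: "monomial R m \<zero> = \<zero>\<^bsub>F\<^esub>"
  by (auto simp: monomial_def monoid_algebra_def)

lemma monomial_add:
  "a \<in> carrier R \<Longrightarrow> b \<in> carrier R \<Longrightarrow>
    monomial R m (a \<oplus> b) = monomial R m a \<oplus>\<^bsub>F\<^esub> monomial R m b"
  by (auto simp: monomial_def add_apply fun_eq_iff)

lemma add_closed: "f \<in> carrier F \<Longrightarrow> g \<in> carrier F \<Longrightarrow> f \<oplus>\<^bsub>F\<^esub> g \<in> carrier F"
proof -
  assume fg: "f \<in> carrier F" "g \<in> carrier F"
  have "supp (f \<oplus>\<^bsub>F\<^esub> g) \<subseteq> supp f \<union> supp g" using memD[OF fg(1)] memD[OF fg(2)] by (auto simp: add_apply)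
  then show ?thesis
    using memD[OF fg(1)] memD[OF fg(2)]
    by (auto simp: carrier_iff add_apply intro: finite_subset[of _ "supp f \<union> supp g"])
qed

lemma F_abelian_group: "abelian_group F"
proof (rule abelian_groupI)
  fix f assume f: "f \<in> carrier F"
  show "\<zero>\<^bsub>F\<^esub> \<oplus>\<^bsub>F\<^esub> f = f" using memD(1)[OF f] by (auto simp: add_apply zero_apply fun_eq_iff)
  have "(\<lambda>x. \<ominus> f x) \<in> carrier F"
    using memD[OF f] by (auto simp: carrier_iff intro: finite_subset[of _ "supp f"])
  moreover have "(\<lambda>x. \<ominus> f x) \<oplus>\<^bsub>F\<^esub> f = \<zero>\<^bsub>F\<^esub>"
    using memD(1)[OF f] by (auto simp: add_apply zero_apply fun_eq_iff R.l_neg)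
  ultimately show "\<exists>g\<in>carrier F. g \<oplus>\<^bsub>F\<^esub> f = \<zero>\<^bsub>F\<^esub>" by blast
next
  fix f g h assume "f \<in> carrier F" "g \<in> carrier F" "h \<in> carrier F"
  then show "f \<oplus>\<^bsub>F\<^esub> g \<oplus>\<^bsub>F\<^esub> h = f \<oplus>\<^bsub>F\<^esub> (g \<oplus>\<^bsub>F\<^esub> h)"
    by (auto simp: add_apply fun_eq_iff R.a_assoc memD(1))
next
  fix f g assume "f \<in> carrier F" "g \<in> carrier F"
  then show "f \<oplus>\<^bsub>F\<^esub> g = g \<oplus>\<^bsub>F\<^esub> f" "f \<oplus>\<^bsub>F\<^esub> g \<in> carrier F"
    by (auto simp: add_apply fun_eq_iff R.a_comm memD(1) add_closed)
qed (auto simp: carrier_iff zero_apply)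

lemma induct [consumes 1, case_names zero monomial add]:
  assumes f: "f \<in> carrier F" and zero: "P \<zero>\<^bsub>F\<^esub>"
    and mon: "\<And>m a. m \<in> carrier M \<Longrightarrow> a \<in> carrier R \<Longrightarrow> P (monomial R m a)"
    and add: "\<And>f g. f \<in> carrier F \<Longrightarrow> g \<in> carrier F \<Longrightarrow> P f \<Longrightarrow> P g \<Longrightarrow> P (f \<oplus>\<^bsub>F\<^esub> g)"
  shows "P f"
proof -
  have "finite S \<Longrightarrow> f \<in> carrier F \<Longrightarrow> supp f = S \<Longrightarrow> P f" for S f
  proof (induction S arbitrary: f rule: finite_induct)
    case empty
    then have "f = \<zero>\<^bsub>F\<^esub>" by (auto simp: zero_apply fun_eq_iff)
    then show ?case using zero by simp
  next
    case (insert x S)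
    define g where "g = f(x := \<zero>)"
    note m = memD[OF insert.prems(1)]
    have xM: "x \<in> carrier M" using m(3) insert.prems(2) by blast
    have sg: "supp g = S" using insert by (auto simp: g_def)
    have g: "g \<in> carrier F"
      using m by (auto simp: carrier_iff g_def intro: finite_subset[of _ "supp f"])
    have "f = monomial R x (f x) \<oplus>\<^bsub>F\<^esub> g"
      using m by (auto simp: fun_eq_iff add_apply monomial_apply g_def)
    moreover have "P (monomial R x (f x) \<oplus>\<^bsub>F\<^esub> g)"
      by (rule add) (use m(1) xM g sg insert.IH mon in auto)
    ultimately show ?case by simp
  qed
  then show ?thesis using f memD(2)[OF f] by blast
qed

text \<open>Summing over a box that contains the supports makes the index set independent of the supports themselves,
  which change under addition.\<close>

lemma mult_apply_superset:
  assumes f: "f \<in> carrier F" and g: "g \<in> carrier F"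
    and S: "finite S" "supp f \<subseteq> S" and T: "finite T" "supp g \<subseteq> T"
  shows "(f \<otimes>\<^bsub>F\<^esub> g) z = (\<Oplus>u\<in>{u \<in> S \<times> T. fst u \<otimes>\<^bsub>M\<^esub> snd u = z}. f (fst u) \<otimes> g (snd u))"
proof -
  have "(f \<otimes>\<^bsub>F\<^esub> g) z = (\<Oplus>u\<in>{(x, y). f x \<noteq> \<zero> \<and> g y \<noteq> \<zero> \<and> x \<otimes>\<^bsub>M\<^esub> y = z}. f (fst u) \<otimes> g (snd u))"
    by (simp add: monoid_algebra_def)
  also have "\<dots> = (\<Oplus>u\<in>{u \<in> S \<times> T. fst u \<otimes>\<^bsub>M\<^esub> snd u = z}. f (fst u) \<otimes> g (snd u))"
  proof (rule R.add.finprod_mono_neutral_cong_left)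
    show "finite {u \<in> S \<times> T. fst u \<otimes>\<^bsub>M\<^esub> snd u = z}"
      by (rule finite_subset[of _ "S \<times> T"]) (use S T in auto)
    show "{(x, y). f x \<noteq> \<zero> \<and> g y \<noteq> \<zero> \<and> x \<otimes>\<^bsub>M\<^esub> y = z} \<subseteq> {u \<in> S \<times> T. fst u \<otimes>\<^bsub>M\<^esub> snd u = z}"
      using S T by auto
  qed (use memD(1)[OF f] memD(1)[OF g] in auto)
  finally show ?thesis .
qed

lemma mult_closed: "f \<in> carrier F \<Longrightarrow> g \<in> carrier F \<Longrightarrow> f \<otimes>\<^bsub>F\<^esub> g \<in> carrier F"
proof -
  assume fg: "f \<in> carrier F" "g \<in> carrier F"
  note f = memD[OF fg(1)] and g = memD[OF fg(2)]
  define P where "P = (\<lambda>u. fst u \<otimes>\<^bsub>M\<^esub> snd u) ` (supp f \<times> supp g)"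
  have P: "finite P" "P \<subseteq> carrier M" using f g by (auto simp: P_def intro!: M.m_closed)
  have "(f \<otimes>\<^bsub>F\<^esub> g) z = \<zero>" if "z \<notin> P" for z
  proof -
    have "{u \<in> supp f \<times> supp g. fst u \<otimes>\<^bsub>M\<^esub> snd u = z} = {}"
    proof (rule equals0I)
      fix u assume "u \<in> {u \<in> supp f \<times> supp g. fst u \<otimes>\<^bsub>M\<^esub> snd u = z}"
      then have "u \<in> supp f \<times> supp g" "z = fst u \<otimes>\<^bsub>M\<^esub> snd u" by blast+
      then have "z \<in> P" unfolding P_def by (rule rev_image_eqI)
      with that show False ..
    qed
    then show ?thesis
      using mult_apply_superset[OF fg f(2) subset_refl g(2) subset_refl, of z]
      by (simp only: R.finsum_empty)
  qed
  then have "supp (f \<otimes>\<^bsub>F\<^esub> g) \<subseteq> P" by blast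
  moreover have "(f \<otimes>\<^bsub>F\<^esub> g) z \<in> carrier R" for z
    unfolding mult_apply_superset[OF fg f(2) subset_refl g(2) subset_refl, of z]
    using f g by (intro R.finsum_closed) auto
  ultimately show ?thesis using P by (auto simp: carrier_iff intro: finite_subset)
qed

lemma mult_add_left:
  assumes f: "f \<in> carrier F" and g: "g \<in> carrier F" and h: "h \<in> carrier F"
  shows "(f \<oplus>\<^bsub>F\<^esub> g) \<otimes>\<^bsub>F\<^esub> h = f \<otimes>\<^bsub>F\<^esub> h \<oplus>\<^bsub>F\<^esub> g \<otimes>\<^bsub>F\<^esub> h"
proof
  fix z
  let ?S = "supp f \<union> supp g" and ?T = "supp h"
  have S: "finite ?S" "supp f \<subseteq> ?S" "supp g \<subseteq> ?S" "supp (f \<oplus>\<^bsub>F\<^esub> g) \<subseteq> ?S"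
    using memD[OF f] memD[OF g] by (auto simp: add_apply)
  note T = memD(2)[OF h] subset_refl[of ?T]
  show "((f \<oplus>\<^bsub>F\<^esub> g) \<otimes>\<^bsub>F\<^esub> h) z = (f \<otimes>\<^bsub>F\<^esub> h \<oplus>\<^bsub>F\<^esub> g \<otimes>\<^bsub>F\<^esub> h) z"
    unfolding add_apply mult_apply_superset[OF add_closed[OF f g] h S(1,4) T]
      mult_apply_superset[OF f h S(1,2) T] mult_apply_superset[OF g h S(1,3) T]
    using memD(1)[OF f] memD(1)[OF g] memD(1)[OF h]
    by (subst R.finsum_addf[symmetric]) (auto simp: R.l_distr intro!: R.finsum_cong')
qed

lemma mult_comm:
  assumes f: "f \<in> carrier F" and g: "g \<in> carrier F"
  shows "f \<otimes>\<^bsub>F\<^esub> g = g \<otimes>\<^bsub>F\<^esub> f"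
proof
  fix z
  note fm = memD[OF f] and gm = memD[OF g]
  have "(f \<otimes>\<^bsub>F\<^esub> g) z = (\<Oplus>u\<in>{u \<in> supp f \<times> supp g. fst u \<otimes>\<^bsub>M\<^esub> snd u = z}. f (fst u) \<otimes> g (snd u))"
    by (rule mult_apply_superset[OF f g fm(2) subset_refl gm(2) subset_refl])
  also have "\<dots> = (\<Oplus>u\<in>prod.swap ` {u \<in> supp f \<times> supp g. fst u \<otimes>\<^bsub>M\<^esub> snd u = z}. g (fst u) \<otimes> f (snd u))"
    using fm gm by (subst R.add.finprod_reindex) (auto simp: R.m_comm intro!: R.finsum_cong')
  also have "prod.swap ` {u \<in> supp f \<times> supp g. fst u \<otimes>\<^bsub>M\<^esub> snd u = z} =
      {u \<in> supp g \<times> supp f. fst u \<otimes>\<^bsub>M\<^esub> snd u = z}"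
  proof -
    have "x \<otimes>\<^bsub>M\<^esub> y = y \<otimes>\<^bsub>M\<^esub> x" if "x \<in> supp f" "y \<in> supp g" for x y
      using that fm(3) gm(3) by (intro M.m_comm) auto
    then show ?thesis by (auto simp: image_iff)
  qed
  also have "(\<Oplus>u\<in>{u \<in> supp g \<times> supp f. fst u \<otimes>\<^bsub>M\<^esub> snd u = z}. g (fst u) \<otimes> f (snd u)) = (g \<otimes>\<^bsub>F\<^esub> f) z"
    by (rule mult_apply_superset[OF g f gm(2) subset_refl fm(2) subset_refl, symmetric])
  finally show "(f \<otimes>\<^bsub>F\<^esub> g) z = (g \<otimes>\<^bsub>F\<^esub> f) z" .
qed

lemma mult_monomials:
  assumes "m \<in> carrier M" "n \<in> carrier M" "a \<in> carrier R" "b \<in> carrier R"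
  shows "monomial R m a \<otimes>\<^bsub>F\<^esub> monomial R n b = monomial R (m \<otimes>\<^bsub>M\<^esub> n) (a \<otimes> b)"
proof
  fix z
  have "(monomial R m a \<otimes>\<^bsub>F\<^esub> monomial R n b) z =
      (\<Oplus>u\<in>{u \<in> {m} \<times> {n}. fst u \<otimes>\<^bsub>M\<^esub> snd u = z}. monomial R m a (fst u) \<otimes> monomial R n b (snd u))"
    using assms by (intro mult_apply_superset) (auto simp: monomial_apply)
  also have "{u \<in> {m} \<times> {n}. fst u \<otimes>\<^bsub>M\<^esub> snd u = z} = (if m \<otimes>\<^bsub>M\<^esub> n = z then {(m, n)} else {})" by auto
  finally have eq: "(monomial R m a \<otimes>\<^bsub>F\<^esub> monomial R n b) z =
      (\<Oplus>u\<in>(if m \<otimes>\<^bsub>M\<^esub> n = z then {(m, n)} else {}). monomial R m a (fst u) \<otimes> monomial R n b (snd u))" .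
  show "(monomial R m a \<otimes>\<^bsub>F\<^esub> monomial R n b) z = monomial R (m \<otimes>\<^bsub>M\<^esub> n) (a \<otimes> b) z"
    unfolding eq using assms by (auto simp: monomial_apply)
qed

lemma mult_zero_left: "g \<in> carrier F \<Longrightarrow> \<zero>\<^bsub>F\<^esub> \<otimes>\<^bsub>F\<^esub> g = \<zero>\<^bsub>F\<^esub>"
  by (rule ext) (simp add: monoid_algebra_def)

lemma mult_add_right:
  assumes "f \<in> carrier F" "g \<in> carrier F" "h \<in> carrier F"
  shows "h \<otimes>\<^bsub>F\<^esub> (f \<oplus>\<^bsub>F\<^esub> g) = h \<otimes>\<^bsub>F\<^esub> f \<oplus>\<^bsub>F\<^esub> h \<otimes>\<^bsub>F\<^esub> g"
  using assms mult_add_left mult_comm add_closed by simp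

lemma mult_zero_right: "g \<in> carrier F \<Longrightarrow> g \<otimes>\<^bsub>F\<^esub> \<zero>\<^bsub>F\<^esub> = \<zero>\<^bsub>F\<^esub>"
  by (rule ext) (simp add: monoid_algebra_def)

lemma mult_assoc:
  assumes f: "f \<in> carrier F" and g: "g \<in> carrier F" and h: "h \<in> carrier F"
  shows "f \<otimes>\<^bsub>F\<^esub> g \<otimes>\<^bsub>F\<^esub> h = f \<otimes>\<^bsub>F\<^esub> (g \<otimes>\<^bsub>F\<^esub> h)"
  using f
proof (induction f rule: induct)
  case zero
  then show ?case using g h by (simp add: mult_zero_left mult_closed)
next
  case (add f1 f2)
  then show ?case using g h by (simp add: mult_add_left mult_closed)
next
  case (monomial m a)
  note ma = monomial monomial_closed[OF monomial]
  show ?case using g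
  proof (induction g rule: induct)
    case zero
    then show ?case using ma h by (simp add: mult_zero_left mult_zero_right mult_closed)
  next
    case (add f1 f2)
    then show ?case using ma h by (simp add: mult_add_left mult_add_right mult_closed)
  next
    case (monomial n b)
    show ?case using h
    proof (induction h rule: induct)
      case zero
      then show ?case using ma monomial by (simp add: mult_zero_right mult_closed)
    next
      case (add f1 f2)
      then show ?case using ma monomial by (simp add: mult_add_right mult_closed)
    next
      case (monomial l c)
      then show ?case using ma \<open>n \<in> carrier M\<close> \<open>b \<in> carrier R\<close>
        by (simp add: mult_monomials M.m_assoc R.m_assoc)
    qed
  qed
qed

lemma F_cring: "cring F"
proof (rule cringI[OF F_abelian_group])
  show "comm_monoid F"
  proof (rule comm_monoidI)
    show "\<one>\<^bsub>F\<^esub> \<in> carrier F" by (simp add: one_eq)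
    fix f assume "f \<in> carrier F"
    then show "\<one>\<^bsub>F\<^esub> \<otimes>\<^bsub>F\<^esub> f = f"
    proof (induction f rule: induct)
      case (add f g)
      then show ?case by (simp add: mult_add_right one_eq)
    qed (simp_all add: one_eq mult_zero_right mult_monomials)
  qed (rule mult_closed mult_assoc mult_comm; assumption)+
qed (simp add: mult_add_left)

sublocale F: cring "monoid_algebra R M" by (rule F_cring)

lemma const_hom: "(\<lambda>a. monomial R \<one>\<^bsub>M\<^esub> a) \<in> ring_hom R F"
  by (rule ring_hom_memI) (simp_all add: mult_monomials monomial_add one_eq)

lemma monomial_pow: "m \<in> carrier M \<Longrightarrow> monomial R m \<one> [^]\<^bsub>F\<^esub> (n::nat) = monomial R (m [^]\<^bsub>M\<^esub> n) \<one>"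
  by (induction n) (simp_all add: one_eq mult_monomials)

end

section \<open>Maps out of a monoid algebra\<close>

text \<open>The additive map \<open>R[M] \<rightarrow> S\<close> given by \<open>\<alpha>\<close> on coefficients and by \<open>\<chi>\<close> on the basis \<open>M\<close>; it is a ring homomorphism if
  \<open>\<chi>\<close> is multiplicative.\<close>

definition evaluation ::
    "('r, 'c) ring_scheme \<Rightarrow> ('s, 'd) ring_scheme \<Rightarrow> ('r \<Rightarrow> 's) \<Rightarrow> ('m \<Rightarrow> 's) \<Rightarrow> ('m \<Rightarrow> 'r) \<Rightarrow> 's" where
  "evaluation R S \<alpha> \<chi> f = (\<Oplus>\<^bsub>S\<^esub>x\<in>{x. f x \<noteq> \<zero>\<^bsub>R\<^esub>}. \<alpha> (f x) \<otimes>\<^bsub>S\<^esub> \<chi> x)"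

context monoid_algebra_setup
begin

context
  fixes S :: "('s, 'd) ring_scheme" and \<alpha> \<chi>
  assumes S: "cring S" and \<alpha>: "\<alpha> \<in> ring_hom R S" and \<chi>: "\<And>x. x \<in> carrier M \<Longrightarrow> \<chi> x \<in> carrier S"
begin

interpretation S: cring S by (rule S)
interpretation \<alpha>: ring_hom_ring R S \<alpha>
  by (intro ring_hom_ringI2 R.ring_axioms S.ring_axioms \<alpha>)

lemma evaluation_superset:
  assumes f: "f \<in> carrier F" and T: "finite T" "supp f \<subseteq> T" "T \<subseteq> carrier M"
  shows "evaluation R S \<alpha> \<chi> f = (\<Oplus>\<^bsub>S\<^esub>x\<in>T. \<alpha> (f x) \<otimes>\<^bsub>S\<^esub> \<chi> x)"
  unfolding evaluation_def
proof (rule S.add.finprod_mono_neutral_cong_left[OF T(1,2)])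
qed (use T(3) \<chi> memD(1)[OF f] in auto)

lemma evaluation_closed: "f \<in> carrier F \<Longrightarrow> evaluation R S \<alpha> \<chi> f \<in> carrier S"
  unfolding evaluation_def using memD(1)[of f] \<chi>[OF subsetD[OF memD(3)[of f]]]
  by (intro S.finsum_closed) auto

lemma evaluation_add:
  assumes f: "f \<in> carrier F" and g: "g \<in> carrier F"
  shows "evaluation R S \<alpha> \<chi> (f \<oplus>\<^bsub>F\<^esub> g) = evaluation R S \<alpha> \<chi> f \<oplus>\<^bsub>S\<^esub> evaluation R S \<alpha> \<chi> g"
proof -
  let ?T = "supp f \<union> supp g"
  have T: "finite ?T" "supp f \<subseteq> ?T" "supp g \<subseteq> ?T" "supp (f \<oplus>\<^bsub>F\<^esub> g) \<subseteq> ?T" "?T \<subseteq> carrier M"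
    using memD[OF f] memD[OF g] by (auto simp: add_apply)
  show ?thesis
    unfolding evaluation_superset[OF f T(1,2,5)] evaluation_superset[OF g T(1,3,5)]
      evaluation_superset[OF F.a_closed[OF f g] T(1,4,5)]
  proof (subst S.finsum_addf[symmetric])
    show "(\<Oplus>\<^bsub>S\<^esub>x\<in>?T. \<alpha> ((f \<oplus>\<^bsub>F\<^esub> g) x) \<otimes>\<^bsub>S\<^esub> \<chi> x) =
        (\<Oplus>\<^bsub>S\<^esub>x\<in>?T. \<alpha> (f x) \<otimes>\<^bsub>S\<^esub> \<chi> x \<oplus>\<^bsub>S\<^esub> \<alpha> (g x) \<otimes>\<^bsub>S\<^esub> \<chi> x)"
      using memD(1)[OF f] memD(1)[OF g] \<chi>[OF subsetD[OF T(5)]]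
      by (intro S.finsum_cong') (auto simp: add_apply S.l_distr)
  qed (use memD(1)[OF f] memD(1)[OF g] \<chi>[OF subsetD[OF T(5)]] in auto)
qed

lemma evaluation_monomial:
  assumes "m \<in> carrier M" "a \<in> carrier R"
  shows "evaluation R S \<alpha> \<chi> (monomial R m a) = \<alpha> a \<otimes>\<^bsub>S\<^esub> \<chi> m"
proof -
  have "evaluation R S \<alpha> \<chi> (monomial R m a) = (\<Oplus>\<^bsub>S\<^esub>x\<in>{m}. \<alpha> (monomial R m a x) \<otimes>\<^bsub>S\<^esub> \<chi> x)"
    using assms by (intro evaluation_superset) (auto simp: monomial_apply)
  then show ?thesis using assms \<chi> by (simp add: monomial_apply)
qed

lemma evaluation_zero: "evaluation R S \<alpha> \<chi> \<zero>\<^bsub>F\<^esub> = \<zero>\<^bsub>S\<^esub>"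
  by (simp add: evaluation_def zero_apply)

lemma evaluation_hom:
  assumes one: "\<chi> \<one>\<^bsub>M\<^esub> = \<one>\<^bsub>S\<^esub>"
    and mult: "\<And>x y. x \<in> carrier M \<Longrightarrow> y \<in> carrier M \<Longrightarrow> \<chi> (x \<otimes>\<^bsub>M\<^esub> y) = \<chi> x \<otimes>\<^bsub>S\<^esub> \<chi> y"
  shows "evaluation R S \<alpha> \<chi> \<in> ring_hom F S"
proof (rule ring_hom_memI)
  show "evaluation R S \<alpha> \<chi> \<one>\<^bsub>F\<^esub> = \<one>\<^bsub>S\<^esub>"
    using one by (simp add: one_eq evaluation_monomial)
  fix f g assume f: "f \<in> carrier F" and g: "g \<in> carrier F"
  show "evaluation R S \<alpha> \<chi> (f \<otimes>\<^bsub>F\<^esub> g) = evaluation R S \<alpha> \<chi> f \<otimes>\<^bsub>S\<^esub> evaluation R S \<alpha> \<chi> g"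
    using f
  proof (induction f rule: induct)
    case zero
    then show ?case using g by (simp add: evaluation_zero evaluation_closed)
  next
    case (add f1 f2)
    then show ?case using g by (simp add: F.l_distr S.l_distr evaluation_add evaluation_closed)
  next
    case (monomial m a)
    show ?case using g
    proof (induction g rule: induct)
      case zero
      then show ?case using monomial by (simp add: evaluation_zero evaluation_closed)
    next
      case (add f1 f2)
      then show ?case using monomial by (simp add: F.r_distr S.r_distr evaluation_add evaluation_closed)
    next
      case (monomial n b)
      then show ?case using \<open>m \<in> carrier M\<close> \<open>a \<in> carrier R\<close> \<chi>
        by (simp add: mult_monomials evaluation_monomial mult S.m_ac)
    qed
  qed
qed (simp_all add: evaluation_add evaluation_closed)

end

end

section \<open>The ring of generalised polynomials\<close>

lemma nonneg_rat_monoid_comm: "comm_monoid nonneg_rat_monoid"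
  by (rule comm_monoidI) (auto simp: nonneg_rat_monoid_def)

text \<open>The product of the terms of highest exponents \<open>q\<close> and \<open>r\<close> cannot cancel, because \<open>q + r\<close> is the sum of exponents of
  \<open>f\<close> and \<open>g\<close> in one way only.\<close>

lemma root_polys_domain:
  assumes k: "domain k"
  shows "domain (root_polys k)"
proof -
  interpret k: domain k by fact
  interpret P: monoid_algebra_setup k nonneg_rat_monoid
    by (intro monoid_algebra_setup.intro k.cring_axioms nonneg_rat_monoid_comm)
  have "domain P.F"
  proof (rule domainI[OF P.F_cring])
    show "\<one>\<^bsub>P.F\<^esub> \<noteq> \<zero>\<^bsub>P.F\<^esub>"
    proof
      assume "\<one>\<^bsub>P.F\<^esub> = \<zero>\<^bsub>P.F\<^esub>"
      then have "\<one>\<^bsub>P.F\<^esub> \<one>\<^bsub>nonneg_rat_monoid\<^esub> = \<zero>\<^bsub>P.F\<^esub> \<one>\<^bsub>nonneg_rat_monoid\<^esub>" by simp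
      then show False by (simp add: P.one_eq P.monomial_apply P.zero_apply)
    qed
    fix f g assume fg: "f \<otimes>\<^bsub>P.F\<^esub> g = \<zero>\<^bsub>P.F\<^esub>" and f: "f \<in> carrier P.F" and g: "g \<in> carrier P.F"
    note fm = P.memD[OF f] and gm = P.memD[OF g]
    show "f = \<zero>\<^bsub>P.F\<^esub> \<or> g = \<zero>\<^bsub>P.F\<^esub>"
    proof (rule ccontr)
      assume "\<not> ?thesis"
      then have ne: "P.supp f \<noteq> {}" "P.supp g \<noteq> {}" by (auto simp: fun_eq_iff P.zero_apply)
      define q where "q = Max (P.supp f)"
      define r where "r = Max (P.supp g)"
      have q: "q \<in> P.supp f" "\<And>x. x \<in> P.supp f \<Longrightarrow> x \<le> q"
        unfolding q_def using Max_in[OF fm(2) ne(1)] Max_ge[OF fm(2)] by blast+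
      have r: "r \<in> P.supp g" "\<And>x. x \<in> P.supp g \<Longrightarrow> x \<le> r"
        unfolding r_def using Max_in[OF gm(2) ne(2)] Max_ge[OF gm(2)] by blast+
      have "{u \<in> P.supp f \<times> P.supp g. fst u \<otimes>\<^bsub>nonneg_rat_monoid\<^esub> snd u = q + r} = {(q, r)}"
        using q r by (auto simp: nonneg_rat_monoid_def) (metis add_le_cancel_left add_le_cancel_right add_mono antisym)+
      then have "(f \<otimes>\<^bsub>P.F\<^esub> g) (q + r) = f q \<otimes>\<^bsub>k\<^esub> g r"
        using P.mult_apply_superset[OF f g fm(2) subset_refl gm(2) subset_refl, of "q + r"] fm(1) gm(1)
        by simp
      moreover have "f q \<otimes>\<^bsub>k\<^esub> g r \<noteq> \<zero>\<^bsub>k\<^esub>" using q(1) r(1) fm(1) gm(1) by (auto simp: k.integral_iff)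
      ultimately show False using fg by (simp add: P.zero_apply)
    qed
  qed
  then show ?thesis by (simp add: root_polys_def)
qed

section \<open>Maps out of a quotient ring\<close>

lemma (in ring) quotient_additive_lift:
  assumes I: "ideal I R" and S: "abelian_group S"
    and closed: "\<And>x. x \<in> carrier R \<Longrightarrow> \<phi> x \<in> carrier S"
    and add: "\<And>x y. x \<in> carrier R \<Longrightarrow> y \<in> carrier R \<Longrightarrow> \<phi> (x \<oplus> y) = \<phi> x \<oplus>\<^bsub>S\<^esub> \<phi> y"
    and zero: "\<And>x. x \<in> I \<Longrightarrow> \<phi> x = \<zero>\<^bsub>S\<^esub>"
  obtains h where "\<And>x. x \<in> carrier R \<Longrightarrow> h (I +> x) = \<phi> x"
proof
  interpret S: abelian_group S by fact
  interpret I: ideal I R by fact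
  fix x assume x: "x \<in> carrier R"
  let ?y = "SOME y. y \<in> carrier R \<and> I +> x = I +> y"
  have y: "?y \<in> carrier R \<and> I +> x = I +> ?y" by (rule someI[of _ x]) (simp add: x)
  then have d: "x \<ominus> ?y \<in> I" using quotient_eq_iff_same_a_r_cos[OF I x] by blast
  have "x = (x \<ominus> ?y) \<oplus> ?y" using x y by (simp add: minus_eq a_assoc l_neg)
  then have "\<phi> x = \<phi> (x \<ominus> ?y) \<oplus>\<^bsub>S\<^esub> \<phi> ?y" using add[of "x \<ominus> ?y" ?y] x y by simp
  then show "\<phi> (SOME y. y \<in> carrier R \<and> I +> x = I +> y) = \<phi> x"
    using zero[OF d] closed y by simp
qed

section \<open>Tensor products of algebras\<close>

locale tensor = A: algebra k A + B: algebra k B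
  for k :: "('k, 'c) ring_scheme" (structure) and A :: "('k, 'a, 'd) module_scheme"
    and B :: "('k, 'b, 'e) module_scheme"
begin

lemma k_ring: "ring k" and A_ring: "ring A" and B_ring: "ring B"
  using A.R_cring A.M_cring B.M_cring by (simp_all add: cring_def)

lemma AB_comm_monoid: "comm_monoid (A \<times>\<times> B)"
  by (rule comm_monoidI)
    (auto simp: DirProd_def A.m_ac B.m_ac)

sublocale P: monoid_algebra_setup k "A \<times>\<times> B"
  by (intro monoid_algebra_setup.intro A.R_cring AB_comm_monoid)

abbreviation "rels \<equiv> bilinearity_relations k A B"
abbreviation "RI \<equiv> Idl\<^bsub>P.F\<^esub> rels"
abbreviation "T \<equiv> algebra_tensor_product k A B"
abbreviation "tens a b c \<equiv> monomial k (a, b) c"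

lemma AB_simps [simp]:
  "(a, b) \<in> carrier (A \<times>\<times> B) \<longleftrightarrow> a \<in> carrier A \<and> b \<in> carrier B"
  "(a, b) \<otimes>\<^bsub>A \<times>\<times> B\<^esub> (a', b') = (a \<otimes>\<^bsub>A\<^esub> a', b \<otimes>\<^bsub>B\<^esub> b')"
  "\<one>\<^bsub>A \<times>\<times> B\<^esub> = (\<one>\<^bsub>A\<^esub>, \<one>\<^bsub>B\<^esub>)"
  by (auto simp: DirProd_def)

lemma tens_closed [simp]:
  "a \<in> carrier A \<Longrightarrow> b \<in> carrier B \<Longrightarrow> c \<in> carrier k \<Longrightarrow> tens a b c \<in> carrier P.F"
  by (rule P.monomial_closed) auto

lemma tens_mult:
  "a \<in> carrier A \<Longrightarrow> b \<in> carrier B \<Longrightarrow> c \<in> carrier k \<Longrightarrow>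
   a' \<in> carrier A \<Longrightarrow> b' \<in> carrier B \<Longrightarrow> c' \<in> carrier k \<Longrightarrow>
   tens a b c \<otimes>\<^bsub>P.F\<^esub> tens a' b' c' = tens (a \<otimes>\<^bsub>A\<^esub> a') (b \<otimes>\<^bsub>B\<^esub> b') (c \<otimes> c')"
  by (subst P.mult_monomials) auto

lemma relation_cases [consumes 1, case_names left right smult_left smult_right]:
  assumes "r \<in> rels"
  obtains a a' b where "a \<in> carrier A" "a' \<in> carrier A" "b \<in> carrier B"
      "r = tens (a \<oplus>\<^bsub>A\<^esub> a') b \<one> \<ominus>\<^bsub>P.F\<^esub> (tens a b \<one> \<oplus>\<^bsub>P.F\<^esub> tens a' b \<one>)"
    | a b b' where "a \<in> carrier A" "b \<in> carrier B" "b' \<in> carrier B"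
      "r = tens a (b \<oplus>\<^bsub>B\<^esub> b') \<one> \<ominus>\<^bsub>P.F\<^esub> (tens a b \<one> \<oplus>\<^bsub>P.F\<^esub> tens a b' \<one>)"
    | a b c where "a \<in> carrier A" "b \<in> carrier B" "c \<in> carrier k"
      "r = tens (c \<odot>\<^bsub>A\<^esub> a) b \<one> \<ominus>\<^bsub>P.F\<^esub> tens a b c"
    | a b c where "a \<in> carrier A" "b \<in> carrier B" "c \<in> carrier k"
      "r = tens a (c \<odot>\<^bsub>B\<^esub> b) \<one> \<ominus>\<^bsub>P.F\<^esub> tens a b c"
  using assms unfolding bilinearity_relations_def Let_def
  by (elim UnE CollectE exE conjE) (rule that; assumption)+

lemma rels_carrier: "rels \<subseteq> carrier P.F"
proof
  fix r assume "r \<in> rels"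
  then show "r \<in> carrier P.F" by (cases rule: relation_cases) simp_all
qed

lemma RI_ideal: "ideal RI P.F" by (rule P.F.genideal_ideal[OF rels_carrier])

lemma T_eq: "T = P.F Quot RI" by (simp add: algebra_tensor_product_def)

lemma T_cring: "cring T"
  unfolding T_eq by (rule ideal.quotient_is_cring[OF RI_ideal P.F_cring])

sublocale T: cring "algebra_tensor_product k A B" by (rule T_cring)

definition proj where "proj f = RI +>\<^bsub>P.F\<^esub> f"

sublocale proj: ring_hom_ring "monoid_algebra k (A \<times>\<times> B)" "algebra_tensor_product k A B" proj
  using ideal.rcos_ring_hom_ring[OF RI_ideal] unfolding T_eq proj_def[abs_def] .

lemma T_cases:
  assumes "y \<in> carrier T" obtains f where "f \<in> carrier P.F" "y = proj f"
  using assms unfolding T_eq proj_def FactRing_def A_RCOSETS_def' by auto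

lemma proj_eqI:
  assumes "f \<ominus>\<^bsub>P.F\<^esub> g \<in> rels" "f \<in> carrier P.F" "g \<in> carrier P.F"
  shows "proj f = proj g"
proof -
  have "f \<ominus>\<^bsub>P.F\<^esub> g \<in> RI" using assms(1) P.F.genideal_self[OF rels_carrier] by blast
  then show ?thesis
    unfolding proj_def using P.F.quotient_eq_iff_same_a_r_cos[OF RI_ideal assms(2,3)] by simp
qed

lemma proj_rel:
  shows proj_add_left: "a \<in> carrier A \<Longrightarrow> a' \<in> carrier A \<Longrightarrow> b \<in> carrier B \<Longrightarrow>
      proj (tens (a \<oplus>\<^bsub>A\<^esub> a') b \<one>) = proj (tens a b \<one>) \<oplus>\<^bsub>T\<^esub> proj (tens a' b \<one>)"
    and proj_add_right: "a \<in> carrier A \<Longrightarrow> b \<in> carrier B \<Longrightarrow> b' \<in> carrier B \<Longrightarrow>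
      proj (tens a (b \<oplus>\<^bsub>B\<^esub> b') \<one>) = proj (tens a b \<one>) \<oplus>\<^bsub>T\<^esub> proj (tens a b' \<one>)"
    and proj_smult_left: "a \<in> carrier A \<Longrightarrow> b \<in> carrier B \<Longrightarrow> c \<in> carrier k \<Longrightarrow>
      proj (tens (c \<odot>\<^bsub>A\<^esub> a) b \<one>) = proj (tens a b c)"
    and proj_smult_right: "a \<in> carrier A \<Longrightarrow> b \<in> carrier B \<Longrightarrow> c \<in> carrier k \<Longrightarrow>
      proj (tens a (c \<odot>\<^bsub>B\<^esub> b) \<one>) = proj (tens a b c)"
proof -
  assume a: "a \<in> carrier A" and b: "b \<in> carrier B"
  {
    assume a': "a' \<in> carrier A"
    have "proj (tens (a \<oplus>\<^bsub>A\<^esub> a') b \<one>) = proj (tens a b \<one> \<oplus>\<^bsub>P.F\<^esub> tens a' b \<one>)"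
    proof (rule proj_eqI)
      show "tens (a \<oplus>\<^bsub>A\<^esub> a') b \<one> \<ominus>\<^bsub>P.F\<^esub> (tens a b \<one> \<oplus>\<^bsub>P.F\<^esub> tens a' b \<one>) \<in> rels"
        unfolding bilinearity_relations_def Let_def using a b a' by blast
    qed (use a b a' in simp_all)
    then show "proj (tens (a \<oplus>\<^bsub>A\<^esub> a') b \<one>) = proj (tens a b \<one>) \<oplus>\<^bsub>T\<^esub> proj (tens a' b \<one>)"
      using a b a' by simp
  }
  {
    assume b': "b' \<in> carrier B"
    have "proj (tens a (b \<oplus>\<^bsub>B\<^esub> b') \<one>) = proj (tens a b \<one> \<oplus>\<^bsub>P.F\<^esub> tens a b' \<one>)"
    proof (rule proj_eqI)
      show "tens a (b \<oplus>\<^bsub>B\<^esub> b') \<one> \<ominus>\<^bsub>P.F\<^esub> (tens a b \<one> \<oplus>\<^bsub>P.F\<^esub> tens a b' \<one>) \<in> rels"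
        unfolding bilinearity_relations_def Let_def using a b b' by blast
    qed (use a b b' in simp_all)
    then show "proj (tens a (b \<oplus>\<^bsub>B\<^esub> b') \<one>) = proj (tens a b \<one>) \<oplus>\<^bsub>T\<^esub> proj (tens a b' \<one>)"
      using a b b' by simp
  }
  assume c: "c \<in> carrier k"
  show "proj (tens (c \<odot>\<^bsub>A\<^esub> a) b \<one>) = proj (tens a b c)"
  proof (rule proj_eqI)
    show "tens (c \<odot>\<^bsub>A\<^esub> a) b \<one> \<ominus>\<^bsub>P.F\<^esub> tens a b c \<in> rels"
      unfolding bilinearity_relations_def Let_def using a b c by blast
  qed (use a b c in simp_all)
  show "proj (tens a (c \<odot>\<^bsub>B\<^esub> b) \<one>) = proj (tens a b c)"
  proof (rule proj_eqI)
    show "tens a (c \<odot>\<^bsub>B\<^esub> b) \<one> \<ominus>\<^bsub>P.F\<^esub> tens a b c \<in> rels"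
      unfolding bilinearity_relations_def Let_def using a b c by blast
  qed (use a b c in simp_all)
qed

definition inl where "inl a = proj (tens a \<one>\<^bsub>B\<^esub> \<one>)"
definition inr where "inr b = proj (tens \<one>\<^bsub>A\<^esub> b \<one>)"

lemma inl_mult_inr:
  assumes "a \<in> carrier A" "b \<in> carrier B"
  shows "inl a \<otimes>\<^bsub>T\<^esub> inr b = proj (tens a b \<one>)"
  using assms proj.hom_mult[of "tens a \<one>\<^bsub>B\<^esub> \<one>" "tens \<one>\<^bsub>A\<^esub> b \<one>"] by (simp add: inl_def inr_def tens_mult)

lemma inl_hom: "inl \<in> ring_hom A T"
proof (rule ring_hom_memI)
  fix x y assume "x \<in> carrier A" "y \<in> carrier A"
  then show "inl (x \<otimes>\<^bsub>A\<^esub> y) = inl x \<otimes>\<^bsub>T\<^esub> inl y"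
    using proj.hom_mult[of "tens x \<one>\<^bsub>B\<^esub> \<one>" "tens y \<one>\<^bsub>B\<^esub> \<one>"] by (simp add: inl_def tens_mult)
next
  show "inl \<one>\<^bsub>A\<^esub> = \<one>\<^bsub>T\<^esub>" using proj.hom_one by (simp add: inl_def P.one_eq)
qed (simp_all add: inl_def proj_add_left)

lemma inr_hom: "inr \<in> ring_hom B T"
proof (rule ring_hom_memI)
  fix x y assume "x \<in> carrier B" "y \<in> carrier B"
  then show "inr (x \<otimes>\<^bsub>B\<^esub> y) = inr x \<otimes>\<^bsub>T\<^esub> inr y"
    using proj.hom_mult[of "tens \<one>\<^bsub>A\<^esub> x \<one>" "tens \<one>\<^bsub>A\<^esub> y \<one>"] by (simp add: inr_def tens_mult)
next
  show "inr \<one>\<^bsub>B\<^esub> = \<one>\<^bsub>T\<^esub>" using proj.hom_one by (simp add: inr_def P.one_eq)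
qed (simp_all add: inr_def proj_add_right)

lemma inl_inr_const:
  "c \<in> carrier k \<Longrightarrow> inl (c \<odot>\<^bsub>A\<^esub> \<one>\<^bsub>A\<^esub>) = inr (c \<odot>\<^bsub>B\<^esub> \<one>\<^bsub>B\<^esub>)"
  by (simp add: inl_def inr_def proj_smult_left proj_smult_right)

lemma tensor_induct [consumes 1, case_names tensor add]:
  assumes y: "y \<in> carrier T"
    and tensor: "\<And>a b. a \<in> carrier A \<Longrightarrow> b \<in> carrier B \<Longrightarrow> P (inl a \<otimes>\<^bsub>T\<^esub> inr b)"
    and add: "\<And>x y. x \<in> carrier T \<Longrightarrow> y \<in> carrier T \<Longrightarrow> P x \<Longrightarrow> P y \<Longrightarrow> P (x \<oplus>\<^bsub>T\<^esub> y)"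
  shows "P y"
proof -
  have tens: "P (proj (tens a b c))" if "a \<in> carrier A" "b \<in> carrier B" "c \<in> carrier k" for a b c
    using tensor[of "c \<odot>\<^bsub>A\<^esub> a" b] that by (simp add: inl_mult_inr proj_smult_left)
  obtain f where f: "f \<in> carrier P.F" "y = proj f" using T_cases[OF y] .
  have "P (proj f)" using f(1)
  proof (induction f rule: P.induct)
    case zero
    then show ?case
      using tens[of "\<one>\<^bsub>A\<^esub>" "\<one>\<^bsub>B\<^esub>" \<zero>] by (simp add: P.monomial_zero)
  next
    case (monomial m a)
    then show ?case using tens by (cases m) simp
  next
    case (add f g)
    then show ?case using assms(3) by simp
  qed
  then show ?thesis using f by simp
qed

text \<open>A \<open>k\<close>-bilinear \<open>\<chi>\<close> kills the relations, and also their products with basis elements, since these are again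
  relations. Hence the ideal of all \<open>f\<close> such that evaluation vanishes on every multiple of \<open>f\<close> contains
  the relations. The resulting additive map serves both the universal property, where \<open>\<chi>\<close> is
  multiplicative, and the retraction onto \<open>A\<close>, where it is not.\<close>

lemma bilinear_lift:
  assumes S: "cring S" and \<alpha>: "\<alpha> \<in> ring_hom k S"
    and \<chi>: "\<And>a b. a \<in> carrier A \<Longrightarrow> b \<in> carrier B \<Longrightarrow> \<chi> (a, b) \<in> carrier S"
    and add_left: "\<And>a a' b. a \<in> carrier A \<Longrightarrow> a' \<in> carrier A \<Longrightarrow> b \<in> carrier B \<Longrightarrow>
        \<chi> (a \<oplus>\<^bsub>A\<^esub> a', b) = \<chi> (a, b) \<oplus>\<^bsub>S\<^esub> \<chi> (a', b)"
    and add_right: "\<And>a b b'. a \<in> carrier A \<Longrightarrow> b \<in> carrier B \<Longrightarrow> b' \<in> carrier B \<Longrightarrow>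
        \<chi> (a, b \<oplus>\<^bsub>B\<^esub> b') = \<chi> (a, b) \<oplus>\<^bsub>S\<^esub> \<chi> (a, b')"
    and smult_left: "\<And>a b c. a \<in> carrier A \<Longrightarrow> b \<in> carrier B \<Longrightarrow> c \<in> carrier k \<Longrightarrow>
        \<chi> (c \<odot>\<^bsub>A\<^esub> a, b) = \<alpha> c \<otimes>\<^bsub>S\<^esub> \<chi> (a, b)"
    and smult_right: "\<And>a b c. a \<in> carrier A \<Longrightarrow> b \<in> carrier B \<Longrightarrow> c \<in> carrier k \<Longrightarrow>
        \<chi> (a, c \<odot>\<^bsub>B\<^esub> b) = \<alpha> c \<otimes>\<^bsub>S\<^esub> \<chi> (a, b)"
  obtains h where "\<And>f. f \<in> carrier P.F \<Longrightarrow> h (proj f) = evaluation k S \<alpha> \<chi> f"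
proof -
  interpret S: cring S by fact
  interpret \<alpha>: ring_hom_ring k S \<alpha> by (intro ring_hom_ringI2 k_ring S.ring_axioms \<alpha>)
  define ev where "ev = evaluation k S \<alpha> \<chi>"
  have \<chi>': "\<And>x. x \<in> carrier (A \<times>\<times> B) \<Longrightarrow> \<chi> x \<in> carrier S" using \<chi> by (auto simp: DirProd_def)
  have ev_add: "ev (f \<oplus>\<^bsub>P.F\<^esub> g) = ev f \<oplus>\<^bsub>S\<^esub> ev g" if "f \<in> carrier P.F" "g \<in> carrier P.F" for f g
    unfolding ev_def by (rule P.evaluation_add[OF S \<alpha> \<chi>' that])
  have ev_closed: "ev f \<in> carrier S" if "f \<in> carrier P.F" for f
    unfolding ev_def by (rule P.evaluation_closed[OF S \<alpha> \<chi>' that])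
  have ev_zero: "ev \<zero>\<^bsub>P.F\<^esub> = \<zero>\<^bsub>S\<^esub>"
    unfolding ev_def by (rule P.evaluation_zero[OF S \<alpha> \<chi>'])
  have ev_tens: "ev (tens a b c) = \<alpha> c \<otimes>\<^bsub>S\<^esub> \<chi> (a, b)"
    if "a \<in> carrier A" "b \<in> carrier B" "c \<in> carrier k" for a b c
    unfolding ev_def by (rule P.evaluation_monomial[OF S \<alpha> \<chi>']) (use that in simp_all)
  have ev_diff: "ev (f \<ominus>\<^bsub>P.F\<^esub> g) = \<zero>\<^bsub>S\<^esub>" if fg: "f \<in> carrier P.F" "g \<in> carrier P.F" "ev f = ev g" for f g
  proof -
    have "ev f = ev ((f \<ominus>\<^bsub>P.F\<^esub> g) \<oplus>\<^bsub>P.F\<^esub> g)"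
      using fg by (simp add: P.F.minus_eq P.F.a_assoc P.F.l_neg)
    also have "\<dots> = ev (f \<ominus>\<^bsub>P.F\<^esub> g) \<oplus>\<^bsub>S\<^esub> ev g" using fg by (simp add: ev_add)
    finally have "ev (f \<ominus>\<^bsub>P.F\<^esub> g) \<oplus>\<^bsub>S\<^esub> ev g = ev g" using fg(3) by simp
    then show ?thesis using fg ev_closed by (simp add: S.add.r_cancel_one)
  qed
  have rel0: "ev (r \<otimes>\<^bsub>P.F\<^esub> h) = \<zero>\<^bsub>S\<^esub>" if r: "r \<in> rels" and h: "h \<in> carrier P.F" for r h
    using h
  proof (induction h rule: P.induct)
    case zero
    then show ?case using r rels_carrier by (auto simp: ev_zero P.mult_zero_right)
  next
    case (add f g)
    have "r \<in> carrier P.F" using r rels_carrier by blast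
    then show ?case using add by (simp add: P.mult_add_right ev_add)
  next
    case (monomial m d)
    then obtain x y where m: "m = (x, y)" "x \<in> carrier A" "y \<in> carrier B" by (cases m) auto
    note d = \<open>d \<in> carrier k\<close>
    from r show ?case
    proof (cases rule: relation_cases)
      case (left a a' b)
      have "r \<otimes>\<^bsub>P.F\<^esub> tens x y d = tens ((a \<oplus>\<^bsub>A\<^esub> a') \<otimes>\<^bsub>A\<^esub> x) (b \<otimes>\<^bsub>B\<^esub> y) d \<ominus>\<^bsub>P.F\<^esub>
          (tens (a \<otimes>\<^bsub>A\<^esub> x) (b \<otimes>\<^bsub>B\<^esub> y) d \<oplus>\<^bsub>P.F\<^esub> tens (a' \<otimes>\<^bsub>A\<^esub> x) (b \<otimes>\<^bsub>B\<^esub> y) d)"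
        unfolding left(4) using left(1-3) m d
        by (simp add: P.F.minus_eq P.F.l_distr P.F.l_minus tens_mult)
      then show ?thesis unfolding m(1) using left(1-3) m d \<chi>
        by (simp add: ev_diff ev_add ev_tens A.l_distr add_left S.r_distr)
    next
      case (right a b b')
      have "r \<otimes>\<^bsub>P.F\<^esub> tens x y d = tens (a \<otimes>\<^bsub>A\<^esub> x) ((b \<oplus>\<^bsub>B\<^esub> b') \<otimes>\<^bsub>B\<^esub> y) d \<ominus>\<^bsub>P.F\<^esub>
          (tens (a \<otimes>\<^bsub>A\<^esub> x) (b \<otimes>\<^bsub>B\<^esub> y) d \<oplus>\<^bsub>P.F\<^esub> tens (a \<otimes>\<^bsub>A\<^esub> x) (b' \<otimes>\<^bsub>B\<^esub> y) d)"
        unfolding right(4) using right(1-3) m d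
        by (simp add: P.F.minus_eq P.F.l_distr P.F.l_minus tens_mult)
      then show ?thesis unfolding m(1) using right(1-3) m d \<chi>
        by (simp add: ev_diff ev_add ev_tens B.l_distr add_right S.r_distr)
    next
      case (smult_left a b c)
      have "r \<otimes>\<^bsub>P.F\<^esub> tens x y d =
          tens (c \<odot>\<^bsub>A\<^esub> (a \<otimes>\<^bsub>A\<^esub> x)) (b \<otimes>\<^bsub>B\<^esub> y) d \<ominus>\<^bsub>P.F\<^esub> tens (a \<otimes>\<^bsub>A\<^esub> x) (b \<otimes>\<^bsub>B\<^esub> y) (c \<otimes> d)"
        unfolding smult_left(4) using smult_left(1-3) m d
        by (simp add: P.F.minus_eq P.F.l_distr P.F.l_minus tens_mult A.smult_assoc2)
      then show ?thesis unfolding m(1) using smult_left(1-3) m d \<chi>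
        by (simp add: ev_diff ev_tens assms(6) S.m_ac)
    next
      case (smult_right a b c)
      have "r \<otimes>\<^bsub>P.F\<^esub> tens x y d =
          tens (a \<otimes>\<^bsub>A\<^esub> x) (c \<odot>\<^bsub>B\<^esub> (b \<otimes>\<^bsub>B\<^esub> y)) d \<ominus>\<^bsub>P.F\<^esub> tens (a \<otimes>\<^bsub>A\<^esub> x) (b \<otimes>\<^bsub>B\<^esub> y) (c \<otimes> d)"
        unfolding smult_right(4) using smult_right(1-3) m d
        by (simp add: P.F.minus_eq P.F.l_distr P.F.l_minus tens_mult B.smult_assoc2)
      then show ?thesis unfolding m(1) using smult_right(1-3) m d \<chi>
        by (simp add: ev_diff ev_tens assms(7) S.m_ac)
    qed
  qed
  define N where "N = {f \<in> carrier P.F. \<forall>h\<in>carrier P.F. ev (f \<otimes>\<^bsub>P.F\<^esub> h) = \<zero>\<^bsub>S\<^esub>}"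
  have "ideal N P.F"
  proof (rule idealI[OF P.F.ring_axioms])
    show "subgroup N (add_monoid P.F)"
    proof (rule P.F.add.subgroupI)
      show "N \<subseteq> carrier P.F" by (auto simp: N_def)
      have "\<zero>\<^bsub>P.F\<^esub> \<in> N" by (auto simp: N_def ev_zero)
      then show "N \<noteq> {}" by blast
      fix f assume f: "f \<in> N"
      have "ev (\<ominus>\<^bsub>P.F\<^esub> f \<otimes>\<^bsub>P.F\<^esub> h) = \<zero>\<^bsub>S\<^esub>" if h: "h \<in> carrier P.F" for h
      proof -
        have "\<ominus>\<^bsub>P.F\<^esub> f \<otimes>\<^bsub>P.F\<^esub> h = f \<otimes>\<^bsub>P.F\<^esub> (\<ominus>\<^bsub>P.F\<^esub> h)"
          using f h by (simp add: N_def P.F.l_minus P.F.r_minus)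
        then show ?thesis using f h by (simp add: N_def)
      qed
      then show "\<ominus>\<^bsub>P.F\<^esub> f \<in> N" using f by (simp add: N_def)
      fix g assume g: "g \<in> N"
      show "f \<oplus>\<^bsub>P.F\<^esub> g \<in> N" using f g by (simp add: N_def P.F.l_distr ev_add)
    qed
    fix f g assume f: "f \<in> N" and g: "g \<in> carrier P.F"
    show *: "f \<otimes>\<^bsub>P.F\<^esub> g \<in> N" using f g by (simp add: N_def P.F.m_assoc)
    then show "g \<otimes>\<^bsub>P.F\<^esub> f \<in> N" using f g by (simp add: N_def P.F.m_comm)
  qed
  moreover have "rels \<subseteq> N" using rel0 rels_carrier by (auto simp: N_def)
  ultimately have "RI \<subseteq> N" by (rule P.F.genideal_minimal)
  have RI0: "ev f = \<zero>\<^bsub>S\<^esub>" if "f \<in> RI" for f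
  proof -
    have "f \<in> N" using that \<open>RI \<subseteq> N\<close> by blast
    then have "f \<in> carrier P.F" "ev (f \<otimes>\<^bsub>P.F\<^esub> \<one>\<^bsub>P.F\<^esub>) = \<zero>\<^bsub>S\<^esub>" unfolding N_def by blast+
    then show ?thesis by simp
  qed
  show thesis
  proof (rule P.F.quotient_additive_lift[OF RI_ideal S.abelian_group_axioms, of ev])
    fix h assume h: "\<And>x. x \<in> carrier P.F \<Longrightarrow> h (RI +>\<^bsub>P.F\<^esub> x) = ev x"
    show thesis by (rule that[of h]) (simp add: h proj_def flip: ev_def)
  qed (simp_all add: ev_closed ev_add RI0)
qed

theorem tensor_universal:
  assumes S: "cring S" and f: "f \<in> ring_hom A S" and g: "g \<in> ring_hom B S"
    and agree: "\<And>c. c \<in> carrier k \<Longrightarrow> f (c \<odot>\<^bsub>A\<^esub> \<one>\<^bsub>A\<^esub>) = g (c \<odot>\<^bsub>B\<^esub> \<one>\<^bsub>B\<^esub>)"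
  shows "\<exists>h\<in>ring_hom T S. (\<forall>a\<in>carrier A. h (inl a) = f a) \<and> (\<forall>b\<in>carrier B. h (inr b) = g b)"
proof -
  interpret S: cring S by fact
  interpret f: ring_hom_ring A S f by (intro ring_hom_ringI2 A_ring S.ring_axioms f)
  interpret g: ring_hom_ring B S g by (intro ring_hom_ringI2 B_ring S.ring_axioms g)
  define \<alpha> where "\<alpha> c = f (c \<odot>\<^bsub>A\<^esub> \<one>\<^bsub>A\<^esub>)" for c
  define \<chi> where "\<chi> = (\<lambda>(a, b). f a \<otimes>\<^bsub>S\<^esub> g b)"
  have smA: "c \<odot>\<^bsub>A\<^esub> a = (c \<odot>\<^bsub>A\<^esub> \<one>\<^bsub>A\<^esub>) \<otimes>\<^bsub>A\<^esub> a" if "c \<in> carrier k" "a \<in> carrier A" for c a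
    using that by (simp add: A.smult_assoc2)
  have smB: "c \<odot>\<^bsub>B\<^esub> b = (c \<odot>\<^bsub>B\<^esub> \<one>\<^bsub>B\<^esub>) \<otimes>\<^bsub>B\<^esub> b" if "c \<in> carrier k" "b \<in> carrier B" for c b
    using that by (simp add: B.smult_assoc2)
  have \<alpha>: "\<alpha> \<in> ring_hom k S"
  proof (rule ring_hom_memI)
    fix x y assume xy: "x \<in> carrier k" "y \<in> carrier k"
    have "(x \<otimes> y) \<odot>\<^bsub>A\<^esub> \<one>\<^bsub>A\<^esub> = (x \<odot>\<^bsub>A\<^esub> \<one>\<^bsub>A\<^esub>) \<otimes>\<^bsub>A\<^esub> (y \<odot>\<^bsub>A\<^esub> \<one>\<^bsub>A\<^esub>)"
      using xy by (simp add: A.smult_assoc1 A.smult_assoc2)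
    then show "\<alpha> (x \<otimes> y) = \<alpha> x \<otimes>\<^bsub>S\<^esub> \<alpha> y" using xy by (simp add: \<alpha>_def)
  qed (simp_all add: \<alpha>_def A.smult_l_distr)
  have \<chi>': "\<And>x. x \<in> carrier (A \<times>\<times> B) \<Longrightarrow> \<chi> x \<in> carrier S" by (auto simp: DirProd_def \<chi>_def)
  have 1: "\<chi> (c \<odot>\<^bsub>A\<^esub> a, b) = \<alpha> c \<otimes>\<^bsub>S\<^esub> \<chi> (a, b)"
    if "a \<in> carrier A" "b \<in> carrier B" "c \<in> carrier k" for a b c
    using that f.hom_mult[of "c \<odot>\<^bsub>A\<^esub> \<one>\<^bsub>A\<^esub>" a] by (simp add: \<chi>_def \<alpha>_def smA[symmetric] S.m_assoc)
  have 2: "\<chi> (a, c \<odot>\<^bsub>B\<^esub> b) = \<alpha> c \<otimes>\<^bsub>S\<^esub> \<chi> (a, b)"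
    if "a \<in> carrier A" "b \<in> carrier B" "c \<in> carrier k" for a b c
    using that g.hom_mult[of "c \<odot>\<^bsub>B\<^esub> \<one>\<^bsub>B\<^esub>" b]
    by (simp add: \<chi>_def \<alpha>_def agree smB[symmetric] S.m_lcomm)
  obtain h where h: "\<And>u. u \<in> carrier P.F \<Longrightarrow> h (proj u) = evaluation k S \<alpha> \<chi> u"
    by (rule bilinear_lift[OF S \<alpha>, of \<chi>]) (use 1 2 in \<open>auto simp: \<chi>_def S.l_distr S.r_distr\<close>)
  have ev: "evaluation k S \<alpha> \<chi> \<in> ring_hom P.F S"
    by (rule P.evaluation_hom[OF S \<alpha> \<chi>']) (auto simp: \<chi>_def DirProd_def S.m_ac)
  interpret ev: ring_hom_ring P.F S "evaluation k S \<alpha> \<chi>"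
    by (intro ring_hom_ringI2 P.F.ring_axioms S.ring_axioms ev)
  have tens: "h (proj (tens a b \<one>)) = f a \<otimes>\<^bsub>S\<^esub> g b" if "a \<in> carrier A" "b \<in> carrier B" for a b
    using that P.evaluation_monomial[where \<chi> = \<chi>, OF S \<alpha> \<chi>', where m = "(a, b)" and a = \<one>] by (simp add: h \<chi>_def \<alpha>_def)
  show ?thesis
  proof (intro bexI[of _ h] conjI ballI)
    show "h \<in> ring_hom T S"
    proof (rule ring_hom_memI)
      fix x y assume "x \<in> carrier T" "y \<in> carrier T"
      then obtain u v where uv: "u \<in> carrier P.F" "x = proj u" "v \<in> carrier P.F" "y = proj v"
        by (metis T_cases)
      then show "h x \<in> carrier S" by (simp add: h)
      have "h (proj (u \<otimes>\<^bsub>P.F\<^esub> v)) = h x \<otimes>\<^bsub>S\<^esub> h y" "h (proj (u \<oplus>\<^bsub>P.F\<^esub> v)) = h x \<oplus>\<^bsub>S\<^esub> h y"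
        using uv by (simp_all only: h P.F.m_closed P.F.a_closed ev.hom_mult ev.hom_add)
      then show "h (x \<otimes>\<^bsub>T\<^esub> y) = h x \<otimes>\<^bsub>S\<^esub> h y" "h (x \<oplus>\<^bsub>T\<^esub> y) = h x \<oplus>\<^bsub>S\<^esub> h y"
        using uv by simp_all
    next
      show "h \<one>\<^bsub>T\<^esub> = \<one>\<^bsub>S\<^esub>" using h[of "\<one>\<^bsub>P.F\<^esub>"] by simp
    qed
    show "h (inl a) = f a" if "a \<in> carrier A" for a using tens[of a "\<one>\<^bsub>B\<^esub>"] that by (simp add: inl_def)
    show "h (inr b) = g b" if "b \<in> carrier B" for b using tens[of "\<one>\<^bsub>A\<^esub>" b] that by (simp add: inr_def)
  qed
qed

text \<open>The map \<open>a \<otimes> b \<mapsto> l(b) a\<close>, an \<open>A\<close>-linear left inverse of \<open>A \<rightarrow> A \<otimes> B\<close>.\<close>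

theorem tensor_retraction:
  assumes l: "\<And>b. b \<in> carrier B \<Longrightarrow> l b \<in> carrier k" "l \<one>\<^bsub>B\<^esub> = \<one>"
    and l_add: "\<And>b b'. b \<in> carrier B \<Longrightarrow> b' \<in> carrier B \<Longrightarrow> l (b \<oplus>\<^bsub>B\<^esub> b') = l b \<oplus> l b'"
    and l_smult: "\<And>c b. c \<in> carrier k \<Longrightarrow> b \<in> carrier B \<Longrightarrow> l (c \<odot>\<^bsub>B\<^esub> b) = c \<otimes> l b"
  shows "\<exists>\<rho>. (\<forall>y\<in>carrier T. \<rho> y \<in> carrier A) \<and>
    (\<forall>x\<in>carrier T. \<forall>y\<in>carrier T. \<rho> (x \<oplus>\<^bsub>T\<^esub> y) = \<rho> x \<oplus>\<^bsub>A\<^esub> \<rho> y) \<and>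
    (\<forall>a\<in>carrier A. \<forall>y\<in>carrier T. \<rho> (inl a \<otimes>\<^bsub>T\<^esub> y) = a \<otimes>\<^bsub>A\<^esub> \<rho> y) \<and>
    \<rho> \<one>\<^bsub>T\<^esub> = \<one>\<^bsub>A\<^esub>"
proof -
  define \<alpha> where "\<alpha> c = c \<odot>\<^bsub>A\<^esub> \<one>\<^bsub>A\<^esub>" for c
  define \<chi> where "\<chi> = (\<lambda>(a, b). l b \<odot>\<^bsub>A\<^esub> a)"
  have \<alpha>_mult: "\<alpha> c \<otimes>\<^bsub>A\<^esub> a = c \<odot>\<^bsub>A\<^esub> a" if "c \<in> carrier k" "a \<in> carrier A" for c a
    using that by (simp add: \<alpha>_def A.smult_assoc2)
  have \<alpha>: "\<alpha> \<in> ring_hom k A"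
    by (rule ring_hom_memI) (auto simp: \<alpha>_def A.smult_assoc1 A.smult_assoc2 A.smult_l_distr)
  have \<chi>': "\<And>x. x \<in> carrier (A \<times>\<times> B) \<Longrightarrow> \<chi> x \<in> carrier A" using l by (auto simp: DirProd_def \<chi>_def)
  have 1: "\<chi> (c \<odot>\<^bsub>A\<^esub> a, b) = \<alpha> c \<otimes>\<^bsub>A\<^esub> \<chi> (a, b)"
    if "a \<in> carrier A" "b \<in> carrier B" "c \<in> carrier k" for a b c
    using that l by (simp add: \<chi>_def \<alpha>_mult A.smult_assoc1[symmetric] A.R.m_comm)
  have 2: "\<chi> (a, c \<odot>\<^bsub>B\<^esub> b) = \<alpha> c \<otimes>\<^bsub>A\<^esub> \<chi> (a, b)"
    if "a \<in> carrier A" "b \<in> carrier B" "c \<in> carrier k" for a b c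
    using that l by (simp add: \<chi>_def \<alpha>_mult l_smult A.smult_assoc1)
  obtain \<rho> where \<rho>: "\<And>u. u \<in> carrier P.F \<Longrightarrow> \<rho> (proj u) = evaluation k A \<alpha> \<chi> u"
    by (rule bilinear_lift[OF A.M_cring \<alpha>, of \<chi>])
      (use 1 2 l in \<open>auto simp: \<chi>_def l_add A.smult_l_distr A.smult_r_distr\<close>)
  have tens: "\<rho> (proj (tens a b \<one>)) = l b \<odot>\<^bsub>A\<^esub> a" if "a \<in> carrier A" "b \<in> carrier B" for a b
    using that l P.evaluation_monomial[where \<chi> = \<chi>, OF A.M_cring \<alpha> \<chi>', where m = "(a, b)" and a = \<one>]
    by (simp add: \<rho> \<chi>_def \<alpha>_mult)
  have closed: "\<rho> y \<in> carrier A" if y: "y \<in> carrier T" for y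
  proof -
    obtain u where "u \<in> carrier P.F" "y = proj u" using T_cases[OF y] .
    then show ?thesis using P.evaluation_closed[where \<chi> = \<chi>, OF A.M_cring \<alpha> \<chi>'] by (simp add: \<rho>)
  qed
  have \<rho>_add: "\<rho> (x \<oplus>\<^bsub>T\<^esub> y) = \<rho> x \<oplus>\<^bsub>A\<^esub> \<rho> y" if xy: "x \<in> carrier T" "y \<in> carrier T" for x y
  proof -
    obtain u v where uv: "u \<in> carrier P.F" "x = proj u" "v \<in> carrier P.F" "y = proj v"
      using xy by (metis T_cases)
    then have "\<rho> (proj (u \<oplus>\<^bsub>P.F\<^esub> v)) = \<rho> x \<oplus>\<^bsub>A\<^esub> \<rho> y"
      using P.evaluation_add[where \<chi> = \<chi>, OF A.M_cring \<alpha> \<chi>'] by (simp only: \<rho> P.F.a_closed)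
    then show ?thesis using uv by simp
  qed
  interpret inl: ring_hom_ring A T inl by (intro ring_hom_ringI2 A_ring T.ring_axioms inl_hom)
  interpret inr: ring_hom_ring B T inr by (intro ring_hom_ringI2 B_ring T.ring_axioms inr_hom)
  have "\<rho> (inl a \<otimes>\<^bsub>T\<^esub> y) = a \<otimes>\<^bsub>A\<^esub> \<rho> y" if a: "a \<in> carrier A" and y: "y \<in> carrier T" for a y
    using y
  proof (induction y rule: tensor_induct)
    case (tensor a' b)
    have "inl a \<otimes>\<^bsub>T\<^esub> (inl a' \<otimes>\<^bsub>T\<^esub> inr b) = proj (tens (a \<otimes>\<^bsub>A\<^esub> a') b \<one>)"
    proof -
      have "inl a \<otimes>\<^bsub>T\<^esub> (inl a' \<otimes>\<^bsub>T\<^esub> inr b) = inl (a \<otimes>\<^bsub>A\<^esub> a') \<otimes>\<^bsub>T\<^esub> inr b"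
        using tensor a by (simp add: T.m_assoc)
      also have "\<dots> = proj (tens (a \<otimes>\<^bsub>A\<^esub> a') b \<one>)"
        using tensor a by (intro inl_mult_inr) auto
      finally show ?thesis .
    qed
    moreover have "a \<otimes>\<^bsub>A\<^esub> (l b \<odot>\<^bsub>A\<^esub> a') = l b \<odot>\<^bsub>A\<^esub> (a \<otimes>\<^bsub>A\<^esub> a')"
      using tensor a l A.m_comm[of a "l b \<odot>\<^bsub>A\<^esub> a'"] A.m_comm[of a a'] A.smult_assoc2[of "l b" a' a]
      by simp
    ultimately show ?case using tensor a l by (simp add: inl_mult_inr tens)
  next
    case (add x y)
    then show ?case using a \<rho>_add closed
      by (simp add: T.r_distr A.r_distr)
  qed
  moreover have "\<rho> \<one>\<^bsub>T\<^esub> = \<one>\<^bsub>A\<^esub>"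
    using tens[of "\<one>\<^bsub>A\<^esub>" "\<one>\<^bsub>B\<^esub>"] l(2) proj.hom_one by (simp add: P.one_eq)
  ultimately show ?thesis by (intro exI[of _ \<rho>] conjI ballI closed \<rho>_add)
qed

end

section \<open>Linear functionals\<close>

text \<open>A submodule \<open>W\<close> maximal among those that do not contain \<open>1\<close> is a complement of the line spanned by \<open>1\<close>, and \<open>l\<close> is the
  coordinate along \<open>1\<close>.\<close>

lemma (in algebra) linear_functional_exists:
  assumes k: "field R" and ne: "\<one>\<^bsub>M\<^esub> \<noteq> \<zero>\<^bsub>M\<^esub>"
  shows "\<exists>l. (\<forall>b\<in>carrier M. l b \<in> carrier R) \<and> l \<one>\<^bsub>M\<^esub> = \<one>\<^bsub>R\<^esub> \<and>
    (\<forall>b\<in>carrier M. \<forall>b'\<in>carrier M. l (b \<oplus>\<^bsub>M\<^esub> b') = l b \<oplus>\<^bsub>R\<^esub> l b') \<and>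
    (\<forall>c\<in>carrier R. \<forall>b\<in>carrier M. l (c \<odot>\<^bsub>M\<^esub> b) = c \<otimes>\<^bsub>R\<^esub> l b)"
proof -
  interpret k: field R by fact
  interpret B: cring M by (rule M_cring)
  define Fam where "Fam = {W. submodule W R M \<and> \<one>\<^bsub>M\<^esub> \<notin> W}"
  have z: "submodule {\<zero>\<^bsub>M\<^esub>} R M" by (rule submoduleI) auto
  have "\<exists>W\<in>Fam. \<forall>V\<in>Fam. W \<subseteq> V \<longrightarrow> V = W"
  proof (rule subset_Zorn_nonempty)
    show "Fam \<noteq> {}" using z ne by (auto simp: Fam_def)
    fix \<C> assume C: "\<C> \<noteq> {}" "subset.chain Fam \<C>"
    have sub: "submodule V R M" "\<one>\<^bsub>M\<^esub> \<notin> V" if "V \<in> \<C>" for V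
      using C(2) that by (auto simp: subset_chain_def Fam_def)
    have "submodule (\<Union>\<C>) R M"
    proof (rule submoduleI)
      show "\<Union>\<C> \<subseteq> carrier M" using submoduleE(1)[OF sub(1)] by blast
      obtain V where V: "V \<in> \<C>" using C by blast
      have "\<zero>\<^bsub>M\<^esub> \<in> V" using subgroup.one_closed[OF submodule.axioms(1)[OF sub(1)[OF V]]] by simp
      then show "\<zero>\<^bsub>M\<^esub> \<in> \<Union>\<C>" using V by blast
    next
      fix a assume "a \<in> \<Union>\<C>"
      then show "\<ominus>\<^bsub>M\<^esub> a \<in> \<Union>\<C>" using submoduleE(3)[OF sub(1)] by blast
    next
      fix a b assume "a \<in> \<Union>\<C>" "b \<in> \<Union>\<C>"
      then obtain V W where VW: "V \<in> \<C>" "W \<in> \<C>" "a \<in> V" "b \<in> W" by blast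
      then have "V \<subseteq> W \<or> W \<subseteq> V" using C(2) by (auto simp: subset_chain_def)
      then obtain U where "U \<in> \<C>" "a \<in> U" "b \<in> U" using VW by blast
      then show "a \<oplus>\<^bsub>M\<^esub> b \<in> \<Union>\<C>" using submoduleE(5)[OF sub(1)] by blast
    next
      fix a x assume "a \<in> carrier R" "x \<in> \<Union>\<C>"
      then show "a \<odot>\<^bsub>M\<^esub> x \<in> \<Union>\<C>" using submoduleE(4)[OF sub(1)] by blast
    qed
    then show "\<Union>\<C> \<in> Fam" using sub(2) by (auto simp: Fam_def)
  qed
  then obtain W where W: "submodule W R M" "\<one>\<^bsub>M\<^esub> \<notin> W"
    and max: "\<And>V. submodule V R M \<Longrightarrow> \<one>\<^bsub>M\<^esub> \<notin> V \<Longrightarrow> W \<subseteq> V \<Longrightarrow> V = W"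
    unfolding Fam_def by blast
  note Wp = submoduleE[OF W(1)]
  have Wz: "\<zero>\<^bsub>M\<^esub> \<in> W" using subgroup.one_closed[OF submodule.axioms(1)[OF W(1)]] by simp
  have WM: "w \<in> carrier M" if "w \<in> W" for w using Wp(1) that by blast
  have decomp: "\<exists>c\<in>carrier R. \<exists>w\<in>W. b = c \<odot>\<^bsub>M\<^esub> \<one>\<^bsub>M\<^esub> \<oplus>\<^bsub>M\<^esub> w" if b: "b \<in> carrier M" for b
  proof (cases "b \<in> W")
    case True
    then have "b = \<zero>\<^bsub>R\<^esub> \<odot>\<^bsub>M\<^esub> \<one>\<^bsub>M\<^esub> \<oplus>\<^bsub>M\<^esub> b" using b by simp
    then show ?thesis using True by blast
  next
    case False
    define V where "V = {w \<oplus>\<^bsub>M\<^esub> c \<odot>\<^bsub>M\<^esub> b | w c. w \<in> W \<and> c \<in> carrier R}"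
    have "submodule V R M"
    proof (rule submoduleI)
      show "V \<subseteq> carrier M" using b WM by (auto simp: V_def)
      have "\<zero>\<^bsub>M\<^esub> = \<zero>\<^bsub>M\<^esub> \<oplus>\<^bsub>M\<^esub> \<zero>\<^bsub>R\<^esub> \<odot>\<^bsub>M\<^esub> b" using b by simp
      then show "\<zero>\<^bsub>M\<^esub> \<in> V" unfolding V_def using Wz by blast
    next
      fix x assume "x \<in> V"
      then obtain w c where x: "x = w \<oplus>\<^bsub>M\<^esub> c \<odot>\<^bsub>M\<^esub> b" "w \<in> W" "c \<in> carrier R" by (auto simp: V_def)
      have "\<ominus>\<^bsub>M\<^esub> x = \<ominus>\<^bsub>M\<^esub> w \<oplus>\<^bsub>M\<^esub> (\<ominus>\<^bsub>R\<^esub> c) \<odot>\<^bsub>M\<^esub> b"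
        using x b WM by (simp add: M.minus_add smult_l_minus)
      then show "\<ominus>\<^bsub>M\<^esub> x \<in> V" unfolding V_def using x Wp(3) by blast
      fix y assume "y \<in> V"
      then obtain v d where y: "y = v \<oplus>\<^bsub>M\<^esub> d \<odot>\<^bsub>M\<^esub> b" "v \<in> W" "d \<in> carrier R" by (auto simp: V_def)
      have "x \<oplus>\<^bsub>M\<^esub> y = (w \<oplus>\<^bsub>M\<^esub> v) \<oplus>\<^bsub>M\<^esub> (c \<oplus>\<^bsub>R\<^esub> d) \<odot>\<^bsub>M\<^esub> b"
        using x y b WM by (simp add: smult_l_distr M.a_ac)
      then show "x \<oplus>\<^bsub>M\<^esub> y \<in> V" unfolding V_def using x y Wp(5) by blast
    next
      fix a x assume a: "a \<in> carrier R" and "x \<in> V"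
      then obtain w c where x: "x = w \<oplus>\<^bsub>M\<^esub> c \<odot>\<^bsub>M\<^esub> b" "w \<in> W" "c \<in> carrier R" by (auto simp: V_def)
      have "a \<odot>\<^bsub>M\<^esub> x = a \<odot>\<^bsub>M\<^esub> w \<oplus>\<^bsub>M\<^esub> (a \<otimes>\<^bsub>R\<^esub> c) \<odot>\<^bsub>M\<^esub> b"
        using x a b WM by (simp add: smult_r_distr smult_assoc1)
      then show "a \<odot>\<^bsub>M\<^esub> x \<in> V" unfolding V_def using x a Wp(4) by blast
    qed
    moreover have "W \<subseteq> V"
    proof
      fix w assume w: "w \<in> W"
      have "w = w \<oplus>\<^bsub>M\<^esub> \<zero>\<^bsub>R\<^esub> \<odot>\<^bsub>M\<^esub> b" using b WM[OF w] by simp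
      then show "w \<in> V" unfolding V_def using w by blast
    qed
    moreover have "V \<noteq> W"
    proof -
      have "b = \<zero>\<^bsub>M\<^esub> \<oplus>\<^bsub>M\<^esub> \<one>\<^bsub>R\<^esub> \<odot>\<^bsub>M\<^esub> b" using b by simp
      then have "b \<in> V" unfolding V_def using Wz by blast
      then show ?thesis using False by blast
    qed
    ultimately have "\<one>\<^bsub>M\<^esub> \<in> V" using max by blast
    then obtain w c where wc: "\<one>\<^bsub>M\<^esub> = w \<oplus>\<^bsub>M\<^esub> c \<odot>\<^bsub>M\<^esub> b" "w \<in> W" "c \<in> carrier R" by (auto simp: V_def)
    have "c \<noteq> \<zero>\<^bsub>R\<^esub>" using wc W(2) b WM by auto
    then have ic: "inv\<^bsub>R\<^esub> c \<in> carrier R" "inv\<^bsub>R\<^esub> c \<otimes>\<^bsub>R\<^esub> c = \<one>\<^bsub>R\<^esub>" using wc(3) k.field_Units by auto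
    have "inv\<^bsub>R\<^esub> c \<odot>\<^bsub>M\<^esub> \<one>\<^bsub>M\<^esub> = inv\<^bsub>R\<^esub> c \<odot>\<^bsub>M\<^esub> w \<oplus>\<^bsub>M\<^esub> b"
      unfolding wc(1) using ic wc(2,3) WM b by (simp add: smult_r_distr smult_assoc1[symmetric])
    then have "b = inv\<^bsub>R\<^esub> c \<odot>\<^bsub>M\<^esub> \<one>\<^bsub>M\<^esub> \<oplus>\<^bsub>M\<^esub> \<ominus>\<^bsub>M\<^esub> (inv\<^bsub>R\<^esub> c \<odot>\<^bsub>M\<^esub> w)"
      using ic wc(2) WM b by (simp add: M.a_ac M.r_neg2 M.r_neg1 M.r_neg)
    moreover have "\<ominus>\<^bsub>M\<^esub> (inv\<^bsub>R\<^esub> c \<odot>\<^bsub>M\<^esub> w) \<in> W" using Wp(3,4) ic wc(2) by blast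
    ultimately show ?thesis using ic(1) by blast
  qed
  have unique: "c = c'" if c: "c \<in> carrier R" "c' \<in> carrier R" and w: "w \<in> W" "w' \<in> W"
    and eq: "c \<odot>\<^bsub>M\<^esub> \<one>\<^bsub>M\<^esub> \<oplus>\<^bsub>M\<^esub> w = c' \<odot>\<^bsub>M\<^esub> \<one>\<^bsub>M\<^esub> \<oplus>\<^bsub>M\<^esub> w'" for c c' w w'
  proof (rule ccontr)
    assume "c \<noteq> c'"
    define d where "d = c \<ominus>\<^bsub>R\<^esub> c'"
    have d: "d \<in> carrier R" "d \<noteq> \<zero>\<^bsub>R\<^esub>" using c \<open>c \<noteq> c'\<close> by (auto simp: d_def)
    have "d \<odot>\<^bsub>M\<^esub> \<one>\<^bsub>M\<^esub> = c \<odot>\<^bsub>M\<^esub> \<one>\<^bsub>M\<^esub> \<oplus>\<^bsub>M\<^esub> \<ominus>\<^bsub>M\<^esub> (c' \<odot>\<^bsub>M\<^esub> \<one>\<^bsub>M\<^esub>)"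
      using c by (simp add: d_def R.minus_eq smult_l_distr smult_l_minus)
    also have "c \<odot>\<^bsub>M\<^esub> \<one>\<^bsub>M\<^esub> = (c' \<odot>\<^bsub>M\<^esub> \<one>\<^bsub>M\<^esub> \<oplus>\<^bsub>M\<^esub> w') \<oplus>\<^bsub>M\<^esub> \<ominus>\<^bsub>M\<^esub> w"
      using eq c w WM by (metis M.a_assoc M.r_neg M.r_zero M.a_inv_closed one_closed smult_closed)
    also have "\<dots> \<oplus>\<^bsub>M\<^esub> \<ominus>\<^bsub>M\<^esub> (c' \<odot>\<^bsub>M\<^esub> \<one>\<^bsub>M\<^esub>) = w' \<oplus>\<^bsub>M\<^esub> \<ominus>\<^bsub>M\<^esub> w"
      using c w WM by (simp add: M.a_ac M.r_neg2 M.r_neg1 M.r_neg)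
    finally have dW: "d \<odot>\<^bsub>M\<^esub> \<one>\<^bsub>M\<^esub> \<in> W" using Wp(3,5) w by simp
    have id: "inv\<^bsub>R\<^esub> d \<in> carrier R" "inv\<^bsub>R\<^esub> d \<otimes>\<^bsub>R\<^esub> d = \<one>\<^bsub>R\<^esub>" using d k.field_Units by auto
    have "inv\<^bsub>R\<^esub> d \<odot>\<^bsub>M\<^esub> (d \<odot>\<^bsub>M\<^esub> \<one>\<^bsub>M\<^esub>) = \<one>\<^bsub>M\<^esub>" using id d by (simp add: smult_assoc1[symmetric])
    then show False using Wp(4)[OF id(1) dW] W(2) by simp
  qed
  define l where "l b = (THE c. c \<in> carrier R \<and> (\<exists>w\<in>W. b = c \<odot>\<^bsub>M\<^esub> \<one>\<^bsub>M\<^esub> \<oplus>\<^bsub>M\<^esub> w))" for b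
  have l: "l (c \<odot>\<^bsub>M\<^esub> \<one>\<^bsub>M\<^esub> \<oplus>\<^bsub>M\<^esub> w) = c" if "c \<in> carrier R" "w \<in> W" for c w
    unfolding l_def using that unique by (intro the_equality) blast+
  have main: "l b \<in> carrier R" "\<And>b'. b' \<in> carrier M \<Longrightarrow> l (b \<oplus>\<^bsub>M\<^esub> b') = l b \<oplus>\<^bsub>R\<^esub> l b'"
    "\<And>d. d \<in> carrier R \<Longrightarrow> l (d \<odot>\<^bsub>M\<^esub> b) = d \<otimes>\<^bsub>R\<^esub> l b" if b: "b \<in> carrier M" for b
  proof -
    from decomp[OF b] obtain c w where c: "c \<in> carrier R" "w \<in> W" "b = c \<odot>\<^bsub>M\<^esub> \<one>\<^bsub>M\<^esub> \<oplus>\<^bsub>M\<^esub> w" by blast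
    then show "l b \<in> carrier R" by (simp add: l)
    {
      fix b' assume b': "b' \<in> carrier M"
      from decomp[OF b'] obtain c' w' where c': "c' \<in> carrier R" "w' \<in> W" "b' = c' \<odot>\<^bsub>M\<^esub> \<one>\<^bsub>M\<^esub> \<oplus>\<^bsub>M\<^esub> w'"
        by blast
      have "b \<oplus>\<^bsub>M\<^esub> b' = (c \<oplus>\<^bsub>R\<^esub> c') \<odot>\<^bsub>M\<^esub> \<one>\<^bsub>M\<^esub> \<oplus>\<^bsub>M\<^esub> (w \<oplus>\<^bsub>M\<^esub> w')"
        using c c' WM by (simp add: smult_l_distr M.a_ac)
      then show "l (b \<oplus>\<^bsub>M\<^esub> b') = l b \<oplus>\<^bsub>R\<^esub> l b'" using c c' Wp(5) by (simp add: l)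
    }
    fix d assume d: "d \<in> carrier R"
    have "d \<odot>\<^bsub>M\<^esub> b = (d \<otimes>\<^bsub>R\<^esub> c) \<odot>\<^bsub>M\<^esub> \<one>\<^bsub>M\<^esub> \<oplus>\<^bsub>M\<^esub> d \<odot>\<^bsub>M\<^esub> w"
      using c d WM by (simp add: smult_r_distr smult_assoc1)
    then show "l (d \<odot>\<^bsub>M\<^esub> b) = d \<otimes>\<^bsub>R\<^esub> l b" using c d Wp(4) by (simp add: l)
  qed
  have "\<one>\<^bsub>M\<^esub> = \<one>\<^bsub>R\<^esub> \<odot>\<^bsub>M\<^esub> \<one>\<^bsub>M\<^esub> \<oplus>\<^bsub>M\<^esub> \<zero>\<^bsub>M\<^esub>" by simp
  then have "l \<one>\<^bsub>M\<^esub> = \<one>\<^bsub>R\<^esub>" using l[OF R.one_closed Wz] by simp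
  then show ?thesis by (intro exI[of _ l] conjI ballI main)
qed

section \<open>Generalised polynomials over a domain\<close>

lemma rat_monoid_simps [simp]:
  "carrier nonneg_rat_monoid = {q. 0 \<le> q}" "\<one>\<^bsub>nonneg_rat_monoid\<^esub> = 0"
  "x \<otimes>\<^bsub>nonneg_rat_monoid\<^esub> y = x + y"
  by (simp_all add: nonneg_rat_monoid_def)

lemma rat_monoid_pow: "x [^]\<^bsub>nonneg_rat_monoid\<^esub> (n::nat) = of_nat n * x"
  by (induction n) (simp_all add: algebra_simps)

locale root_poly_domain = k: domain k for k :: "('k, 'c) ring_scheme" (structure)
begin

abbreviation "D \<equiv> root_polys k"

sublocale D: domain "root_polys k" by (rule root_polys_domain[OF k.domain_axioms])

sublocale M: monoid_algebra_setup k nonneg_rat_monoid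
  rewrites "monoid_algebra k nonneg_rat_monoid = root_polys k"
  by (intro monoid_algebra_setup.intro k.cring_axioms nonneg_rat_monoid_comm)
    (simp add: root_polys_def)

lemma poly_const_hom: "(\<lambda>c. monomial k 0 c) \<in> ring_hom k D"
  using M.const_hom by simp

sublocale pconst: ring_hom_ring k "root_polys k" "\<lambda>c. monomial k 0 c"
  by (intro ring_hom_ringI2 k.ring_axioms D.ring_axioms poly_const_hom)

lemma mono_D: "0 \<le> q \<Longrightarrow> c \<in> carrier k \<Longrightarrow> monomial k q c \<in> carrier D"
  using M.monomial_closed[of q c] by simp

lemma Qt_D_field: "field (Qt D)" by (rule D.Qt_field)

sublocale QD: field "Qt (root_polys k)" by (rule Qt_D_field)

sublocale embed: ring_hom_ring "root_polys k" "Qt (root_polys k)"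
    "\<lambda>f. fraction (root_polys k) f \<one>\<^bsub>root_polys k\<^esub>"
  by (intro ring_hom_ringI2 D.ring_axioms QD.ring_axioms D.Qt_embed_hom)

text \<open>The constant coefficient is the evaluation for \<open>\<chi> 0 = 1\<close> and \<open>\<chi> q = 0\<close> otherwise, which is multiplicative because a
  sum of exponents vanishes only if both exponents do.\<close>

lemma const_coeff_hom: "(\<lambda>f. f 0) \<in> ring_hom D k"
proof -
  define \<chi> where "\<chi> q = (if q = 0 then \<one> else \<zero>)" for q :: rat
  have \<chi>: "\<chi> q \<in> carrier k" for q by (simp add: \<chi>_def)
  have id: "(\<lambda>x. x) \<in> ring_hom k k" by (rule ring_hom_memI) auto
  have hom: "evaluation k k (\<lambda>x. x) \<chi> \<in> ring_hom D k"
    by (rule M.evaluation_hom[OF k.cring_axioms id \<chi>]) (auto simp: \<chi>_def)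
  have "evaluation k k (\<lambda>x. x) \<chi> f = f 0" if "f \<in> carrier D" for f
    using that
  proof (induction f rule: M.induct)
    case zero
    show ?case
      by (subst M.evaluation_zero[where \<chi> = \<chi>, OF k.cring_axioms id \<chi>]) (simp add: M.zero_apply)
  next
    case (monomial m a)
    then show ?case
      by (subst M.evaluation_monomial[where \<chi> = \<chi>, OF k.cring_axioms id \<chi>])
        (auto simp: M.monomial_apply \<chi>_def)
  next
    case (add f g)
    then show ?case
      by (subst M.evaluation_add[where \<chi> = \<chi>, OF k.cring_axioms id \<chi>]) (simp_all add: M.add_apply)
  qed
  then show ?thesis by (rule D.ring_hom_restrict[OF hom])
qed

sublocale cc: ring_hom_ring "root_polys k" k "\<lambda>f. f 0"
  by (intro ring_hom_ringI2 D.ring_axioms k.ring_axioms const_coeff_hom)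

lemma low_order_mult:
  assumes f: "f \<in> carrier D" and g: "g \<in> carrier D" and low: "\<And>x. x < q \<Longrightarrow> f x = \<zero>" and x: "x < q"
  shows "(f \<otimes>\<^bsub>D\<^esub> g) x = \<zero>"
proof -
  note fm = M.memD[OF f] and gm = M.memD[OF g]
  have "\<not> (u \<in> M.supp f \<times> M.supp g \<and> fst u \<otimes>\<^bsub>nonneg_rat_monoid\<^esub> snd u = x)" for u
  proof
    assume u: "u \<in> M.supp f \<times> M.supp g \<and> fst u \<otimes>\<^bsub>nonneg_rat_monoid\<^esub> snd u = x"
    then have "f (fst u) \<noteq> \<zero>" by (simp add: mem_Times_iff)
    then have "fst u \<ge> q" using low[of "fst u"] by (meson not_less)
    moreover have "snd u \<in> M.supp g" using u by (simp add: mem_Times_iff)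
    then have "snd u \<ge> 0" using subsetD[OF gm(3)] by simp
    moreover have "fst u + snd u = x" using u by simp
    ultimately show False using x by linarith
  qed
  then have "{u \<in> M.supp f \<times> M.supp g. fst u \<otimes>\<^bsub>nonneg_rat_monoid\<^esub> snd u = x} = {}" by blast
  then show ?thesis
    using M.mult_apply_superset[OF f g fm(2) subset_refl gm(2) subset_refl, of x]
    by (simp only: k.finsum_empty)
qed

lemma monomial_mult_apply:
  assumes "0 \<le> r" "b \<in> carrier k" "g \<in> carrier D"
  shows "(monomial k r b \<otimes>\<^bsub>D\<^esub> g) r = b \<otimes> g 0"
proof -
  note gm = M.memD[OF assms(3)]
  let ?T = "insert 0 (M.supp g)"
  have "(monomial k r b \<otimes>\<^bsub>D\<^esub> g) r = (\<Oplus>u\<in>{u \<in> {r} \<times> ?T. fst u \<otimes>\<^bsub>nonneg_rat_monoid\<^esub> snd u = r}.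
      monomial k r b (fst u) \<otimes> g (snd u))"
    using gm assms by (intro M.mult_apply_superset mono_D) (auto simp: M.monomial_apply)
  also have "{u \<in> {r} \<times> ?T. fst u \<otimes>\<^bsub>nonneg_rat_monoid\<^esub> snd u = r} = {(r, 0)}" by auto
  finally have e: "(monomial k r b \<otimes>\<^bsub>D\<^esub> g) r = (\<Oplus>u\<in>{(r, 0)}. monomial k r b (fst u) \<otimes> g (snd u))" .
  show ?thesis unfolding e using gm(1)[of 0] assms by (simp add: M.monomial_apply)
qed

text \<open>The order of a generalised polynomial is its lowest exponent, and a denominator with nonzero constant coefficient
  has order \<open>0\<close>. These are the fractions of order at least \<open>q\<close> whose denominators can be chosen in this way.\<close>

definition order_at_least :: "rat \<Rightarrow> ((rat \<Rightarrow> 'k) \<times> (rat \<Rightarrow> 'k)) set set" where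
  "order_at_least q = {fraction D f g | f g. f \<in> carrier D \<and> g \<in> carrier D \<and> g 0 \<noteq> \<zero> \<and> (\<forall>x<q. f x = \<zero>)}"

lemma const_coeff_nonzero: "g \<in> carrier D \<Longrightarrow> g 0 \<noteq> \<zero> \<Longrightarrow> g \<in> carrier D - {\<zero>\<^bsub>D\<^esub>}"
  by (auto simp: M.zero_apply)

lemma order_add:
  assumes "w \<in> order_at_least q" "w' \<in> order_at_least q"
  shows "w \<oplus>\<^bsub>Qt D\<^esub> w' \<in> order_at_least q"
proof -
  obtain f g where f: "f \<in> carrier D" "g \<in> carrier D" "g 0 \<noteq> \<zero>" "\<forall>x<q. f x = \<zero>" "w = fraction D f g"
    using assms(1) unfolding order_at_least_def by blast
  obtain f' g' where f': "f' \<in> carrier D" "g' \<in> carrier D" "g' 0 \<noteq> \<zero>" "\<forall>x<q. f' x = \<zero>" "w' = fraction D f' g'"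
    using assms(2) unfolding order_at_least_def by blast
  have e: "w \<oplus>\<^bsub>Qt D\<^esub> w' = fraction D (f \<otimes>\<^bsub>D\<^esub> g' \<oplus>\<^bsub>D\<^esub> f' \<otimes>\<^bsub>D\<^esub> g) (g \<otimes>\<^bsub>D\<^esub> g')"
    unfolding f(5) f'(5) by (intro D.fraction_add const_coeff_nonzero f f')
  have "(g \<otimes>\<^bsub>D\<^esub> g') 0 \<noteq> \<zero>"
    using cc.hom_mult[OF f(2) f'(2)] f(3) f'(3) cc.hom_closed[OF f(2)] cc.hom_closed[OF f'(2)]
    by (simp add: k.integral_iff)
  moreover have "(f \<otimes>\<^bsub>D\<^esub> g' \<oplus>\<^bsub>D\<^esub> f' \<otimes>\<^bsub>D\<^esub> g) x = \<zero>" if "x < q" for x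
    using low_order_mult[OF f(1) f'(2), of q x] low_order_mult[OF f'(1) f(2), of q x] f(4) f'(4) that
    by (simp add: M.add_apply)
  ultimately show ?thesis
    unfolding e order_at_least_def using f(1,2) f'(1,2) D.a_closed D.m_closed by blast
qed

lemma order_mult:
  assumes "w \<in> order_at_least q" "w' \<in> order_at_least r"
  shows "w \<otimes>\<^bsub>Qt D\<^esub> w' \<in> order_at_least q"
proof -
  obtain f g where f: "f \<in> carrier D" "g \<in> carrier D" "g 0 \<noteq> \<zero>" "\<forall>x<q. f x = \<zero>" "w = fraction D f g"
    using assms(1) unfolding order_at_least_def by blast
  obtain f' g' where f': "f' \<in> carrier D" "g' \<in> carrier D" "g' 0 \<noteq> \<zero>" "w' = fraction D f' g'"
    using assms(2) unfolding order_at_least_def by blast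
  have e: "w \<otimes>\<^bsub>Qt D\<^esub> w' = fraction D (f \<otimes>\<^bsub>D\<^esub> f') (g \<otimes>\<^bsub>D\<^esub> g')"
    unfolding f(5) f'(4) by (intro D.fraction_mult const_coeff_nonzero f f')
  have "(g \<otimes>\<^bsub>D\<^esub> g') 0 \<noteq> \<zero>"
    using cc.hom_mult[OF f(2) f'(2)] f(3) f'(3) cc.hom_closed[OF f(2)] cc.hom_closed[OF f'(2)]
    by (simp add: k.integral_iff)
  moreover have "\<forall>x<q. (f \<otimes>\<^bsub>D\<^esub> f') x = \<zero>"
    using low_order_mult[OF f(1) f'(1), of q] f(4) by blast
  ultimately show ?thesis
    unfolding e order_at_least_def using f(1,2) f'(1,2) D.m_closed by blast
qed

lemma order_mono: "q \<le> r \<Longrightarrow> order_at_least r \<subseteq> order_at_least q"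
  unfolding order_at_least_def by (blast intro: less_le_trans)

lemma order_embed:
  assumes "f \<in> carrier D" "\<And>x. x < q \<Longrightarrow> f x = \<zero>"
  shows "fraction D f \<one>\<^bsub>D\<^esub> \<in> order_at_least q"
  unfolding order_at_least_def
proof (rule CollectI, rule exI[of _ f], rule exI[of _ "\<one>\<^bsub>D\<^esub>"], intro conjI allI impI)
  show "\<one>\<^bsub>D\<^esub> 0 \<noteq> \<zero>" using cc.hom_one k.one_not_zero by simp
qed (use assms in auto)

lemma order_zero: "\<zero>\<^bsub>Qt D\<^esub> \<in> order_at_least q"
  unfolding D.Qt_zero by (rule order_embed) (auto simp: M.zero_apply)

lemma order_monomial:
  assumes r: "0 \<le> r" "b \<in> carrier k" "b \<noteq> \<zero>"
    and mem: "fraction D (monomial k r b) \<one>\<^bsub>D\<^esub> \<in> order_at_least q"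
  shows "q \<le> r"
proof (rule ccontr)
  assume "\<not> q \<le> r"
  obtain f g where f: "f \<in> carrier D" "g \<in> carrier D" "g 0 \<noteq> \<zero>" "\<forall>x<q. f x = \<zero>"
      "fraction D (monomial k r b) \<one>\<^bsub>D\<^esub> = fraction D f g"
    using mem unfolding order_at_least_def by blast
  have "monomial k r b \<otimes>\<^bsub>D\<^esub> g = f"
    using D.fraction_eq_iff[of "monomial k r b" "\<one>\<^bsub>D\<^esub>" f g] f(1,2,5) const_coeff_nonzero[OF f(2,3)]
      mono_D[OF r(1,2)] by simp
  then have "b \<otimes> g 0 = \<zero>"
    using monomial_mult_apply[OF r(1,2) f(2)] f(4) \<open>\<not> q \<le> r\<close> by (metis not_le)
  then show False using r(2,3) f(3) cc.hom_closed[OF f(2)] by (simp add: k.integral_iff)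
qed

end

section \<open>The perfect closure of k(t)\<close>

lemma cring_cong:
  assumes R: "cring R" and eq: "carrier S = carrier R" "monoid.mult S = monoid.mult R" "one S = one R"
    "ring.zero S = ring.zero R" "ring.add S = ring.add R"
  shows "cring S"
proof -
  interpret cring R by fact
  show ?thesis
  proof (intro cringI abelian_groupI comm_monoidI)
    fix x assume "x \<in> carrier S"
    then show "\<exists>y\<in>carrier S. y \<oplus>\<^bsub>S\<^esub> x = \<zero>\<^bsub>S\<^esub>" unfolding eq by (intro bexI[of _ "\<ominus>\<^bsub>R\<^esub> x"]) (auto simp: l_neg)
  qed (simp_all add: eq a_ac m_ac l_distr r_distr)
qed

lemma field_cong:
  assumes R: "field R" and eq: "carrier S = carrier R" "monoid.mult S = monoid.mult R" "one S = one R"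
    "ring.zero S = ring.zero R" "ring.add S = ring.add R"
  shows "field S"
proof -
  interpret field R by fact
  interpret S: cring S by (rule cring_cong[OF cring_axioms eq])
  show ?thesis
  proof (rule S.cring_fieldI2)
    fix a assume "a \<in> carrier S" "a \<noteq> \<zero>\<^bsub>S\<^esub>"
    then show "\<exists>b\<in>carrier S. a \<otimes>\<^bsub>S\<^esub> b = \<one>\<^bsub>S\<^esub>" unfolding eq using field_Units by (intro bexI[of _ "inv\<^bsub>R\<^esub> a"]) auto
  qed (simp add: eq)
qed

locale perfect_closure =
  fixes p :: nat and k :: "('k, 'c) ring_scheme" (structure)
  assumes perfect: "perfect_field_of_char p k"
begin

sublocale k: field k using perfect by (simp add: perfect_field_of_char_def)

sublocale root_poly_domain k by unfold_locales

lemma p_prime: "Factorial_Ring.prime p" and p_zero: "add_pow k p \<one> = \<zero>"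
  using perfect by (simp_all add: perfect_field_of_char_def)

lemma p_pos: "p > 0" using prime_gt_0_nat[OF p_prime] .

abbreviation "\<Omega> \<equiv> ambient k"
abbreviation "Kinf \<equiv> k_infty p k"
abbreviation "const \<equiv> ambient_const k"
abbreviation "t \<equiv> t_root p k"
abbreviation "consts \<equiv> const ` carrier k"

lemma ambient_eq: "ambient k = Qt D" by (simp add: ambient_def)

sublocale \<Omega>: field "ambient k" unfolding ambient_eq by (rule D.Qt_field)

lemma embed_hom: "(\<lambda>f. fraction D f \<one>\<^bsub>D\<^esub>) \<in> ring_hom D \<Omega>"
  unfolding ambient_eq by (rule D.Qt_embed_hom)

sublocale em: ring_hom_ring "root_polys k" "ambient k" "\<lambda>f. fraction (root_polys k) f \<one>\<^bsub>root_polys k\<^esub>"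
  by (intro ring_hom_ringI2 D.ring_axioms \<Omega>.ring_axioms embed_hom)

lemma const_hom: "const \<in> ring_hom k \<Omega>"
  using ring_hom_trans[OF poly_const_hom embed_hom] unfolding ambient_const_def[abs_def] comp_def .

sublocale const: ring_hom_ring k "ambient k" "ambient_const k"
  by (intro ring_hom_ringI2 k.ring_axioms \<Omega>.ring_axioms const_hom)

lemma consts_subfield: "subfield consts \<Omega>"
  by (rule const.img_is_subfield(2)[OF k.carrier_is_subfield]) simp

lemma t_closed [simp]: "t m \<in> carrier \<Omega>"
  unfolding t_root_def by (intro em.hom_closed mono_D) auto

lemma t_power: "t (Suc m) [^]\<^bsub>\<Omega>\<^esub> p = t m"
proof -
  have "monomial k (1 / of_nat p ^ Suc m) \<one> [^]\<^bsub>D\<^esub> p = monomial k (of_nat p * (1 / of_nat p ^ Suc m)) \<one>"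
    using M.monomial_pow[of "1 / of_nat p ^ Suc m" p] by (simp add: rat_monoid_pow)
  also have "of_nat p * (1 / of_nat p ^ Suc m) = (1 / of_nat p ^ m :: rat)"
    using p_pos by simp
  finally show ?thesis
    using em.hom_nat_pow[of "monomial k (1 / of_nat p ^ Suc m) \<one>" p] mono_D
    by (simp add: t_root_def)
qed

definition "stage m = generate_field \<Omega> (consts \<union> {t m})"

lemma gens_carrier: "consts \<union> {t m} \<subseteq> carrier \<Omega>" by auto

lemma stage_subfield: "subfield (stage m) \<Omega>"
  unfolding stage_def by (rule \<Omega>.generate_field_is_subfield[OF gens_carrier])

lemma stage_incl: "consts \<subseteq> stage m" "t m \<in> stage m"
  unfolding stage_def by (auto intro: generate_field.incl)

lemma stage_mono: "m \<le> n \<Longrightarrow> stage m \<subseteq> stage n"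
proof (rule lift_Suc_mono_le[of stage])
  fix m
  have "t (Suc m) [^]\<^bsub>\<Omega>\<^esub> n \<in> stage (Suc m)" for n :: nat
    using subringE(3,6)[OF subfieldE(1)[OF stage_subfield[of "Suc m"]]] stage_incl(2)[of "Suc m"]
    by (induction n) auto
  then have "t m \<in> stage (Suc m)" by (metis t_power)
  then show "stage m \<subseteq> stage (Suc m)"
    unfolding stage_def[of m] using stage_incl(1)
    by (intro \<Omega>.generate_field_min_subfield1[OF gens_carrier stage_subfield]) auto
qed

lemma Kinf_carrier: "carrier Kinf = (\<Union>m. stage m)"
  by (simp add: k_infty_def stage_def)

lemma Kinf_simps [simp]:
  "monoid.mult Kinf = monoid.mult \<Omega>" "one Kinf = one \<Omega>" "ring.zero Kinf = ring.zero \<Omega>" "ring.add Kinf = ring.add \<Omega>"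
  "c \<odot>\<^bsub>Kinf\<^esub> x = const c \<otimes>\<^bsub>\<Omega>\<^esub> x"
  by (simp_all add: k_infty_def)

lemma Kinf_subfield: "subfield (carrier Kinf) \<Omega>"
proof (rule \<Omega>.subfieldI'[OF \<Omega>.subringI])
  note S = subringE[OF subfieldE(1)[OF stage_subfield]]
  show "carrier Kinf \<subseteq> carrier \<Omega>" using S(1) by (auto simp: Kinf_carrier)
  show "\<one>\<^bsub>\<Omega>\<^esub> \<in> carrier Kinf" using S(3) by (auto simp: Kinf_carrier)
  fix x assume "x \<in> carrier Kinf"
  then obtain m where m: "x \<in> stage m" by (auto simp: Kinf_carrier)
  then show "\<ominus>\<^bsub>\<Omega>\<^esub> x \<in> carrier Kinf" using S(5) by (auto simp: Kinf_carrier)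
  fix y assume "y \<in> carrier Kinf"
  then obtain n where n: "y \<in> stage n" by (auto simp: Kinf_carrier)
  have "x \<in> stage (max m n)" "y \<in> stage (max m n)"
    using m n stage_mono[of m "max m n"] stage_mono[of n "max m n"] by auto
  then show "x \<otimes>\<^bsub>\<Omega>\<^esub> y \<in> carrier Kinf" "x \<oplus>\<^bsub>\<Omega>\<^esub> y \<in> carrier Kinf"
    using S(6,7)[of x "max m n" y] by (auto simp: Kinf_carrier)
next
  fix x assume "x \<in> carrier Kinf - {\<zero>\<^bsub>\<Omega>\<^esub>}"
  then obtain m where m: "x \<in> stage m - {\<zero>\<^bsub>\<Omega>\<^esub>}" by (auto simp: Kinf_carrier)
  then show "inv\<^bsub>\<Omega>\<^esub> x \<in> carrier Kinf"
    using \<Omega>.subfield_m_inv(1)[OF stage_subfield m] by (auto simp: Kinf_carrier)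
qed

lemma Kinf_field: "field Kinf"
  by (rule field_cong[OF \<Omega>.subfield_iff(2)[OF Kinf_subfield]]) simp_all

sublocale Kinf: field "k_infty p k" by (rule Kinf_field)

lemma t_Kinf [simp]: "t m \<in> carrier Kinf" using stage_incl(2) by (auto simp: Kinf_carrier)
lemma const_Kinf [simp]: "c \<in> carrier k \<Longrightarrow> const c \<in> carrier Kinf"
  using stage_incl(1) by (auto simp: Kinf_carrier)
lemma Kinf_Omega: "x \<in> carrier Kinf \<Longrightarrow> x \<in> carrier \<Omega>"
  using subfieldE(3)[OF Kinf_subfield] by blast

lemma Kinf_algebra: "algebra k Kinf"
proof (rule algebraI[OF k.cring_axioms Kinf.cring_axioms])
  fix a x assume "a \<in> carrier k" "x \<in> carrier Kinf"
  then show "a \<odot>\<^bsub>Kinf\<^esub> x \<in> carrier Kinf"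
    using Kinf.m_closed[of "const a" x] by simp
qed (auto simp: \<Omega>.l_distr \<Omega>.r_distr \<Omega>.m_assoc Kinf_Omega)

lemma Kinf_nat_pow: "x [^]\<^bsub>Kinf\<^esub> (n::nat) = x [^]\<^bsub>\<Omega>\<^esub> n"
  by (simp add: nat_pow_def)

lemma Kinf_eval: "ring.eval Kinf l x = ring.eval \<Omega> l x"
  by (induction l) (simp_all add: Kinf_nat_pow)

subsection \<open>Transcendence of the roots of t\<close>

text \<open>A polynomial of length \<open>n\<close> in the monomial of exponent \<open>q\<close> only has exponents below \<open>n q\<close>, so its leading term is
  not cancelled by the others.\<close>

lemma eval_monomial_apply:
  assumes "set l \<subseteq> carrier k" "0 < q"
  shows "x \<ge> of_nat (length l) * q \<Longrightarrow> ring.eval D (map (monomial k 0) l) (monomial k q \<one>) x = \<zero>"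
    and "ring.eval D (map (monomial k 0) l) (monomial k q \<one>) = \<zero>\<^bsub>D\<^esub> \<Longrightarrow> set l \<subseteq> {\<zero>}"
proof -
  have "(\<forall>x. x \<ge> of_nat (length l) * q \<longrightarrow> D.eval (map (monomial k 0) l) (monomial k q \<one>) x = \<zero>) \<and>
      (D.eval (map (monomial k 0) l) (monomial k q \<one>) = \<zero>\<^bsub>D\<^esub> \<longrightarrow> set l \<subseteq> {\<zero>})"
    using assms(1)
  proof (induction l)
    case Nil
    then show ?case by (simp add: M.zero_apply)
  next
    case (Cons a l)
    let ?n = "of_nat (length l) * q"
    let ?e = "D.eval (map (monomial k 0) l) (monomial k q \<one>)"
    have a: "a \<in> carrier k" and l: "set l \<subseteq> carrier k" using Cons.prems by auto
    have IH: "\<And>x. x \<ge> ?n \<Longrightarrow> ?e x = \<zero>" "?e = \<zero>\<^bsub>D\<^esub> \<Longrightarrow> set l \<subseteq> {\<zero>}" using Cons.IH l by auto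
    have eD: "?e \<in> carrier D"
      using l assms(2) by (intro D.eval_in_carrier) (auto intro!: mono_D)
    have "monomial k q \<one> [^]\<^bsub>D\<^esub> length l = monomial k ?n \<one>"
      using M.monomial_pow[of q "length l"] assms(2) by (simp add: rat_monoid_pow)
    then have e: "D.eval (map (monomial k 0) (a # l)) (monomial k q \<one>) = monomial k ?n a \<oplus>\<^bsub>D\<^esub> ?e"
      using M.mult_monomials[of 0 ?n a \<one>] a assms(2) by simp
    have val: "D.eval (map (monomial k 0) (a # l)) (monomial k q \<one>) x = (if x = ?n then a else \<zero>) \<oplus> ?e x" for x
      unfolding e M.add_apply M.monomial_apply ..
    show ?case
    proof (intro conjI allI impI)
      fix x :: rat assume x: "x \<ge> of_nat (length (a # l)) * q"
      then have "x \<noteq> ?n" "x \<ge> ?n" using assms(2) by (auto simp: algebra_simps)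
      then show "D.eval (map (monomial k 0) (a # l)) (monomial k q \<one>) x = \<zero>"
        unfolding val using IH(1) by simp
    next
      assume z: "D.eval (map (monomial k 0) (a # l)) (monomial k q \<one>) = \<zero>\<^bsub>D\<^esub>"
      then have "(if ?n = ?n then a else \<zero>) \<oplus> ?e ?n = \<zero>" using val[of ?n] M.zero_apply by metis
      then have a0: "a = \<zero>" using IH(1)[of ?n] a by simp
      have "\<zero>\<^bsub>D\<^esub> \<oplus>\<^bsub>D\<^esub> ?e = \<zero>\<^bsub>D\<^esub>" using z e a0 M.monomial_zero by metis
      then have "?e = \<zero>\<^bsub>D\<^esub>" using eD by (simp only: D.l_zero)
      then show "set (a # l) \<subseteq> {\<zero>}" using IH(2) a0 by simp
    qed
  qed
  then show "x \<ge> of_nat (length l) * q \<Longrightarrow> D.eval (map (monomial k 0) l) (monomial k q \<one>) x = \<zero>"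
    and "D.eval (map (monomial k 0) l) (monomial k q \<one>) = \<zero>\<^bsub>D\<^esub> \<Longrightarrow> set l \<subseteq> {\<zero>}" by auto
qed

lemma eval_t:
  assumes "set l \<subseteq> carrier k"
  shows "\<Omega>.eval (map const l) (t m) =
      fraction D (D.eval (map (monomial k 0) l) (monomial k (1 / of_nat p ^ m) \<one>)) \<one>\<^bsub>D\<^esub>"
proof -
  have "set (map (monomial k 0) l) \<subseteq> carrier D" using assms by (auto intro!: mono_D)
  then show ?thesis
    using em.eval_hom'[of "monomial k (1 / of_nat p ^ m) \<one>" "map (monomial k 0) l"] mono_D
    by (simp add: ambient_const_def[abs_def] t_root_def comp_def)
qed

lemma t_transcendental:
  assumes l: "set l \<subseteq> carrier k" and z: "\<Omega>.eval (map const l) (t m) = \<zero>\<^bsub>\<Omega>\<^esub>"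
  shows "set l \<subseteq> {\<zero>}"
proof (rule eval_monomial_apply(2)[OF l])
  show "0 < (1 / of_nat p ^ m :: rat)" using p_pos by simp
  have "set (map (monomial k 0) l) \<subseteq> carrier D" using l by (auto intro!: mono_D)
  then have "D.eval (map (monomial k 0) l) (monomial k (1 / of_nat p ^ m) \<one>) \<in> carrier D"
    by (intro D.eval_in_carrier mono_D) auto
  moreover have "fraction D (D.eval (map (monomial k 0) l) (monomial k (1 / of_nat p ^ m) \<one>)) \<one>\<^bsub>D\<^esub> = \<zero>\<^bsub>Qt D\<^esub>"
    using z unfolding eval_t[OF l] by (simp only: ambient_def)
  ultimately show "D.eval (map (monomial k 0) l) (monomial k (1 / of_nat p ^ m) \<one>) = \<zero>\<^bsub>D\<^esub>"
    using D.Qt_embed_eq_zero_iff by (simp only:)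
qed

lemma Kinf_fraction:
  assumes "b \<in> carrier Kinf"
  obtains m z where "z \<in> \<Omega>.simple_extension consts (t m)" "z \<noteq> \<zero>\<^bsub>\<Omega>\<^esub>"
    "b \<otimes>\<^bsub>\<Omega>\<^esub> z \<in> \<Omega>.simple_extension consts (t m)"
proof -
  obtain m where "b \<in> generate_field \<Omega> (consts \<union> {t m})" using assms by (auto simp: Kinf_carrier stage_def)
  then show thesis
    using \<Omega>.generate_field_simple_fraction[OF subfieldE(1)[OF consts_subfield] t_closed] that by blast
qed

lemma simple_extension_stage: "\<Omega>.simple_extension consts (t m) \<subseteq> stage m"
  using stage_incl by (intro \<Omega>.simple_extension_subring_incl subfieldE(1)[OF stage_subfield])

end

section \<open>The universal property of the perfect closure\<close>

text \<open>Coefficient lists over the source of \<open>h\<close> may have leading zeros and are mapped entrywise, without any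
  normalisation.\<close>

lemma (in ring) simple_extension_image_list:
  assumes h: "\<And>b. b \<in> B \<Longrightarrow> h b \<in> carrier R" and x: "x \<in> carrier R"
    and y: "y \<in> simple_extension (h ` B) x"
  shows "\<exists>l. set l \<subseteq> B \<and> y = eval (map h l) x"
  using y
proof induction
  case zero
  show ?case by (intro exI[of _ "[]"]) simp
next
  case (lin y c)
  then obtain l b where l: "set l \<subseteq> B" "y = eval (map h l) x" and b: "b \<in> B" "c = h b" by blast
  have "set (map h l) \<subseteq> carrier R" using l(1) h by auto
  then have "eval (map h (l @ [b])) x = y \<otimes> x \<oplus> c"
    using eval_append_aux[of "map h l" "h b" x] h[OF b(1)] x l(2) b(2) by simp
  then show ?case using l(1) b(1) by (intro exI[of _ "l @ [b]"]) simp
qed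

lemma (in ring) eval_in_subring:
  assumes S: "subring S R" and "set l \<subseteq> S" "x \<in> S" shows "eval l x \<in> S"
proof -
  interpret S: ring "R\<lparr>carrier := S\<rparr>" by (rule subring_is_ring[OF S])
  show ?thesis using S.eval_in_carrier[of l x] assms eval_consistent[OF S] by simp
qed

lemma (in cring) root_sequence_power:
  fixes m n p :: nat
  assumes s: "\<And>m. s m \<in> carrier R" "\<And>m. s (Suc m) [^] p = s m"
  shows "s (m + n) [^] (p ^ n) = s m"
proof (induction n)
  case (Suc n)
  have "s (m + Suc n) [^] (p ^ Suc n) = (s (Suc (m + n)) [^] p) [^] (p ^ n)"
    using s(1) by (simp add: nat_pow_pow)
  then show ?case using Suc s(2) by simp
qed (use s(1) in simp)

text \<open>The exponents of the monomials in the \<open>t\<^sub>m\<close>. A system of successive \<open>p\<close>-th roots can be raised to exactly these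
  exponents.\<close>

definition p_power_rat_monoid :: "nat \<Rightarrow> rat monoid" where
  "p_power_rat_monoid p = \<lparr>carrier = {of_nat i / of_nat p ^ m | i m. True}, monoid.mult = (+), one = 0\<rparr>"

context perfect_closure
begin

abbreviation "\<tau> m \<equiv> monomial k (1 / of_nat p ^ m) \<one>"

lemma \<tau>_closed [simp]: "\<tau> m \<in> carrier D" by (rule mono_D) auto

lemma common_denominator:
  "of_nat i / of_nat p ^ m + of_nat j / of_nat p ^ n =
    (of_nat (i * p ^ n + j * p ^ m) / of_nat p ^ (m + n) :: rat)"
  using p_pos by (simp add: field_simps power_add)

lemma p_power_rat_comm_monoid: "comm_monoid (p_power_rat_monoid p)"
proof (rule comm_monoidI)
  fix x y assume "x \<in> carrier (p_power_rat_monoid p)" "y \<in> carrier (p_power_rat_monoid p)"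
  then obtain i m j n where "x = of_nat i / of_nat p ^ m" "y = of_nat j / of_nat p ^ n"
    by (auto simp: p_power_rat_monoid_def)
  then have "x \<otimes>\<^bsub>p_power_rat_monoid p\<^esub> y = of_nat (i * p ^ n + j * p ^ m) / of_nat p ^ (m + n)"
    by (simp only: p_power_rat_monoid_def monoid.simps common_denominator)
  then show "x \<otimes>\<^bsub>p_power_rat_monoid p\<^esub> y \<in> carrier (p_power_rat_monoid p)"
    unfolding p_power_rat_monoid_def partial_object.simps by blast
next
  show "\<one>\<^bsub>p_power_rat_monoid p\<^esub> \<in> carrier (p_power_rat_monoid p)"
    by (auto simp: p_power_rat_monoid_def intro!: exI[of _ 0])
qed (auto simp: p_power_rat_monoid_def)

text \<open>The monoid algebra on the exponents \<open>i/p\<^sup>m\<close> is the union of the polynomial rings \<open>k[t\<^sub>m]\<close>: any two of its elements are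
  polynomials in a common \<open>t\<^sub>m\<close>.\<close>

lemma p_power_polys:
  defines "D0 \<equiv> carrier (monoid_algebra k (p_power_rat_monoid p))"
  shows "monoid_algebra k (p_power_rat_monoid p) = D\<lparr>carrier := D0\<rparr>"
    and "subring D0 D"
    and "c \<in> carrier k \<Longrightarrow> monomial k 0 c \<in> D0" "\<tau> m \<in> D0"
    and "f \<in> D0 \<Longrightarrow>
      \<exists>l m. set l \<subseteq> carrier k \<and> f = D.eval (map (monomial k 0) l) (\<tau> m)"
proof -
  show eq: "monoid_algebra k (p_power_rat_monoid p) = D\<lparr>carrier := D0\<rparr>"
    by (simp only: D0_def root_polys_def monoid_algebra_def p_power_rat_monoid_def nonneg_rat_monoid_def
        monoid.simps partial_object.simps partial_object.update_convs ring.simps)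
  interpret MP: monoid_algebra_setup k "p_power_rat_monoid p"
    by (intro monoid_algebra_setup.intro k.cring_axioms p_power_rat_comm_monoid)
  have sub: "D0 \<subseteq> carrier D"
  proof
    fix f assume "f \<in> D0"
    then have f: "f \<in> carrier MP.F" by (simp only: D0_def)
    have "carrier (p_power_rat_monoid p) \<subseteq> carrier nonneg_rat_monoid"
      by (auto simp: p_power_rat_monoid_def)
    then show "f \<in> carrier D" unfolding M.carrier_iff using MP.memD[OF f] by blast
  qed
  show sr: "subring D0 D"
    by (rule D.ring_incl_imp_subring[OF sub]) (use MP.F.ring_axioms eq in simp)
  have PM: "of_nat i / of_nat p ^ m \<in> carrier (p_power_rat_monoid p)" for i m
    by (auto simp: p_power_rat_monoid_def)
  show "monomial k 0 c \<in> D0" if "c \<in> carrier k"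
    unfolding D0_def using PM[of 0 0] that by (intro MP.monomial_closed) simp_all
  show tD0: "\<tau> m \<in> D0" for m
    unfolding D0_def using PM[of 1 m] by (intro MP.monomial_closed) simp_all
  let ?PC = "monomial k 0 ` carrier k"
  have PCr: "subring ?PC D" by (rule pconst.img_is_subring[OF k.carrier_is_subring])
  define E where "E m = D.simple_extension ?PC (\<tau> m)" for m
  have Er: "subring (E m) D" for m unfolding E_def by (rule D.simple_extension_is_subring[OF PCr \<tau>_closed])
  have PCE: "?PC \<subseteq> E m" for m
    unfolding E_def by (rule D.simple_extension_incl[OF subringE(1)[OF PCr] \<tau>_closed])
  have \<tau>E: "\<tau> m \<in> E m" for m unfolding E_def by (rule D.simple_extension_mem[OF PCr \<tau>_closed])
  have \<tau>_pow: "\<tau> m [^]\<^bsub>D\<^esub> i = monomial k (of_nat i / of_nat p ^ m) \<one>" for m i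
    using M.monomial_pow[of "1 / of_nat p ^ m" i] by (simp add: rat_monoid_pow)
  have powE: "x [^]\<^bsub>D\<^esub> i \<in> E m" if "x \<in> E m" for x m and i :: nat
    using subringE(3,6)[OF Er[of m]] that by (induction i) auto
  have E_mono: "E m \<subseteq> E (m + n)" for m n
  proof -
    have "\<tau> (m + n) [^]\<^bsub>D\<^esub> (p ^ n) = \<tau> m" unfolding \<tau>_pow using p_pos by (simp add: power_add)
    then have "\<tau> m \<in> E (m + n)" using powE[OF \<tau>E] by metis
    then show ?thesis unfolding E_def[of m] by (rule D.simple_extension_subring_incl[OF Er PCE])
  qed
  show "\<exists>l m. set l \<subseteq> carrier k \<and> f = D.eval (map (monomial k 0) l) (\<tau> m)" if "f \<in> D0" for f
  proof -
    have "\<exists>m. f \<in> E m" using that unfolding D0_def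
    proof (induction f rule: MP.induct)
      case zero
      have "\<zero>\<^bsub>MP.F\<^esub> = \<zero>\<^bsub>D\<^esub>" unfolding eq by simp
      then show ?case using subringE(2)[OF Er[of 0]] by auto
    next
      case (monomial q c)
      then obtain i m where q: "q = of_nat i / of_nat p ^ m" by (auto simp: p_power_rat_monoid_def)
      have "monomial k q c = monomial k 0 c \<otimes>\<^bsub>D\<^esub> \<tau> m [^]\<^bsub>D\<^esub> i"
        unfolding \<tau>_pow q using M.mult_monomials[of 0 "of_nat i / of_nat p ^ m" c \<one>] monomial by simp
      then show ?case using subringE(6)[OF Er _ powE[OF \<tau>E]] PCE monomial(2) by (metis imageI subsetD)
    next
      case (add f g)
      then obtain m n where "f \<in> E m" "g \<in> E n" by auto
      then have "f \<in> E (m + n)" "g \<in> E (m + n)"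
        using E_mono[of m n] E_mono[of n m] by (auto simp: add.commute)
      then have "f \<oplus>\<^bsub>D\<^esub> g \<in> E (m + n)" using subringE(7)[OF Er] by blast
      moreover have "f \<oplus>\<^bsub>MP.F\<^esub> g = f \<oplus>\<^bsub>D\<^esub> g" unfolding eq by simp
      ultimately show ?case by auto
    qed
    then obtain m where "f \<in> E m" ..
    then have "\<exists>l. set l \<subseteq> carrier k \<and> f = D.eval (map (monomial k 0) l) (\<tau> m)"
      unfolding E_def by (intro D.simple_extension_image_list) (simp_all add: mono_D)
    then show ?thesis by blast
  qed
qed

text \<open>The assignment \<open>i/p\<^sup>m \<mapsto> \<sigma>\<^sub>m\<^sup>i\<close> is well defined and additive in the exponent, so it extends to the union of the
  \<open>k[t\<^sub>m]\<close>. Nonzero elements of that ring are sent to units by assumption, so the map extends to its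
  fractions, which include all of \<open>k\<^sub>\<infinity>\<close>.\<close>

theorem Kinf_universal:
  assumes S: "cring S" and \<alpha>: "\<alpha> \<in> ring_hom k S"
    and \<sigma>: "\<And>m. \<sigma> m \<in> carrier S" "\<And>m. \<sigma> (Suc m) [^]\<^bsub>S\<^esub> p = \<sigma> m"
    and unit: "\<And>l m. set l \<subseteq> carrier k \<Longrightarrow> \<not> set l \<subseteq> {\<zero>} \<Longrightarrow> ring.eval S (map \<alpha> l) (\<sigma> m) \<in> Units S"
  shows "\<exists>\<psi>\<in>ring_hom Kinf S. (\<forall>c\<in>carrier k. \<psi> (const c) = \<alpha> c) \<and> (\<forall>m. \<psi> (t m) = \<sigma> m)"
proof -
  interpret S: cring S by fact
  interpret \<alpha>: ring_hom_ring k S \<alpha> by (intro ring_hom_ringI2 k.ring_axioms S.ring_axioms \<alpha>)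
  define M' where "M' = p_power_rat_monoid p"
  define D0 where "D0 = carrier (monoid_algebra k M')"
  note pp = p_power_polys[folded M'_def, folded D0_def]
  interpret MP: monoid_algebra_setup k M'
    unfolding M'_def by (intro monoid_algebra_setup.intro k.cring_axioms p_power_rat_comm_monoid)
  have wd: "\<sigma> m [^]\<^bsub>S\<^esub> i = \<sigma> n [^]\<^bsub>S\<^esub> j"
    if eq: "(of_nat i / of_nat p ^ m :: rat) = of_nat j / of_nat p ^ n" for i j m n :: nat
  proof -
    have "(of_nat (i * p ^ n) :: rat) = of_nat (j * p ^ m)" using eq p_pos by (simp add: field_simps)
    then have ij: "i * p ^ n = j * p ^ m" by (simp only: of_nat_eq_iff)
    have "\<sigma> m [^]\<^bsub>S\<^esub> i = \<sigma> (m + n) [^]\<^bsub>S\<^esub> (p ^ n * i)"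
      using S.root_sequence_power[of \<sigma> p m n, OF \<sigma>] \<sigma>(1) S.nat_pow_pow by metis
    also have "\<dots> = \<sigma> (n + m) [^]\<^bsub>S\<^esub> (p ^ m * j)" using ij by (simp add: ac_simps)
    also have "\<dots> = \<sigma> n [^]\<^bsub>S\<^esub> j"
      using S.root_sequence_power[of \<sigma> p n m, OF \<sigma>] \<sigma>(1) S.nat_pow_pow by metis
    finally show ?thesis .
  qed
  define \<chi> where "\<chi> q = (SOME w. \<exists>i m. q = of_nat i / of_nat p ^ m \<and> w = \<sigma> m [^]\<^bsub>S\<^esub> i)" for q :: rat
  have \<chi>: "\<chi> (of_nat i / of_nat p ^ m) = \<sigma> m [^]\<^bsub>S\<^esub> i" for i m
  proof -
    have "\<exists>j n. of_nat i / of_nat p ^ m = (of_nat j / of_nat p ^ n :: rat) \<and> \<chi> (of_nat i / of_nat p ^ m) = \<sigma> n [^]\<^bsub>S\<^esub> j"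
      unfolding \<chi>_def by (rule someI_ex) blast
    then show ?thesis using wd by metis
  qed
  have M'c: "\<exists>i m. q = of_nat i / of_nat p ^ m" if "q \<in> carrier M'" for q
    using that by (auto simp: M'_def p_power_rat_monoid_def)
  have \<chi>c: "\<chi> q \<in> carrier S" if "q \<in> carrier M'" for q
    using M'c[OF that] \<sigma>(1) by (auto simp: \<chi>)
  have M'_simps: "\<one>\<^bsub>M'\<^esub> = 0" "x \<otimes>\<^bsub>M'\<^esub> y = x + y" for x y
    by (simp_all add: M'_def p_power_rat_monoid_def)
  define \<Lambda> where "\<Lambda> = evaluation k S \<alpha> \<chi>"
  have "\<Lambda> \<in> ring_hom MP.F S"
    unfolding \<Lambda>_def
  proof (rule MP.evaluation_hom[OF S \<alpha> \<chi>c])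
    show "\<chi> \<one>\<^bsub>M'\<^esub> = \<one>\<^bsub>S\<^esub>" using \<chi>[of 0 0] by (simp add: M'_simps)
    fix x y assume "x \<in> carrier M'" "y \<in> carrier M'"
    then obtain i m j n where xy: "x = of_nat i / of_nat p ^ m" "y = of_nat j / of_nat p ^ n" using M'c by metis
    have "\<chi> (x + y) = \<sigma> (m + n) [^]\<^bsub>S\<^esub> (i * p ^ n + j * p ^ m)"
      unfolding xy common_denominator by (rule \<chi>)
    also have "\<dots> = (\<sigma> (m + n) [^]\<^bsub>S\<^esub> (p ^ n)) [^]\<^bsub>S\<^esub> i \<otimes>\<^bsub>S\<^esub> (\<sigma> (n + m) [^]\<^bsub>S\<^esub> (p ^ m)) [^]\<^bsub>S\<^esub> j"
      using \<sigma>(1) by (simp add: S.nat_pow_mult S.nat_pow_pow ac_simps)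
    also have "\<dots> = \<chi> x \<otimes>\<^bsub>S\<^esub> \<chi> y"
      unfolding S.root_sequence_power[of \<sigma> p, OF \<sigma>] xy \<chi> ..
    finally show "\<chi> (x \<otimes>\<^bsub>M'\<^esub> y) = \<chi> x \<otimes>\<^bsub>S\<^esub> \<chi> y" by (simp add: M'_simps)
  qed
  then have \<Lambda>: "\<Lambda> \<in> ring_hom (D\<lparr>carrier := D0\<rparr>) S" unfolding pp(1) .
  have \<Lambda>_mono: "\<Lambda> (monomial k q c) = \<alpha> c \<otimes>\<^bsub>S\<^esub> \<chi> q" if "q \<in> carrier M'" "c \<in> carrier k" for q c
    unfolding \<Lambda>_def by (rule MP.evaluation_monomial[OF S \<alpha> \<chi>c that])
  have M'm: "of_nat i / of_nat p ^ m \<in> carrier M'" for i m by (auto simp: M'_def p_power_rat_monoid_def)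
  have \<Lambda>_const: "\<Lambda> (monomial k 0 c) = \<alpha> c" if "c \<in> carrier k" for c
    using \<Lambda>_mono[OF M'm[of 0 0]] \<chi>[of 0 0] that by simp
  have \<Lambda>_\<tau>: "\<Lambda> (\<tau> m) = \<sigma> m" for m
    using \<Lambda>_mono[OF M'm[of 1 m], of \<one>] \<chi>[of 1 m] \<sigma>(1) by simp
  interpret D0: ring "D\<lparr>carrier := D0\<rparr>" by (rule D.subring_is_ring[OF pp(2)])
  interpret \<Lambda>: ring_hom_ring "D\<lparr>carrier := D0\<rparr>" S \<Lambda>
    by (intro ring_hom_ringI2 D0.ring_axioms S.ring_axioms \<Lambda>)
  have unit': "\<Lambda> f \<in> Units S" if f: "f \<in> D0 - {\<zero>\<^bsub>D\<^esub>}" for f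
  proof -
    obtain l m where l: "set l \<subseteq> carrier k" "f = D.eval (map (monomial k 0) l) (\<tau> m)"
      using pp(5) f by blast
    have "set (map (monomial k 0) l) \<subseteq> D0" using l(1) pp(3) by auto
    then have "\<Lambda> f = S.eval (map \<Lambda> (map (monomial k 0) l)) (\<sigma> m)"
      using \<Lambda>.eval_hom'[of "\<tau> m" "map (monomial k 0) l"] pp(4)[of m] l(2) D.eval_consistent[OF pp(2)] \<Lambda>_\<tau> by simp
    also have "map \<Lambda> (map (monomial k 0) l) = map \<alpha> l" using l(1) \<Lambda>_const by auto
    finally have "\<Lambda> f = S.eval (map \<alpha> l) (\<sigma> m)" .
    moreover have "\<not> set l \<subseteq> {\<zero>}"
    proof
      assume z: "set l \<subseteq> {\<zero>}"
      have "D.eval (map (monomial k 0) l) (\<tau> m) = \<zero>\<^bsub>D\<^esub>" using z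
        by (induction l) (simp_all add: M.monomial_zero)
      then show False using f l(2) by simp
    qed
    ultimately show ?thesis using unit[OF l(1)] by simp
  qed
  define \<psi> where "\<psi> = fraction_lift D D0 S \<Lambda>"
  have lift_eq: "\<psi> (fraction D f g) = \<Lambda> f \<otimes>\<^bsub>S\<^esub> inv\<^bsub>S\<^esub> (\<Lambda> g)"
    if "f \<in> D0" "g \<in> D0 - {\<zero>\<^bsub>D\<^esub>}" for f g
    unfolding \<psi>_def by (rule D.fraction_lift_eq[OF pp(2) S \<Lambda> unit' that])
  have lift_hom: "\<psi> \<in> ring_hom ((Qt D)\<lparr>carrier := fractions_over D D0\<rparr>) S"
    unfolding \<psi>_def by (rule D.fraction_lift_hom[OF pp(2) S \<Lambda> unit'])
  have D0D: "f \<in> carrier D" if "f \<in> D0" for f using subringE(1)[OF pp(2)] that by blast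
  have eval_D0: "\<exists>f\<in>D0. y = fraction D f \<one>\<^bsub>D\<^esub>" if y: "y \<in> \<Omega>.simple_extension consts (t m)" for y m
  proof -
    obtain l where l: "set l \<subseteq> carrier k" "y = \<Omega>.eval (map const l) (t m)"
      using \<Omega>.simple_extension_image_list[OF _ t_closed y] const.hom_closed by blast
    have "D.eval (map (monomial k 0) l) (\<tau> m) \<in> D0"
      using l(1) pp(3,4) by (intro D.eval_in_subring[OF pp(2)]) auto
    then show ?thesis using eval_t[OF l(1), of m] l(2) by blast
  qed
  have Kinf_sub: "b \<in> fractions_over D D0" if b: "b \<in> carrier Kinf" for b
  proof -
    obtain m z where z: "z \<in> \<Omega>.simple_extension consts (t m)" "z \<noteq> \<zero>\<^bsub>\<Omega>\<^esub>"
      "b \<otimes>\<^bsub>\<Omega>\<^esub> z \<in> \<Omega>.simple_extension consts (t m)" using Kinf_fraction[OF b] .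
    obtain g where g: "g \<in> D0" "z = fraction D g \<one>\<^bsub>D\<^esub>" using eval_D0[OF z(1)] by blast
    obtain f where f: "f \<in> D0" "b \<otimes>\<^bsub>\<Omega>\<^esub> z = fraction D f \<one>\<^bsub>D\<^esub>" using eval_D0[OF z(3)] by blast
    have "b \<in> carrier (Qt D)" using Kinf_Omega[OF b] by (simp add: ambient_eq)
    then obtain u v where uv: "u \<in> carrier D" "v \<in> carrier D - {\<zero>\<^bsub>D\<^esub>}" "b = fraction D u v"
      by (rule D.Qt_cases)
    have gne: "g \<noteq> \<zero>\<^bsub>D\<^esub>" using z(2) unfolding g(2) ambient_eq D.Qt_zero by metis
    have fg: "f \<in> carrier D" "g \<in> carrier D" using f(1) g(1) D0D by auto
    have "fraction D (u \<otimes>\<^bsub>D\<^esub> g) v = fraction D f \<one>\<^bsub>D\<^esub>"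
      using f(2) D.fraction_mult[OF uv(1,2), of g "\<one>\<^bsub>D\<^esub>"] fg uv unfolding g(2) uv(3) ambient_eq by simp
    then have "u \<otimes>\<^bsub>D\<^esub> g = f \<otimes>\<^bsub>D\<^esub> v"
      using D.fraction_eq_iff[of "u \<otimes>\<^bsub>D\<^esub> g" v f "\<one>\<^bsub>D\<^esub>"] fg uv by simp
    then have "b = fraction D f g"
      unfolding uv(3) using D.fraction_eq_iff[of u v f g] fg uv gne by simp
    then show ?thesis unfolding fractions_over_def using f(1) g(1) gne by blast
  qed
  have one0: "\<one>\<^bsub>D\<^esub> \<in> D0 - {\<zero>\<^bsub>D\<^esub>}" using subringE(3)[OF pp(2)] by simp
  show ?thesis
  proof (intro bexI[of _ \<psi>] conjI ballI allI)
    show "\<psi> \<in> ring_hom Kinf S"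
    proof (rule ring_hom_memI)
      fix x y assume xy: "x \<in> carrier Kinf" "y \<in> carrier Kinf"
      have "x \<in> fractions_over D D0" "y \<in> fractions_over D D0" using Kinf_sub xy by auto
      then show "\<psi> x \<in> carrier S" "\<psi> (x \<otimes>\<^bsub>Kinf\<^esub> y) = \<psi> x \<otimes>\<^bsub>S\<^esub> \<psi> y" "\<psi> (x \<oplus>\<^bsub>Kinf\<^esub> y) = \<psi> x \<oplus>\<^bsub>S\<^esub> \<psi> y"
        using ring_hom_closed[OF lift_hom, of x] ring_hom_mult[OF lift_hom, of x y]
          ring_hom_add[OF lift_hom, of x y] by (simp_all add: ambient_eq)
    next
      show "\<psi> \<one>\<^bsub>Kinf\<^esub> = \<one>\<^bsub>S\<^esub>" using ring_hom_one[OF lift_hom] by (simp add: ambient_eq)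
    qed
    have \<Lambda>1: "\<Lambda> \<one>\<^bsub>D\<^esub> = \<one>\<^bsub>S\<^esub>" using \<Lambda>.hom_one by simp
    show "\<psi> (const c) = \<alpha> c" if c: "c \<in> carrier k" for c
      using lift_eq[OF pp(3)[OF c] one0] \<Lambda>_const[OF c] c by (simp add: ambient_const_def \<Lambda>1)
    show "\<psi> (t m) = \<sigma> m" for m
      using lift_eq[OF pp(4) one0, of m] \<Lambda>_\<tau> \<sigma>(1) by (simp add: t_root_def \<Lambda>1)
  qed
qed

end

section \<open>Descent of noetherianity from A_infinity to A\<close>

locale extended_algebra = perfect_closure p k + A: algebra k A
  for p :: nat and k :: "('k, 'c) ring_scheme" (structure) and A :: "('k, 'a, 'd) module_scheme"
begin

sublocale tensor k A "k_infty p k"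
  by (intro tensor.intro A.algebra_axioms Kinf_algebra)

lemma A_infty_eq: "A_infty p k A = T"
  by (simp add: A_infty_def)

sublocale inl: ring_hom_ring A "algebra_tensor_product k A (k_infty p k)" inl
  by (intro ring_hom_ringI2 A_ring T.ring_axioms inl_hom)

sublocale inr: ring_hom_ring "k_infty p k" "algebra_tensor_product k A (k_infty p k)" inr
  by (intro ring_hom_ringI2 B_ring T.ring_axioms inr_hom)

text \<open>Let \<open>\<rho> : T \<rightarrow> A\<close> be an \<open>A\<close>-linear retraction. For an ideal \<open>I\<close> of \<open>A\<close>, the elements all of whose multiples are
  mapped into \<open>I\<close> by \<open>\<rho>\<close> form an ideal \<open>E I\<close> of \<open>T\<close> that contracts to \<open>I\<close>. So \<open>E\<close> transports chains of ideals of \<open>A\<close>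
  to chains in \<open>T\<close> without collapsing them.\<close>

theorem noetherian_descends:
  assumes "noetherian_ring T" shows "noetherian_ring A"
proof -
  interpret TN: noetherian_ring T by fact
  have ne: "\<one>\<^bsub>Kinf\<^esub> \<noteq> \<zero>\<^bsub>Kinf\<^esub>" by simp
  obtain l where l: "\<And>b. b \<in> carrier Kinf \<Longrightarrow> l b \<in> carrier k" "l \<one>\<^bsub>Kinf\<^esub> = \<one>"
    "\<And>b b'. b \<in> carrier Kinf \<Longrightarrow> b' \<in> carrier Kinf \<Longrightarrow> l (b \<oplus>\<^bsub>Kinf\<^esub> b') = l b \<oplus> l b'"
    "\<And>c b. c \<in> carrier k \<Longrightarrow> b \<in> carrier Kinf \<Longrightarrow> l (c \<odot>\<^bsub>Kinf\<^esub> b) = c \<otimes> l b"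
    using algebra.linear_functional_exists[OF Kinf_algebra k.field_axioms ne] by blast
  obtain \<rho> where \<rho>: "\<And>y. y \<in> carrier T \<Longrightarrow> \<rho> y \<in> carrier A"
    "\<And>x y. x \<in> carrier T \<Longrightarrow> y \<in> carrier T \<Longrightarrow> \<rho> (x \<oplus>\<^bsub>T\<^esub> y) = \<rho> x \<oplus>\<^bsub>A\<^esub> \<rho> y"
    "\<And>a y. a \<in> carrier A \<Longrightarrow> y \<in> carrier T \<Longrightarrow> \<rho> (inl a \<otimes>\<^bsub>T\<^esub> y) = a \<otimes>\<^bsub>A\<^esub> \<rho> y"
    "\<rho> \<one>\<^bsub>T\<^esub> = \<one>\<^bsub>A\<^esub>"
    using tensor_retraction[of l, OF l] by blast
  define E where "E I = {y \<in> carrier T. \<forall>z\<in>carrier T. \<rho> (z \<otimes>\<^bsub>T\<^esub> y) \<in> I}" for I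
  have E_ideal: "ideal (E I) T" if "ideal I A" for I
  proof (rule idealI[OF T.ring_axioms])
    interpret I: ideal I A by fact
    show "subgroup (E I) (add_monoid T)"
    proof (rule T.add.subgroupI)
      show "E I \<subseteq> carrier T" by (auto simp: E_def)
      have "\<rho> \<zero>\<^bsub>T\<^esub> = \<zero>\<^bsub>A\<^esub>" using \<rho>(3)[of "\<zero>\<^bsub>A\<^esub>" "\<one>\<^bsub>T\<^esub>"] \<rho>(4) by simp
      then have "\<zero>\<^bsub>T\<^esub> \<in> E I" by (simp add: E_def)
      then show "E I \<noteq> {}" by blast
      fix y assume y: "y \<in> E I"
      then have yT: "y \<in> carrier T" by (simp add: E_def)
      have "\<rho> (z \<otimes>\<^bsub>T\<^esub> (\<ominus>\<^bsub>T\<^esub> y)) \<in> I" if z: "z \<in> carrier T" for z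
      proof -
        have "z \<otimes>\<^bsub>T\<^esub> (\<ominus>\<^bsub>T\<^esub> y) = (\<ominus>\<^bsub>T\<^esub> z) \<otimes>\<^bsub>T\<^esub> y" using z yT by (simp add: T.l_minus T.r_minus)
        then show ?thesis using y z by (simp add: E_def)
      qed
      then show "\<ominus>\<^bsub>T\<^esub> y \<in> E I" using yT by (simp add: E_def)
      fix x assume x: "x \<in> E I"
      then show "y \<oplus>\<^bsub>T\<^esub> x \<in> E I"
        using y by (simp add: E_def T.r_distr \<rho>(2) I.a_closed)
    qed
    fix y x assume y: "y \<in> E I" and x: "x \<in> carrier T"
    then have yT: "y \<in> carrier T" by (simp add: E_def)
    show *: "x \<otimes>\<^bsub>T\<^esub> y \<in> E I" using y x by (simp add: E_def T.m_assoc[symmetric])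
    show "y \<otimes>\<^bsub>T\<^esub> x \<in> E I" using * T.m_comm[OF x yT] by simp
  qed
  have E_mem: "inl a \<in> E I \<longleftrightarrow> a \<in> I" if I: "ideal I A" and a: "a \<in> carrier A" for I a
  proof
    assume "inl a \<in> E I"
    then have "\<rho> (\<one>\<^bsub>T\<^esub> \<otimes>\<^bsub>T\<^esub> inl a) \<in> I" unfolding E_def using T.one_closed by blast
    then have "\<rho> (inl a \<otimes>\<^bsub>T\<^esub> \<one>\<^bsub>T\<^esub>) \<in> I" using a by simp
    then show "a \<in> I" using \<rho>(3)[OF a T.one_closed] \<rho>(4) a by simp
  next
    assume "a \<in> I"
    then have "\<rho> (z \<otimes>\<^bsub>T\<^esub> inl a) \<in> I" if z: "z \<in> carrier T" for z
      using \<rho>(3)[OF a z] \<rho>(1)[OF z] ideal.I_r_closed[OF I, of a "\<rho> z"] T.m_comm[OF z, of "inl a"] a by simp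
    then show "inl a \<in> E I" using a by (simp add: E_def)
  qed
  show ?thesis
  proof (rule ring.trivial_ideal_chain_imp_noetherian[OF A_ring])
    fix C assume C: "C \<noteq> {}" "subset.chain {I. ideal I A} C"
    have CI: "\<And>I. I \<in> C \<Longrightarrow> ideal I A" using C(2) by (auto simp: subset_chain_def)
    have "subset.chain {I. ideal I T} (E ` C)"
      unfolding subset_chain_def
    proof (intro conjI ballI)
      show "E ` C \<subseteq> {I. ideal I T}" using CI E_ideal by blast
      fix X' Y' assume "X' \<in> E ` C" "Y' \<in> E ` C"
      then obtain I J where IJ: "I \<in> C" "J \<in> C" "X' = E I" "Y' = E J" by blast
      then have "I \<subseteq> J \<or> J \<subseteq> I" using C(2) unfolding subset_chain_def by blast
      then show "X' \<subseteq> Y' \<or> Y' \<subseteq> X'" unfolding IJ(3,4) E_def by blast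
    qed
    then have "\<Union> (E ` C) \<in> E ` C" using TN.ideal_chain_is_trivial[of "E ` C"] C(1) by blast
    then obtain J where J: "J \<in> C" "\<Union> (E ` C) = E J" by blast
    have "\<Union>C = J"
    proof
      show "\<Union>C \<subseteq> J"
      proof
        fix a assume "a \<in> \<Union>C"
        then obtain I where I: "I \<in> C" "a \<in> I" by blast
        have aA: "a \<in> carrier A" using ideal.Icarr[OF CI[OF I(1)] I(2)] .
        have "inl a \<in> E I" using E_mem[OF CI[OF I(1)] aA] I(2) by simp
        then have "inl a \<in> E J" using J(2) I(1) by blast
        then show "a \<in> J" using E_mem[OF CI[OF J(1)] aA] by simp
      qed
    qed (use J(1) in blast)
    then show "\<Union>C \<in> C" using J(1) by simp
  qed
qed

context
  fixes P assumes P: "primeideal P A"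
begin

lemma APd: "domain (A Quot P)" by (rule primeideal.quotient_is_domain[OF P])

definition "resA a = fraction (A Quot P) (P +>\<^bsub>A\<^esub> a) \<one>\<^bsub>A Quot P\<^esub>"

lemma resA_hom: "resA \<in> ring_hom A (Qt (A Quot P))"
proof -
  have "(+>\<^bsub>A\<^esub>) P \<in> ring_hom A (A Quot P)"
    using ideal.rcos_ring_hom[OF primeideal.axioms(1)[OF P]] .
  from ring_hom_trans[OF this domain.Qt_embed_hom[OF APd]]
  show ?thesis unfolding resA_def[abs_def] comp_def .
qed

lemma residue_map_eq: "residue_map A P c = resA (c \<odot>\<^bsub>A\<^esub> \<one>\<^bsub>A\<^esub>)"
  by (simp add: residue_map_def resA_def)

lemma structure_hom: "(\<lambda>c. c \<odot>\<^bsub>A\<^esub> \<one>\<^bsub>A\<^esub>) \<in> ring_hom k A"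
  by (rule ring_hom_memI) (simp_all add: A.smult_l_distr A.smult_assoc1 A.smult_assoc2)

lemma residue_map_hom: "residue_map A P \<in> ring_hom k (Qt (A Quot P))"
  using ring_hom_trans[OF structure_hom resA_hom] unfolding residue_map_eq[abs_def] comp_def .

lemma residue_field_cases:
  assumes "x \<in> carrier (Qt (A Quot P))"
  obtains a b where "a \<in> carrier A" "b \<in> carrier A" "x \<otimes>\<^bsub>Qt (A Quot P)\<^esub> resA b = resA a"
    "resA b \<noteq> \<zero>\<^bsub>Qt (A Quot P)\<^esub>"
proof -
  interpret AP: domain "A Quot P" by (rule APd)
  obtain u v where uv: "u \<in> carrier (A Quot P)" "v \<in> carrier (A Quot P) - {\<zero>\<^bsub>A Quot P\<^esub>}"
      "x = fraction (A Quot P) u v"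
    using AP.Qt_cases[OF assms] .
  obtain a where a: "a \<in> carrier A" "u = P +>\<^bsub>A\<^esub> a" using uv(1) by (auto simp: FactRing_def A_RCOSETS_def')
  obtain b where b: "b \<in> carrier A" "v = P +>\<^bsub>A\<^esub> b" using uv(2) by (auto simp: FactRing_def A_RCOSETS_def')
  have e: "x \<otimes>\<^bsub>Qt (A Quot P)\<^esub> resA b = resA a"
    unfolding uv(3) resA_def a(2)[symmetric] b(2)[symmetric]
    by (rule AP.fraction_mult_denominator[OF uv(1,2)])
  have ne: "resA b \<noteq> \<zero>\<^bsub>Qt (A Quot P)\<^esub>"
    unfolding resA_def b(2)[symmetric] using uv(2) AP.Qt_embed_eq_zero_iff by blast
  show thesis by (rule that[OF a(1) b(1) e ne])
qed

end

end

section \<open>Residue fields when A_infinity is noetherian\<close>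

lemma normalize_Nil_imp:
  assumes "ring R" "ring.normalize R l = []" shows "set l \<subseteq> {\<zero>\<^bsub>R\<^esub>}"
proof -
  interpret ring R by fact
  show ?thesis using assms(2) by (induction l) (auto split: if_splits)
qed

text \<open>Here the coefficient list may have leading zeros, which \<open>K[X]\<close> does not permit.\<close>

lemma (in ring) transcendental_eval_zero:
  assumes tr: "(transcendental over K) x" and K: "K \<subseteq> carrier R" and x: "x \<in> carrier R"
    and l: "set l \<subseteq> K" and zero: "eval l x = \<zero>"
  shows "set l \<subseteq> {\<zero>}"
proof (rule normalize_Nil_imp[OF ring_axioms])
  have "normalize l \<in> carrier (K[X])"
    using normalize_gives_polynomial[OF l] by (simp add: univ_poly_carrier)
  moreover have "eval (normalize l) x = \<zero>" using eval_normalize[of l x] l K x zero by auto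
  ultimately show "normalize l = []" by (rule eval_transcendental[OF tr])
qed

context extended_algebra
begin

text \<open>Suppose that \<open>x\<close> is transcendental over \<open>k\<close>. The homomorphism \<open>\<Psi>\<close> that moves \<open>t\<^sub>m\<close> away from the root \<open>x\<^sub>m\<close> by \<open>e\<^sup>r\<close>, \<open>r = 1/p\<^sup>m\<close>, detects how closely \<open>x\<^sub>m\<close>
  is approximated: \<open>b t\<^sub>m - a\<close> with \<open>a/b = x\<^sub>m\<close> has order exactly \<open>1/p\<^sup>m\<close>. So the ideals of elements of
  order at least \<open>1/p\<^sup>m\<close> never become stationary.\<close>

theorem sharp_algebraic_of_noetherian:
  assumes noeth: "noetherian_ring T" and P: "primeideal P A"
    and x: "x \<in> sharp p (Qt (A Quot P))"
  shows "(ring.algebraic (Qt (A Quot P)) over (residue_map A P ` carrier k)) x"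
proof (rule ccontr)
  define K where "K = Qt (A Quot P)"
  define res where "res = residue_map A P"
  define q where "q = resA P"
  have K_field: "field K" unfolding K_def by (rule domain.Qt_field[OF APd[OF P]])
  interpret K: field K by (rule K_field)
  interpret res: ring_hom_ring k K res
    unfolding K_def res_def
    by (intro ring_hom_ringI2 k.ring_axioms K.ring_axioms[unfolded K_def] residue_map_hom[OF P])
  interpret q: ring_hom_ring A K q
    unfolding K_def q_def by (intro ring_hom_ringI2 A_ring K.ring_axioms[unfolded K_def] resA_hom[OF P])
  have res_q: "res c = q (c \<odot>\<^bsub>A\<^esub> \<one>\<^bsub>A\<^esub>)" for c unfolding res_def q_def by (rule residue_map_eq[OF P])
  assume "\<not> (ring.algebraic (Qt (A Quot P)) over (residue_map A P ` carrier k)) x"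
  then have tr: "(K.transcendental over (res ` carrier k)) x"
    unfolding K_def[symmetric] res_def[symmetric] over_def by simp
  have charK: "add_pow K p \<one>\<^bsub>K\<^esub> = \<zero>\<^bsub>K\<^esub>" using res.hom_add_pow[of \<one> p] p_zero by simp
  have k'_sub: "subfield (res ` carrier k) K" by (rule res.img_is_subfield(2)[OF k.carrier_is_subfield]) simp
  have k'_carrier: "res ` carrier k \<subseteq> carrier K" by auto
  have "\<forall>m. \<exists>b. b \<in> carrier K \<and> x = b [^]\<^bsub>K\<^esub> (p ^ m)"
    using x unfolding sharp_def K_def[symmetric] by auto
  then obtain xs where xs: "\<And>m. xs m \<in> carrier K" "\<And>m. x = xs m [^]\<^bsub>K\<^esub> (p ^ m)" by metis
  have xs_step: "xs (Suc m) [^]\<^bsub>K\<^esub> p = xs m" for m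
  proof (rule K.frobenius_inj[OF p_prime charK])
    show "(xs (Suc m) [^]\<^bsub>K\<^esub> p) [^]\<^bsub>K\<^esub> (p ^ m) = xs m [^]\<^bsub>K\<^esub> (p ^ m)"
      using xs(1) xs(2)[of m] xs(2)[of "Suc m"] by (simp add: K.nat_pow_pow)
  qed (use xs in simp_all)
  have xs_tr: "(K.transcendental over (res ` carrier k)) (xs m)" for m
  proof (rule ccontr)
    assume "\<not> (K.transcendental over (res ` carrier k)) (xs m)"
    then have alg: "xs m \<in> {y \<in> carrier K. (K.algebraic over (res ` carrier k)) y}"
      using xs(1) unfolding over_def by simp
    note sub = subringE[OF subfieldE(1)[OF K.subfield_of_algebraics[OF k'_sub]]]
    have "xs m [^]\<^bsub>K\<^esub> n \<in> {y \<in> carrier K. (K.algebraic over (res ` carrier k)) y}" for n :: nat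
    proof (induction n)
      case 0
      show ?case using sub(3) by (simp only: K.nat_pow_0)
    next
      case (Suc n)
      then show ?case using sub(6) alg by (simp only: K.nat_pow_Suc)
    qed
    then have "(K.algebraic over (res ` carrier k)) x" using xs(2)[of m] by (metis (mono_tags, lifting) mem_Collect_eq)
    then show False using tr unfolding over_def by simp
  qed
  interpret C: root_poly_domain K by unfold_locales
  define emb where "emb f = fraction C.D f \<one>\<^bsub>C.D\<^esub>" for f
  interpret emb: ring_hom_ring C.D "Qt C.D" emb
    using C.embed.ring_hom_ring_axioms unfolding emb_def[abs_def] .
  have charC: "add_pow C.D p \<one>\<^bsub>C.D\<^esub> = \<zero>\<^bsub>C.D\<^esub>" using C.pconst.hom_add_pow[of "\<one>\<^bsub>K\<^esub>" p] charK by simp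
  define \<epsilon> where "\<epsilon> m = monomial K (1 / of_nat p ^ m :: rat) \<one>\<^bsub>K\<^esub>" for m :: nat
  have \<epsilon>C: "\<epsilon> m \<in> carrier C.D" for m unfolding \<epsilon>_def by (rule C.mono_D) auto
  have \<epsilon>_step: "\<epsilon> (Suc m) [^]\<^bsub>C.D\<^esub> p = \<epsilon> m" for m
    using C.M.monomial_pow[of "1 / of_nat p ^ Suc m" p] p_pos
    by (simp add: \<epsilon>_def rat_monoid_pow)
  define \<sigma> where "\<sigma> m = monomial K (0::rat) (xs m) \<oplus>\<^bsub>C.D\<^esub> \<epsilon> m" for m
  have \<sigma>C: "\<sigma> m \<in> carrier C.D" for m unfolding \<sigma>_def using xs(1) \<epsilon>C by simp
  have \<sigma>_step: "\<sigma> (Suc m) [^]\<^bsub>C.D\<^esub> p = \<sigma> m" for m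
  proof -
    have "\<sigma> (Suc m) [^]\<^bsub>C.D\<^esub> p = monomial K 0 (xs (Suc m)) [^]\<^bsub>C.D\<^esub> p \<oplus>\<^bsub>C.D\<^esub> \<epsilon> (Suc m) [^]\<^bsub>C.D\<^esub> p"
      unfolding \<sigma>_def using xs(1) \<epsilon>C by (intro C.D.frobenius_add[OF p_prime charC]) auto
    also have "monomial K 0 (xs (Suc m)) [^]\<^bsub>C.D\<^esub> p = monomial K 0 (xs m)"
      using C.pconst.hom_nat_pow[OF xs(1), of "Suc m" p] xs_step by simp
    finally show ?thesis using \<epsilon>_step by (simp add: \<sigma>_def)
  qed
  have \<sigma>0: "\<sigma> m 0 = xs m" for m
  proof -
    have "\<epsilon> m 0 = \<zero>\<^bsub>K\<^esub>" using p_pos by (simp add: \<epsilon>_def monomial_def)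
    moreover have "monomial K 0 (xs m) (0::rat) = xs m" by (simp add: monomial_def)
    moreover have "\<sigma> m 0 = monomial K (0::rat) (xs m) 0 \<oplus>\<^bsub>K\<^esub> \<epsilon> m 0"
      by (simp only: \<sigma>_def C.M.add_apply)
    ultimately show ?thesis using xs(1) by simp
  qed
  define \<alpha> where "\<alpha> c = emb (monomial K 0 (res c))" for c
  have \<alpha>: "\<alpha> \<in> ring_hom k (Qt C.D)"
    using ring_hom_trans[OF ring_hom_trans[OF res.homh C.pconst.homh] emb.homh] unfolding \<alpha>_def[abs_def] comp_def .
  \<comment> \<open>The constant term of a polynomial in \<open>x\<^sub>m + e\<^sup>r\<close> is its value at \<open>x\<^sub>m\<close>, nonzero because \<open>x\<^sub>m\<close> is
    transcendental over \<open>k\<close>. This makes all denominators of \<open>k\<^sub>\<infinity>\<close> invertible and keeps the order nonnegative.\<close>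
  have ev: "\<exists>g\<in>carrier C.D. g 0 \<noteq> \<zero>\<^bsub>K\<^esub> \<and> ring.eval (Qt C.D) (map \<alpha> l) (emb (\<sigma> m)) = emb g"
    if l: "set l \<subseteq> carrier k" "\<not> set l \<subseteq> {\<zero>}" for l m
  proof -
    let ?l = "map (\<lambda>c. monomial K (0::rat) (res c)) l"
    define g where "g = ring.eval C.D ?l (\<sigma> m)"
    have lC: "set ?l \<subseteq> carrier C.D" using l(1) by auto
    have gC: "g \<in> carrier C.D" unfolding g_def by (rule C.D.eval_in_carrier[OF lC \<sigma>C])
    have "emb g = C.QD.eval (map \<alpha> l) (emb (\<sigma> m))"
      using emb.eval_hom'[OF \<sigma>C lC, of m] unfolding g_def \<alpha>_def[abs_def] by (simp add: comp_def)
    moreover have "g 0 = K.eval (map res l) (xs m)"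
    proof -
      have "map (\<lambda>f. f 0) ?l = map res l" by (simp add: monomial_def)
      then show ?thesis using C.cc.eval_hom'[OF \<sigma>C lC, of m] \<sigma>0[of m] unfolding g_def by (simp only:)
    qed
    moreover have "K.eval (map res l) (xs m) \<noteq> \<zero>\<^bsub>K\<^esub>"
    proof
      assume z: "K.eval (map res l) (xs m) = \<zero>\<^bsub>K\<^esub>"
      have "set (map res l) \<subseteq> res ` carrier k" using l(1) by auto
      then have "set (map res l) \<subseteq> {\<zero>\<^bsub>K\<^esub>}"
        by (rule K.transcendental_eval_zero[OF xs_tr k'_carrier xs(1) _ z])
      moreover have "c = \<zero>" if "c \<in> set l" "res c = \<zero>\<^bsub>K\<^esub>" for c
      proof -
        have "inj_on res (carrier k)" by (rule res.img_is_subfield(1)[OF k.carrier_is_subfield]) simp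
        then show ?thesis using that l(1) res.hom_zero k.zero_closed by (metis inj_onD subsetD)
      qed
      ultimately show False using l(2) by auto
    qed
    ultimately show ?thesis using gC by metis
  qed
  have emb_ne: "emb g \<noteq> \<zero>\<^bsub>Qt C.D\<^esub>" if "g \<in> carrier C.D" "g 0 \<noteq> \<zero>\<^bsub>K\<^esub>" for g
    using C.D.Qt_embed_eq_zero_iff[of g] that unfolding emb_def by (auto simp: C.M.zero_apply)
  have unit: "C.QD.eval (map \<alpha> l) (emb (\<sigma> m)) \<in> Units (Qt C.D)" if l: "set l \<subseteq> carrier k" "\<not> set l \<subseteq> {\<zero>}" for l m
    using ev[OF l, of m] emb_ne emb.hom_closed C.QD.field_Units by auto
  have emb_step: "emb (\<sigma> (Suc m)) [^]\<^bsub>Qt C.D\<^esub> p = emb (\<sigma> m)" for m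
    using emb.hom_nat_pow[OF \<sigma>C, of "Suc m" p] \<sigma>_step by simp
  obtain \<psi> where \<psi>: "\<psi> \<in> ring_hom Kinf (Qt C.D)" "\<And>c. c \<in> carrier k \<Longrightarrow> \<psi> (const c) = \<alpha> c"
      "\<And>m. \<psi> (t m) = emb (\<sigma> m)"
    using Kinf_universal[OF C.QD.cring_axioms \<alpha>, of "\<lambda>m. emb (\<sigma> m)"] unit emb_step emb.hom_closed[OF \<sigma>C] by blast
  interpret \<psi>: ring_hom_ring Kinf "Qt C.D" \<psi> by (intro ring_hom_ringI2 Kinf.ring_axioms C.QD.ring_axioms \<psi>(1))
  define \<beta> where "\<beta> a = emb (monomial K 0 (q a))" for a
  have \<beta>: "\<beta> \<in> ring_hom A (Qt C.D)"
    using ring_hom_trans[OF ring_hom_trans[OF q.homh C.pconst.homh] emb.homh] unfolding \<beta>_def[abs_def] comp_def .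
  have agree: "\<beta> (c \<odot>\<^bsub>A\<^esub> \<one>\<^bsub>A\<^esub>) = \<psi> (c \<odot>\<^bsub>Kinf\<^esub> \<one>\<^bsub>Kinf\<^esub>)" if "c \<in> carrier k" for c
    using that \<psi>(2)[OF that] res_q[of c] by (simp add: \<beta>_def \<alpha>_def)
  obtain \<Psi> where \<Psi>: "\<Psi> \<in> ring_hom T (Qt C.D)" "\<And>a. a \<in> carrier A \<Longrightarrow> \<Psi> (inl a) = \<beta> a"
      "\<And>b. b \<in> carrier Kinf \<Longrightarrow> \<Psi> (inr b) = \<psi> b"
    using tensor_universal[OF C.QD.cring_axioms \<beta> \<psi>(1) agree] by blast
  interpret \<Psi>: ring_hom_ring T "Qt C.D" \<Psi> by (intro ring_hom_ringI2 T.ring_axioms C.QD.ring_axioms \<Psi>(1))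
  interpret TN: noetherian_ring T by (rule noeth)
  define V where "V = C.order_at_least"
  note V_add = C.order_add[folded V_def]
    and V_mult = C.order_mult[folded V_def]
    and V_zero = C.order_zero[folded V_def]
    and V_mono = C.order_mono[folded V_def]
    and V_embed = C.order_embed[folded V_def, folded emb_def]
    and V_monomial = C.order_monomial[folded V_def, folded emb_def]
  have emb_V0: "emb f \<in> V 0" if "f \<in> carrier C.D" for f
  proof (rule V_embed[OF that])
    fix x :: rat assume "x < 0"
    then show "f x = \<zero>\<^bsub>K\<^esub>" using C.M.memD(3)[of f] that by auto
  qed
  have constK: "set (map const l) \<subseteq> carrier Kinf" if "set l \<subseteq> carrier k" for l
    using that const_Kinf by auto
  have eval_emb: "\<exists>f\<in>carrier C.D. \<psi> y = emb f" if y: "y \<in> \<Omega>.simple_extension consts (t m)" for y m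
  proof -
    obtain l where l: "set l \<subseteq> carrier k" "y = \<Omega>.eval (map const l) (t m)"
      using \<Omega>.simple_extension_image_list[OF _ t_closed y] const.hom_closed by blast
    have "\<psi> y = C.QD.eval (map \<psi> (map const l)) (emb (\<sigma> m))"
      using \<psi>.eval_hom'[OF t_Kinf constK[OF l(1)], of m] unfolding l(2) Kinf_eval \<psi>(3) .
    also have "map \<psi> (map const l) = map \<alpha> l" using l(1) \<psi>(2) by auto
    finally have e: "\<psi> y = C.QD.eval (map \<alpha> l) (emb (\<sigma> m))" .
    let ?l = "map (\<lambda>c. monomial K (0::rat) (res c)) l"
    have lC: "set ?l \<subseteq> carrier C.D" using l(1) by auto
    have "emb (C.D.eval ?l (\<sigma> m)) = C.QD.eval (map \<alpha> l) (emb (\<sigma> m))"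
      using emb.eval_hom'[OF \<sigma>C lC, of m] unfolding \<alpha>_def[abs_def] by (simp add: comp_def)
    then show ?thesis using e C.D.eval_in_carrier[OF lC \<sigma>C] by metis
  qed
  have \<psi>_V: "\<psi> b \<in> V 0" if b: "b \<in> carrier Kinf" for b
  proof -
    obtain m z where z: "z \<in> \<Omega>.simple_extension consts (t m)" "z \<noteq> \<zero>\<^bsub>\<Omega>\<^esub>"
      "b \<otimes>\<^bsub>\<Omega>\<^esub> z \<in> \<Omega>.simple_extension consts (t m)" using Kinf_fraction[OF b] .
    have zK: "z \<in> carrier Kinf" using z(1) simple_extension_stage by (auto simp: Kinf_carrier)
    obtain l where l: "set l \<subseteq> carrier k" "z = \<Omega>.eval (map const l) (t m)"
      using \<Omega>.simple_extension_image_list[OF _ t_closed z(1)] const.hom_closed by blast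
    have lne: "\<not> set l \<subseteq> {\<zero>}"
    proof
      assume "set l \<subseteq> {\<zero>}"
      then have "\<Omega>.eval (map const l) (t m) = \<zero>\<^bsub>\<Omega>\<^esub>" by (induction l) simp_all
      then show False using z(2) l(2) by simp
    qed
    have "\<psi> z = C.QD.eval (map \<psi> (map const l)) (emb (\<sigma> m))"
      using \<psi>.eval_hom'[OF t_Kinf constK[OF l(1)], of m] unfolding l(2) Kinf_eval \<psi>(3) .
    also have "map \<psi> (map const l) = map \<alpha> l" using l(1) \<psi>(2) by auto
    finally obtain g where g: "g \<in> carrier C.D" "g 0 \<noteq> \<zero>\<^bsub>K\<^esub>" "\<psi> z = emb g"
      using ev[OF l(1) lne, of m] by metis
    obtain f where f: "f \<in> carrier C.D" "\<psi> (b \<otimes>\<^bsub>\<Omega>\<^esub> z) = emb f" using eval_emb[OF z(3)] by blast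
    have prod: "\<psi> b \<otimes>\<^bsub>Qt C.D\<^esub> emb g = emb f" using \<psi>.hom_mult[OF b zK] f(2) g(3) by simp
    have gne: "g \<in> carrier C.D - {\<zero>\<^bsub>C.D\<^esub>}" using C.const_coeff_nonzero[of g] g by blast
    have "fraction C.D f g \<otimes>\<^bsub>Qt C.D\<^esub> emb g = emb f"
      unfolding emb_def by (rule C.D.fraction_mult_denominator[OF f(1) gne])
    then have "\<psi> b = fraction C.D f g"
      using prod emb_ne[OF g(1,2)] emb.hom_closed[OF g(1)] \<psi>.hom_closed[OF b]
        C.D.fraction_closed[OF f(1) gne] by (metis C.QD.m_rcancel)
    moreover have "\<forall>x<0. f x = \<zero>\<^bsub>K\<^esub>" using C.M.memD(3)[of f] f(1) by auto
    ultimately show ?thesis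
      unfolding V_def C.order_at_least_def using f(1) g(1,2) by blast
  qed
  have \<Psi>_V: "\<Psi> y \<in> V 0" if "y \<in> carrier T" for y
    using that
  proof (induction y rule: tensor_induct)
    case (tensor a b)
    then show ?case
      using V_mult[OF emb_V0 \<psi>_V, of "monomial K 0 (q a)" b] by (simp add: \<Psi>(2,3) \<beta>_def)
  next
    case (add x y)
    then show ?case using V_add by simp
  qed
  have Jq_ideal: "ideal {y \<in> carrier T. \<Psi> y \<in> V r} T" for r
  proof (rule idealI[OF T.ring_axioms])
    have mult: "\<Psi> (y \<otimes>\<^bsub>T\<^esub> z) \<in> V r" if "y \<in> carrier T" "z \<in> carrier T" "\<Psi> y \<in> V r" for y z
      using V_mult[OF that(3) \<Psi>_V[OF that(2)]] that by simp
    show "subgroup {y \<in> carrier T. \<Psi> y \<in> V r} (add_monoid T)"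
    proof (rule T.add.subgroupI)
      have "\<zero>\<^bsub>T\<^esub> \<in> {y \<in> carrier T. \<Psi> y \<in> V r}" using V_zero by simp
      then show "{y \<in> carrier T. \<Psi> y \<in> V r} \<noteq> {}" by blast
      fix y assume y: "y \<in> {y \<in> carrier T. \<Psi> y \<in> V r}"
      then have "\<Psi> (y \<otimes>\<^bsub>T\<^esub> (\<ominus>\<^bsub>T\<^esub> \<one>\<^bsub>T\<^esub>)) \<in> V r" by (intro mult) auto
      moreover have "y \<otimes>\<^bsub>T\<^esub> (\<ominus>\<^bsub>T\<^esub> \<one>\<^bsub>T\<^esub>) = \<ominus>\<^bsub>T\<^esub> y" using y by (simp add: T.r_minus)
      ultimately show "\<ominus>\<^bsub>T\<^esub> y \<in> {y \<in> carrier T. \<Psi> y \<in> V r}" using y by simp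
      fix z assume "z \<in> {y \<in> carrier T. \<Psi> y \<in> V r}"
      then show "y \<oplus>\<^bsub>T\<^esub> z \<in> {y \<in> carrier T. \<Psi> y \<in> V r}" using y V_add by simp
    qed auto
    fix y z assume y: "y \<in> {y \<in> carrier T. \<Psi> y \<in> V r}" and z: "z \<in> carrier T"
    show *: "y \<otimes>\<^bsub>T\<^esub> z \<in> {y \<in> carrier T. \<Psi> y \<in> V r}" using y z mult by simp
    then show "z \<otimes>\<^bsub>T\<^esub> y \<in> {y \<in> carrier T. \<Psi> y \<in> V r}" using T.m_comm[of y z] y z by simp
  qed
  define J where "J r = {y \<in> carrier T. \<Psi> y \<in> V r}" for r
  note J_ideal = Jq_ideal[folded J_def]
  have J_mono: "J r \<subseteq> J s" if "s \<le> r" for r s using V_mono[OF that] by (auto simp: J_def)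
  define e where "e n = (1 / of_nat p ^ n :: rat)" for n :: nat
  have e_mono: "e (Suc n) \<le> e n" for n
    unfolding e_def using p_pos by (simp add: field_simps)
  obtain N where N: "\<And>n. J (e n) \<subseteq> J (e N)"
    using TN.ideal_seq_stabilizes[of "\<lambda>n. J (e n)", OF J_ideal J_mono[OF e_mono]] by blast
  \<comment> \<open>One step beyond the index \<open>N\<close> from which the ideals are constant, an element of order \<open>1/p\<^sup>m < 1/p\<^sup>N\<close> appears.\<close>
  define m where "m = Suc N"
  obtain a b where ab: "a \<in> carrier A" "b \<in> carrier A" "xs m \<otimes>\<^bsub>K\<^esub> q b = q a" "q b \<noteq> \<zero>\<^bsub>K\<^esub>"
    using residue_field_cases[OF P, of "xs m"] xs(1)[of m] unfolding K_def q_def by metis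
  define y where "y = inl b \<otimes>\<^bsub>T\<^esub> inr (t m) \<ominus>\<^bsub>T\<^esub> inl a"
  have yT: "y \<in> carrier T" unfolding y_def using ab by simp
  have "\<Psi> y = \<beta> b \<otimes>\<^bsub>Qt C.D\<^esub> emb (\<sigma> m) \<oplus>\<^bsub>Qt C.D\<^esub> \<ominus>\<^bsub>Qt C.D\<^esub> \<beta> a"
    unfolding y_def T.minus_eq using ab by (simp add: \<Psi>(2,3) \<psi>(3))
  also have "\<dots> = emb (monomial K 0 (q b) \<otimes>\<^bsub>C.D\<^esub> \<sigma> m \<oplus>\<^bsub>C.D\<^esub> \<ominus>\<^bsub>C.D\<^esub> monomial K 0 (q a))"
    using ab \<sigma>C by (simp add: \<beta>_def)
  also have "monomial K 0 (q b) \<otimes>\<^bsub>C.D\<^esub> \<sigma> m \<oplus>\<^bsub>C.D\<^esub> \<ominus>\<^bsub>C.D\<^esub> monomial K 0 (q a) = monomial K 0 (q b) \<otimes>\<^bsub>C.D\<^esub> \<epsilon> m"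
  proof -
    have c: "monomial K 0 (q b) \<in> carrier C.D" "monomial K 0 (xs m) \<in> carrier C.D" "monomial K 0 (q a) \<in> carrier C.D"
      using ab xs(1) by auto
    have "monomial K 0 (q b) \<otimes>\<^bsub>C.D\<^esub> monomial K 0 (xs m) = monomial K 0 (q a)"
      using C.pconst.hom_mult[of "q b" "xs m"] ab xs(1) K.m_comm[of "q b" "xs m"] by simp
    then show ?thesis
      unfolding \<sigma>_def using c \<epsilon>C[of m] by (simp add: C.D.r_distr C.D.a_ac C.D.r_neg2 C.D.r_neg1 C.D.r_neg)
  qed
  also have "monomial K 0 (q b) \<otimes>\<^bsub>C.D\<^esub> \<epsilon> m = monomial K (e m) (q b)"
    unfolding \<epsilon>_def e_def using C.M.mult_monomials[of 0 "1 / of_nat p ^ m" "q b" "\<one>\<^bsub>K\<^esub>"] ab by simp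
  finally have \<Psi>y: "\<Psi> y = emb (monomial K (e m) (q b))" .
  have e_pos: "0 \<le> e n" for n by (simp add: e_def)
  have "emb (monomial K (e m) (q b)) \<in> V (e m)"
    by (rule V_embed) (use ab e_pos C.mono_D[of "e m" "q b"] in \<open>auto simp: monomial_def\<close>)
  then have "y \<in> J (e m)" unfolding J_def using yT \<Psi>y by simp
  then have "y \<in> J (e N)" using N by blast
  then have "emb (monomial K (e m) (q b)) \<in> V (e N)" unfolding J_def using \<Psi>y by simp
  then have "e N \<le> e m" by (rule V_monomial[OF e_pos q.hom_closed[OF ab(2)] ab(4)])
  moreover have "e m < e N"
    unfolding e_def m_def using prime_gt_1_nat[OF p_prime] by (simp add: field_simps)
  ultimately show False by simp
qed

end

section \<open>Prime ideals of A_infinity\<close>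

lemma (in ring_hom_ring) bounded_polys_image:
  assumes "y \<in> bounded_polys R H t n" "H \<subseteq> carrier R" "t \<in> carrier R" "h ` H \<subseteq> L"
  shows "y \<in> carrier R" "h y \<in> bounded_polys S L (h t) n"
proof -
  have "y \<in> carrier R \<and> h y \<in> bounded_polys S L (h t) n"
    using assms(1)
  proof (induction n arbitrary: y)
    case (Suc n)
    then obtain c z where y: "y = c \<otimes> t [^] n \<oplus> z" "c \<in> H" "z \<in> bounded_polys R H t n" by auto
    have z: "z \<in> carrier R" "h z \<in> bounded_polys S L (h t) n" using Suc.IH[OF y(3)] by auto
    have c: "c \<in> carrier R" "h c \<in> L" using y(2) assms(2,4) by auto
    have "h y = h c \<otimes>\<^bsub>S\<^esub> h t [^]\<^bsub>S\<^esub> n \<oplus>\<^bsub>S\<^esub> h z"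
      unfolding y(1) using c z assms(3) by (simp add: hom_nat_pow)
    moreover have "y \<in> carrier R" unfolding y(1) using c z assms(3) by simp
    ultimately show ?case using c z by auto
  qed simp
  then show "y \<in> carrier R" "h y \<in> bounded_polys S L (h t) n" by auto
qed

text \<open>A map into a field factors through the residue field of its kernel, since nonzero classes have nonzero, hence
  invertible, images.\<close>

theorem (in ring_hom_ring) residue_field_lift:
  assumes S: "field S" and P: "primeideal P R" and P_def: "P = a_kernel R S h"
  shows "\<exists>\<theta>\<in>ring_hom (Qt (R Quot P)) S. \<forall>a\<in>carrier R. \<theta> (fraction (R Quot P) (P +>\<^bsub>R\<^esub> a) \<one>\<^bsub>R Quot P\<^esub>) = h a"
proof -
  interpret S: field S by (rule S)
  interpret Q: domain "R Quot P" by (rule primeideal.quotient_is_domain[OF P])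
  define g where "g = (\<lambda>C. the_elem (h ` C))"
  have g_hom: "g \<in> ring_hom (R Quot P) S" unfolding g_def P_def by (rule the_elem_hom)
  have g: "g (P +>\<^bsub>R\<^esub> a) = h a" if "a \<in> carrier R" for a
    unfolding g_def P_def by (rule the_elem_simp[OF that])
  interpret g: ring_hom_ring "R Quot P" S g by (intro ring_hom_ringI2 Q.ring_axioms S.ring_axioms g_hom)
  have unit: "g C \<in> Units S" if C: "C \<in> carrier (R Quot P) - {\<zero>\<^bsub>R Quot P\<^esub>}" for C
  proof -
    have "g C \<noteq> \<zero>\<^bsub>S\<^esub>"
    proof
      assume z: "g C = \<zero>\<^bsub>S\<^esub>"
      then have "g C = g \<zero>\<^bsub>R Quot P\<^esub>" using g.hom_zero by simp
      then have "C = \<zero>\<^bsub>R Quot P\<^esub>"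
        using the_elem_inj[of C "\<zero>\<^bsub>R Quot P\<^esub>"] C Q.zero_closed unfolding g_def P_def by blast
      then show False using C by blast
    qed
    then show ?thesis using C S.field_Units g.hom_closed by blast
  qed
  have self: "(R Quot P)\<lparr>carrier := carrier (R Quot P)\<rparr> = R Quot P"
    "(Qt (R Quot P))\<lparr>carrier := fractions_over (R Quot P) (carrier (R Quot P))\<rparr> = Qt (R Quot P)"
    by (simp_all add: fractions_over_def Qt_def)
  let ?\<theta> = "fraction_lift (R Quot P) (carrier (R Quot P)) S g"
  have lift: "?\<theta> (fraction (R Quot P) a b) = g a \<otimes>\<^bsub>S\<^esub> inv\<^bsub>S\<^esub> g b"
    if "a \<in> carrier (R Quot P)" "b \<in> carrier (R Quot P) - {\<zero>\<^bsub>R Quot P\<^esub>}" for a b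
    by (rule Q.fraction_lift_eq[OF Q.carrier_is_subring S.cring_axioms _ unit that]) (simp_all add: self g_hom)
  have hom: "?\<theta> \<in> ring_hom (Qt (R Quot P)) S"
    using Q.fraction_lift_hom[where h = g, OF Q.carrier_is_subring S.cring_axioms _ unit] g_hom unfolding self by blast
  have "?\<theta> (fraction (R Quot P) (P +>\<^bsub>R\<^esub> a) \<one>\<^bsub>R Quot P\<^esub>) = h a" if a: "a \<in> carrier R" for a
  proof -
    have Pa: "P +>\<^bsub>R\<^esub> a \<in> carrier (R Quot P)"
      by (rule ring_hom_closed[OF ideal.rcos_ring_hom[OF primeideal.axioms(1)[OF P]] a])
    have "?\<theta> (fraction (R Quot P) (P +>\<^bsub>R\<^esub> a) \<one>\<^bsub>R Quot P\<^esub>) = h a \<otimes>\<^bsub>S\<^esub> inv\<^bsub>S\<^esub> \<one>\<^bsub>S\<^esub>"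
      using lift[OF Pa, of "\<one>\<^bsub>R Quot P\<^esub>"] g[OF a] g.hom_one by simp
    then show ?thesis using hom_closed[OF a] by simp
  qed
  then show ?thesis using hom by blast
qed

context extended_algebra
begin

abbreviation "s m \<equiv> inr (t m)"
abbreviation "iA \<equiv> inl ` carrier A"

definition "U m = T.simple_extension iA (s m)"

lemma iA_subring: "subring iA T"
  by (rule inl.img_is_subring[OF ring.carrier_is_subring[OF A_ring]])

lemma s_closed [simp]: "s m \<in> carrier T" by simp

lemma s_power: "s (Suc m) [^]\<^bsub>T\<^esub> p = s m"
  using inr.hom_nat_pow[OF t_Kinf, of "Suc m" p] t_power[of m] by (simp add: Kinf_nat_pow)

lemma U_subring: "subring (U m) T"
  unfolding U_def by (rule T.simple_extension_subring_cring[OF iA_subring s_closed])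

lemma U_incl: "iA \<subseteq> U m" "s m \<in> U m"
  unfolding U_def
  using T.simple_extension_incl[OF subringE(1)[OF iA_subring] s_closed]
    T.simple_extension_mem[OF iA_subring s_closed] by auto

lemma U_pow: "x \<in> U m \<Longrightarrow> x [^]\<^bsub>T\<^esub> (n::nat) \<in> U m"
  using subringE(3,6)[OF U_subring[of m]] by (induction n) auto

lemma U_mono_Suc: "U m \<subseteq> U (Suc m)"
proof -
  have "s m \<in> U (Suc m)" using U_pow[OF U_incl(2), of "Suc m" p] s_power by simp
  then show ?thesis
    unfolding U_def[of m] by (intro T.simple_extension_subring_incl[OF U_subring U_incl(1)])
qed

lemma U_mono: "m \<le> n \<Longrightarrow> U m \<subseteq> U n"
  by (rule lift_Suc_mono_le[of U, OF U_mono_Suc])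

lemma U_Suc_subset: "U (Suc m) \<subseteq> T.simple_extension (U m) (s (Suc m))"
  unfolding U_def[of "Suc m"] by (rule T.mono_simple_extension[OF U_incl(1)])

lemma inr_const_iA: "c \<in> carrier k \<Longrightarrow> inr (const c) \<in> iA"
  using inl_inr_const[of c] by (simp add: rev_image_eqI[of "c \<odot>\<^bsub>A\<^esub> \<one>\<^bsub>A\<^esub>"])

lemma inr_simple_extension: "y \<in> \<Omega>.simple_extension consts (t m) \<Longrightarrow> inr y \<in> U m"
proof (induction rule: \<Omega>.simple_extension.induct)
  case zero
  then show ?case using subringE(2)[OF U_subring] inr.hom_zero by simp
next
  case (lin y c)
  then obtain d where d: "d \<in> carrier k" "c = const d" by auto
  have y: "y \<in> carrier Kinf" using lin(1) simple_extension_stage by (auto simp: Kinf_carrier)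
  have "inr (y \<otimes>\<^bsub>Kinf\<^esub> t m \<oplus>\<^bsub>Kinf\<^esub> c) = inr y \<otimes>\<^bsub>T\<^esub> s m \<oplus>\<^bsub>T\<^esub> inr c"
    using y d t_Kinf Kinf.m_closed[of y "t m"] by (simp del: Kinf_simps)
  moreover have "inr c \<in> U m" using U_incl(1) inr_const_iA[OF d(1)] d(2) by blast
  ultimately show ?case
    using subringE(6,7)[OF U_subring] lin.IH U_incl(2) by simp
qed

text \<open>Elements of \<open>T\<close> are combinations over \<open>A\<close> of fractions from the fields \<open>k(t\<^sub>m)\<close>, and the denominators of these are
  units of \<open>T\<close>.\<close>

lemma clear_denominators:
  assumes "y \<in> carrier T"
  shows "\<exists>m. \<exists>u\<in>Units T. u \<in> U m \<and> u \<otimes>\<^bsub>T\<^esub> y \<in> U m"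
  using assms
proof (induction y rule: tensor_induct)
  case (tensor a b)
  obtain m z where z: "z \<in> \<Omega>.simple_extension consts (t m)" "z \<noteq> \<zero>\<^bsub>\<Omega>\<^esub>"
    "b \<otimes>\<^bsub>\<Omega>\<^esub> z \<in> \<Omega>.simple_extension consts (t m)" using Kinf_fraction[OF tensor(2)] .
  have zK: "z \<in> carrier Kinf" using z(1) simple_extension_stage by (auto simp: Kinf_carrier)
  have "z \<in> Units Kinf" using zK z(2) Kinf.field_Units by simp
  then obtain z' where z': "z' \<in> carrier Kinf" "z \<otimes>\<^bsub>Kinf\<^esub> z' = \<one>\<^bsub>Kinf\<^esub>"
    using Kinf.Units_r_inv_ex by blast
  have "inr z \<otimes>\<^bsub>T\<^esub> inr z' = \<one>\<^bsub>T\<^esub>" using inr.hom_mult[OF zK z'(1)] z'(2) inr.hom_one by simp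
  then have unit: "inr z \<in> Units T" using zK z'(1) T.m_comm[of "inr z" "inr z'"]
    unfolding Units_def by auto
  have "inr z \<otimes>\<^bsub>T\<^esub> (inl a \<otimes>\<^bsub>T\<^esub> inr b) = inl a \<otimes>\<^bsub>T\<^esub> (inr b \<otimes>\<^bsub>T\<^esub> inr z)"
    using tensor zK by (simp add: T.m_ac del: inr.hom_mult)
  also have "inr b \<otimes>\<^bsub>T\<^esub> inr z = inr (b \<otimes>\<^bsub>\<Omega>\<^esub> z)" using inr.hom_mult[OF tensor(2) zK] by simp
  finally have "inr z \<otimes>\<^bsub>T\<^esub> (inl a \<otimes>\<^bsub>T\<^esub> inr b) \<in> U m"
    using subringE(6)[OF U_subring _ inr_simple_extension[OF z(3)]] subsetD[OF U_incl(1) imageI[OF tensor(1)]] by simp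
  then show ?case using unit inr_simple_extension[OF z(1)] by blast
next
  case (add x y)
  then obtain m u n v where u: "u \<in> Units T" "u \<in> U m" "u \<otimes>\<^bsub>T\<^esub> x \<in> U m"
    and v: "v \<in> Units T" "v \<in> U n" "v \<otimes>\<^bsub>T\<^esub> y \<in> U n" by auto
  let ?N = "max m n"
  have UN: "u \<in> U ?N" "u \<otimes>\<^bsub>T\<^esub> x \<in> U ?N" "v \<in> U ?N" "v \<otimes>\<^bsub>T\<^esub> y \<in> U ?N"
    using u v U_mono[of m ?N] U_mono[of n ?N] by auto
  note sr = subringE(6,7)[OF U_subring[of ?N]]
  have "(u \<otimes>\<^bsub>T\<^esub> v) \<otimes>\<^bsub>T\<^esub> (x \<oplus>\<^bsub>T\<^esub> y) = v \<otimes>\<^bsub>T\<^esub> (u \<otimes>\<^bsub>T\<^esub> x) \<oplus>\<^bsub>T\<^esub> u \<otimes>\<^bsub>T\<^esub> (v \<otimes>\<^bsub>T\<^esub> y)"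
    using add(1,2) T.Units_closed[OF u(1)] T.Units_closed[OF v(1)] by (simp add: T.r_distr T.m_ac)
  then have "(u \<otimes>\<^bsub>T\<^esub> v) \<otimes>\<^bsub>T\<^esub> (x \<oplus>\<^bsub>T\<^esub> y) \<in> U ?N"
    using sr(2)[OF sr(1)[OF UN(3,2)] sr(1)[OF UN(1,4)]] by simp
  moreover have "u \<otimes>\<^bsub>T\<^esub> v \<in> U ?N" by (rule sr(1)[OF UN(1,3)])
  moreover have "u \<otimes>\<^bsub>T\<^esub> v \<in> Units T" using u(1) v(1) by (rule T.Units_m_closed)
  ultimately show ?case by blast
qed

text \<open>Cohen's theorem reduces the claim to prime ideals \<open>P\<close>. From some \<open>M\<close> on, the images of the \<open>t\<^sub>m\<close> in \<open>Qt(T/P)\<close> have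
  degree \<open>p\<close> over the field that the preceding image generates over the residue field of \<open>P \<inter> A\<close>, so that no new generators of \<open>P\<close> appear after \<open>A[t\<^sub>M]\<close>.\<close>

theorem noetherian_of_sharp_algebraic:
  assumes noeth: "noetherian_ring A"
    and sharp: "\<And>P x. primeideal P A \<Longrightarrow> x \<in> sharp p (Qt (A Quot P)) \<Longrightarrow>
      (ring.algebraic (Qt (A Quot P)) over (residue_map A P ` carrier k)) x"
  shows "noetherian_ring T"
proof (rule T.noetherian_from_prime_ideals)
  fix P assume P: "primeideal P T"
  interpret P: primeideal P T by (rule P)
  define \<Xi> where "\<Xi> = Qt (T Quot P)"
  have TP: "domain (T Quot P)" by (rule P.quotient_is_domain)
  interpret \<Xi>: field \<Xi> unfolding \<Xi>_def by (rule domain.Qt_field[OF TP])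
  define \<phi> where "\<phi> y = fraction (T Quot P) (P +>\<^bsub>T\<^esub> y) \<one>\<^bsub>T Quot P\<^esub>" for y
  have \<phi>_hom: "\<phi> \<in> ring_hom T \<Xi>"
    using ring_hom_trans[OF P.rcos_ring_hom domain.Qt_embed_hom[OF TP]]
    unfolding \<phi>_def[abs_def] \<Xi>_def comp_def .
  interpret \<phi>: ring_hom_ring T \<Xi> \<phi> by (intro ring_hom_ringI2 T.ring_axioms \<Xi>.ring_axioms \<phi>_hom)
  interpret quo: ring_hom_ring T "T Quot P" "(+>\<^bsub>T\<^esub>) P" by (rule P.rcos_ring_hom_ring)
  have \<phi>_zero: "\<phi> y = \<zero>\<^bsub>\<Xi>\<^esub> \<longleftrightarrow> y \<in> P" if y: "y \<in> carrier T" for y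
  proof -
    have "\<phi> y = \<zero>\<^bsub>\<Xi>\<^esub> \<longleftrightarrow> P +>\<^bsub>T\<^esub> y = \<zero>\<^bsub>T Quot P\<^esub>"
      unfolding \<phi>_def \<Xi>_def by (rule domain.Qt_embed_eq_zero_iff[OF TP quo.hom_closed[OF y]])
    also have "\<dots> \<longleftrightarrow> P +>\<^bsub>T\<^esub> y = P" by (simp only: FactRing_def ring.simps)
    also have "\<dots> \<longleftrightarrow> y \<in> P"
      by (rule iffI[OF P.rcos_const_imp_mem[OF y] T.a_rcos_zero[OF P.ideal_axioms]])
    finally show ?thesis .
  qed
  define q where "q = {a \<in> carrier A. inl a \<in> P}"
  have q_prime: "primeideal q A"
  proof (rule primeidealI)
    show "ideal q A" unfolding q_def by (rule inl.ideal_vimage[OF P.ideal_axioms])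
    show "cring A" by (rule A.M_cring)
    show "carrier A \<noteq> q"
    proof
      assume "carrier A = q"
      then have "inl \<one>\<^bsub>A\<^esub> \<in> P" unfolding q_def by blast
      then have "P = carrier T" using P.one_imp_carrier inl.hom_one by simp
      then show False using P.I_notcarr by simp
    qed
    fix a b assume ab: "a \<in> carrier A" "b \<in> carrier A" "a \<otimes>\<^bsub>A\<^esub> b \<in> q"
    then have "inl a \<otimes>\<^bsub>T\<^esub> inl b \<in> P" by (simp add: q_def)
    then show "a \<in> q \<or> b \<in> q" using P.I_prime[of "inl a" "inl b"] ab by (simp add: q_def)
  qed
  define K0 where "K0 = Qt (A Quot q)"
  have Aq: "domain (A Quot q)" by (rule APd[OF q_prime])
  interpret Aq: domain "A Quot q" by (rule Aq)
  interpret K0: field K0 unfolding K0_def by (rule Aq.Qt_field)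
  have "\<exists>\<theta>\<in>ring_hom K0 \<Xi>. \<forall>a\<in>carrier A. \<theta> (resA q a) = \<phi> (inl a)"
  proof -
    interpret f: ring_hom_ring A \<Xi> "\<lambda>a. \<phi> (inl a)"
      using ring_hom_trans[OF inl_hom \<phi>_hom] unfolding comp_def
      by (intro ring_hom_ringI2 A_ring \<Xi>.ring_axioms)
    have "a_kernel A \<Xi> (\<lambda>a. \<phi> (inl a)) = q"
      unfolding a_kernel_def' q_def
      by (rule Collect_cong, rule conj_cong[OF refl]) (rule \<phi>_zero[OF inl.hom_closed])
    from f.residue_field_lift[OF \<Xi>.field_axioms q_prime this[symmetric]]
    show ?thesis unfolding K0_def resA_def[OF q_prime] .
  qed
  then obtain \<theta> where \<theta>: "\<theta> \<in> ring_hom K0 \<Xi>" "\<And>a. a \<in> carrier A \<Longrightarrow> \<theta> (resA q a) = \<phi> (inl a)" by blast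
  interpret \<theta>: ring_hom_ring K0 \<Xi> \<theta> by (intro ring_hom_ringI2 K0.ring_axioms \<Xi>.ring_axioms \<theta>(1))
  define K where "K = \<theta> ` carrier K0"
  have \<theta>_img: "inj_on \<theta> (carrier K0)" "subfield K \<Xi>"
    unfolding K_def using \<theta>.img_is_subfield[OF K0.carrier_is_subfield] by simp_all
  have K_carrier: "K \<subseteq> carrier \<Xi>" by (rule subfieldE(3)[OF \<theta>_img(2)])
  have \<phi>_K: "\<phi> (inl a) \<in> K" if "a \<in> carrier A" for a
    using that \<theta>(2)[OF that] ring_hom_closed[OF resA_hom[OF q_prime] that] unfolding K_def K0_def by (metis imageI)
  define \<tau>' where "\<tau>' m = \<phi> (s m)" for m
  define cst where "cst c = \<phi> (inr (const c))" for c
  have cst_hom: "cst \<in> ring_hom k \<Xi>"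
  proof -
    have cK: "const \<in> ring_hom k Kinf"
      by (rule ring_hom_memI) (simp_all add: const.hom_mult const.hom_add)
    show ?thesis
      using ring_hom_trans[OF ring_hom_trans[OF cK inr_hom] \<phi>_hom] unfolding cst_def[abs_def] comp_def .
  qed
  interpret cst: ring_hom_ring k \<Xi> cst by (intro ring_hom_ringI2 k.ring_axioms \<Xi>.ring_axioms cst_hom)
  define k' where "k' = cst ` carrier k"
  have k'_sub: "subfield k' \<Xi>" unfolding k'_def by (rule cst.img_is_subfield(2)[OF k.carrier_is_subfield]) simp
  have char: "add_pow \<Xi> p \<one>\<^bsub>\<Xi>\<^esub> = \<zero>\<^bsub>\<Xi>\<^esub>" using cst.hom_add_pow[of \<one> p] p_zero by simp
  have cst_res: "cst c = \<theta> (residue_map A q c)" if "c \<in> carrier k" for c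
    using that inl_inr_const[OF that] \<theta>(2)[of "c \<odot>\<^bsub>A\<^esub> \<one>\<^bsub>A\<^esub>"] residue_map_eq[OF q_prime, of c] by (simp add: cst_def)
  have \<tau>'_c: "\<tau>' m \<in> carrier \<Xi>" for m unfolding \<tau>'_def by simp
  have \<tau>'_step: "\<tau>' (Suc m) [^]\<^bsub>\<Xi>\<^esub> p = \<tau>' m" for m
    using \<phi>.hom_nat_pow[OF s_closed, of "Suc m" p] s_power by (simp add: \<tau>'_def)
  define L where "L m = generate_field \<Xi> (K \<union> {\<tau>' m})" for m
  have gens: "K \<union> {\<tau>' m} \<subseteq> carrier \<Xi>" for m using K_carrier \<tau>'_c by simp
  have L_sub: "subfield (L m) \<Xi>" for m unfolding L_def by (rule \<Xi>.generate_field_is_subfield[OF gens])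
  have L_incl: "K \<subseteq> L m" "\<tau>' m \<in> L m" for m unfolding L_def by (auto intro: generate_field.incl)
  \<comment> \<open>Frobenius maps \<open>K\<close> into \<open>K\<close> and \<open>\<tau>'\<^sub>m\<^sub>+\<^sub>1\<close> to \<open>\<tau>'\<^sub>m\<close>.\<close>
  have L_frob: "y [^]\<^bsub>\<Xi>\<^esub> p \<in> L m" if y: "y \<in> L (Suc m)" for y m
  proof -
    let ?F = "{y \<in> carrier \<Xi>. y [^]\<^bsub>\<Xi>\<^esub> p \<in> L m}"
    note Lr = subringE[OF subfieldE(1)[OF L_sub[of m]]]
    have powL: "x [^]\<^bsub>\<Xi>\<^esub> n \<in> L m" if "x \<in> L m" for x and n :: nat
      using Lr(3,6) that by (induction n) auto
    have "subfield ?F \<Xi>"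
    proof (rule \<Xi>.subfieldI'[OF \<Xi>.subringI])
      show "?F \<subseteq> carrier \<Xi>" by auto
      show "\<one>\<^bsub>\<Xi>\<^esub> \<in> ?F" using Lr(3) by simp
      fix x assume x: "x \<in> ?F"
      show "\<ominus>\<^bsub>\<Xi>\<^esub> x \<in> ?F"
        using x \<Xi>.frobenius_minus[OF p_prime char, of x 1] Lr(5) by simp
      fix y assume y: "y \<in> ?F"
      show "x \<otimes>\<^bsub>\<Xi>\<^esub> y \<in> ?F" using x y Lr(6) by (simp add: \<Xi>.nat_pow_distrib)
      show "x \<oplus>\<^bsub>\<Xi>\<^esub> y \<in> ?F" using x y Lr(7) by (simp add: \<Xi>.frobenius_add[OF p_prime char])
    next
      fix x assume x: "x \<in> ?F - {\<zero>\<^bsub>\<Xi>\<^esub>}"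
      then have xu: "x \<in> carrier \<Xi>" "x \<noteq> \<zero>\<^bsub>\<Xi>\<^esub>" "x [^]\<^bsub>\<Xi>\<^esub> p \<in> L m" by auto
      then have ix: "inv\<^bsub>\<Xi>\<^esub> x \<in> carrier \<Xi>" "x \<otimes>\<^bsub>\<Xi>\<^esub> inv\<^bsub>\<Xi>\<^esub> x = \<one>\<^bsub>\<Xi>\<^esub>" using \<Xi>.field_Units by auto
      have ne: "x [^]\<^bsub>\<Xi>\<^esub> p \<noteq> \<zero>\<^bsub>\<Xi>\<^esub>" using xu \<Xi>.nat_pow_eq_zero_imp by blast
      have "x [^]\<^bsub>\<Xi>\<^esub> p \<otimes>\<^bsub>\<Xi>\<^esub> inv\<^bsub>\<Xi>\<^esub> x [^]\<^bsub>\<Xi>\<^esub> p = (x \<otimes>\<^bsub>\<Xi>\<^esub> inv\<^bsub>\<Xi>\<^esub> x) [^]\<^bsub>\<Xi>\<^esub> p"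
        by (rule \<Xi>.nat_pow_distrib[OF xu(1) ix(1), symmetric])
      also have "\<dots> = \<one>\<^bsub>\<Xi>\<^esub>" using ix by simp
      finally have "x [^]\<^bsub>\<Xi>\<^esub> p \<otimes>\<^bsub>\<Xi>\<^esub> inv\<^bsub>\<Xi>\<^esub> x [^]\<^bsub>\<Xi>\<^esub> p \<in> L m" using Lr(3) by simp
      then have "inv\<^bsub>\<Xi>\<^esub> x [^]\<^bsub>\<Xi>\<^esub> p \<in> L m"
        using \<Xi>.subfield_m_inv_simprule[OF L_sub[of m], of "x [^]\<^bsub>\<Xi>\<^esub> p" "inv\<^bsub>\<Xi>\<^esub> x [^]\<^bsub>\<Xi>\<^esub> p"] xu ix ne by simp
      then show "inv\<^bsub>\<Xi>\<^esub> x \<in> ?F" using ix by simp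
    qed
    moreover have "K \<union> {\<tau>' (Suc m)} \<subseteq> ?F"
      using L_incl[of m] K_carrier \<tau>'_c \<tau>'_step powL by auto
    ultimately have "L (Suc m) \<subseteq> ?F"
      unfolding L_def[of "Suc m"] by (intro \<Xi>.generate_field_min_subfield1[OF gens])
    then show ?thesis using y by blast
  qed
  \<comment> \<open>Otherwise \<open>\<tau>'\<^sub>0\<close> would be algebraic over \<open>k\<close>, although \<open>t\<close> is transcendental and \<open>k\<^sub>\<infinity>\<close>, a field, embeds into \<open>\<Xi>\<close>.\<close>
  have tr: "\<exists>m. \<tau>' (Suc m) \<notin> L m"
  proof (rule ccontr)
    assume "\<not> ?thesis"
    then have all: "\<tau>' (Suc m) \<in> generate_field \<Xi> (K \<union> {\<tau>' m})" for m unfolding L_def by blast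
    have "(\<Xi>.algebraic over k') (\<tau>' 0)"
    proof (rule \<Xi>.root_chain_algebraic[where \<tau> = \<tau>', OF p_prime char \<theta>_img(2) k'_sub \<tau>'_c \<tau>'_step all])
      fix c assume c: "c \<in> K" "\<forall>m. \<exists>d\<in>K. d [^]\<^bsub>\<Xi>\<^esub> (p ^ m) = c"
      then obtain x where x: "x \<in> carrier K0" "c = \<theta> x" unfolding K_def by auto
      have "x \<in> sharp p K0"
        unfolding sharp_def
      proof (rule INT_I)
        fix m :: nat
        obtain d where "d \<in> K" "d [^]\<^bsub>\<Xi>\<^esub> (p ^ m) = c" using c(2) by blast
        then obtain w where w: "w \<in> carrier K0" "\<theta> w [^]\<^bsub>\<Xi>\<^esub> (p ^ m) = \<theta> x" using x unfolding K_def by auto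
        then have "\<theta> (w [^]\<^bsub>K0\<^esub> (p ^ m)) = \<theta> x" using \<theta>.hom_nat_pow by simp
        then have "w [^]\<^bsub>K0\<^esub> (p ^ m) = x" using inj_onD[OF \<theta>_img(1)] w(1) x(1) K0.nat_pow_closed by blast
        then show "x \<in> (\<lambda>b. b [^]\<^bsub>K0\<^esub> (p ^ m)) ` carrier K0" using w(1) by blast
      qed
      then have "(K0.algebraic over (residue_map A q ` carrier k)) x"
        using sharp[OF q_prime] unfolding K0_def by blast
      moreover have rs: "subring (residue_map A q ` carrier k) K0"
      proof -
        interpret r: ring_hom_ring k K0 "residue_map A q"
          unfolding K0_def by (intro ring_hom_ringI2 k.ring_axioms K0.ring_axioms[unfolded K0_def] residue_map_hom[OF q_prime])
        show ?thesis by (rule r.img_is_subring[OF k.carrier_is_subring])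
      qed
      ultimately obtain f where f: "f \<in> carrier (univ_poly K0 (residue_map A q ` carrier k))" "f \<noteq> []"
          "K0.eval f x = \<zero>\<^bsub>K0\<^esub>"
        using K0.algebraicE[OF _ x(1)] by blast
      have fR: "set f \<subseteq> residue_map A q ` carrier k" "hd f \<noteq> \<zero>\<^bsub>K0\<^esub>"
        using f(1,2) unfolding univ_poly_def polynomial_def by auto
      have fc: "set f \<subseteq> carrier K0" using fR(1) subringE(1)[OF rs] by blast
      have "\<Xi>.eval (map \<theta> f) c = \<zero>\<^bsub>\<Xi>\<^esub>" using \<theta>.eval_hom'[OF x(1) fc] f(3) x(2) by simp
      moreover have "set (map \<theta> f) \<subseteq> k'" using fR(1) cst_res unfolding k'_def by force
      moreover have "hd (map \<theta> f) \<noteq> \<zero>\<^bsub>\<Xi>\<^esub>"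
      proof -
        have "hd f \<in> carrier K0" using fc f(2) by (cases f) auto
        then have "\<theta> (hd f) \<noteq> \<theta> \<zero>\<^bsub>K0\<^esub>" using fR(2) inj_onD[OF \<theta>_img(1)] K0.zero_closed by blast
        then show ?thesis using f(2) by (simp add: hd_map)
      qed
      ultimately show "(\<Xi>.algebraic over k') c"
        using f(2) by (intro \<Xi>.algebraicI[of "map \<theta> f"]) (auto simp: univ_poly_def polynomial_def)
    qed
    then obtain f where f: "f \<in> carrier (univ_poly \<Xi> k')" "f \<noteq> []" "\<Xi>.eval f (\<tau>' 0) = \<zero>\<^bsub>\<Xi>\<^esub>"
      using \<Xi>.algebraicE[OF subfieldE(1)[OF k'_sub] \<tau>'_c] by blast
    have fk: "set f \<subseteq> cst ` carrier k" "hd f \<noteq> \<zero>\<^bsub>\<Xi>\<^esub>"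
      using f(1,2) unfolding univ_poly_def polynomial_def k'_def by auto
    obtain l where l: "set l \<subseteq> carrier k" "f = map cst l"
    proof -
      have "f \<in> lists (cst ` carrier k)" using fk(1) by (simp add: in_lists_conv_set subset_iff)
      then have "f \<in> map cst ` lists (carrier k)" by (simp only: lists_image)
      then show thesis using that by (auto simp: in_lists_conv_set)
    qed
    define w where "w = \<Omega>.eval (map const l) (t 0)"
    interpret \<phi>r: ring_hom_ring Kinf \<Xi> "\<lambda>b. \<phi> (inr b)"
      using ring_hom_trans[OF inr_hom \<phi>_hom] unfolding comp_def
      by (intro ring_hom_ringI2 Kinf.ring_axioms \<Xi>.ring_axioms)
    have lc: "set (map const l) \<subseteq> carrier Kinf" using l(1) by auto
    have wK: "w \<in> carrier Kinf" using Kinf.eval_in_carrier[OF lc t_Kinf] by (simp add: w_def Kinf_eval)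
    have "\<phi> (inr w) = \<Xi>.eval (map (\<lambda>b. \<phi> (inr b)) (map const l)) (\<tau>' 0)"
      using \<phi>r.eval_hom'[OF t_Kinf lc, of 0] by (simp add: w_def Kinf_eval \<tau>'_def)
    also have "map (\<lambda>b. \<phi> (inr b)) (map const l) = f" unfolding l(2) by (simp add: cst_def)
    finally have "\<phi> (inr w) = \<zero>\<^bsub>\<Xi>\<^esub>" using f(3) by simp
    moreover have "inj_on (\<lambda>b. \<phi> (inr b)) (carrier Kinf)"
      by (rule \<phi>r.img_is_subfield(1)[OF Kinf.carrier_is_subfield]) simp
    ultimately have "w = \<zero>\<^bsub>Kinf\<^esub>" using wK inj_onD \<phi>r.hom_zero Kinf.zero_closed by metis
    then have "set l \<subseteq> {\<zero>}" using t_transcendental[OF l(1), of 0] by (simp add: w_def)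
    then have "hd f = \<zero>\<^bsub>\<Xi>\<^esub>" using f(2) l(2) by (cases l) auto
    then show False using fk(2) by simp
  qed
  then obtain M where M0: "\<tau>' (Suc M) \<notin> L M" by blast
  have M: "\<tau>' (Suc m) \<notin> L m" if "M \<le> m" for m
    using that
  proof (induction m rule: dec_induct)
    case base
    show ?case by (rule M0)
  next
    case (step m)
    then show ?case using L_frob[of "\<tau>' (Suc (Suc m))" m] \<tau>'_step by auto
  qed
  have \<phi>_U: "\<phi> y \<in> L m" if "y \<in> U m" for y m
  proof -
    have "U m \<subseteq> {y \<in> carrier T. \<phi> y \<in> L m}"
      unfolding U_def
    proof (rule T.simple_extension_subring_incl)
      note Lr = subringE[OF subfieldE(1)[OF L_sub[of m]]]
      show "subring {y \<in> carrier T. \<phi> y \<in> L m} T"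
        by (rule T.subringI) (use Lr in auto)
      show "iA \<subseteq> {y \<in> carrier T. \<phi> y \<in> L m}" using \<phi>_K L_incl(1) by auto
      show "s m \<in> {y \<in> carrier T. \<phi> y \<in> L m}" using L_incl(2) by (simp add: \<tau>'_def)
    qed
    then show ?thesis using that by blast
  qed
  \<comment> \<open>The leading coefficient of an element of \<open>P\<close> vanishes in \<open>\<Xi>\<close> by linear independence, so it lies in \<open>P\<close>
    itself; then the induction removes it.\<close>
  have descend: "y \<in> Idl\<^bsub>T\<^esub> (P \<inter> U m)"
    if m: "M \<le> m" and y: "y \<in> bounded_polys T (U m) (s (Suc m)) n" and n: "n \<le> p" and yP: "y \<in> P" for m n y
  proof -
    have PU: "P \<inter> U m \<subseteq> carrier T" using P.Icarr by auto
    interpret I: ideal "Idl\<^bsub>T\<^esub> (P \<inter> U m)" T by (rule T.genideal_ideal[OF PU])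
    show ?thesis
      using y n yP
    proof (induction n arbitrary: y)
      case 0
      then show ?case using I.zero_closed by simp
    next
      case (Suc n)
      then obtain c z where yz: "y = c \<otimes>\<^bsub>T\<^esub> s (Suc m) [^]\<^bsub>T\<^esub> n \<oplus>\<^bsub>T\<^esub> z" "c \<in> U m"
          "z \<in> bounded_polys T (U m) (s (Suc m)) n" by auto
      have UT: "U m \<subseteq> carrier T" by (rule subringE(1)[OF U_subring])
      have z: "z \<in> carrier T" "\<phi> z \<in> bounded_polys \<Xi> (L m) (\<tau>' (Suc m)) n"
        using \<phi>.bounded_polys_image[OF yz(3) UT s_closed, of "L m"] \<phi>_U by (auto simp: \<tau>'_def)
      have c: "c \<in> carrier T" "\<phi> c \<in> L m" using yz(2) UT \<phi>_U by auto
      have "\<phi> c \<otimes>\<^bsub>\<Xi>\<^esub> \<tau>' (Suc m) [^]\<^bsub>\<Xi>\<^esub> n \<oplus>\<^bsub>\<Xi>\<^esub> \<phi> z = \<phi> y"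
        unfolding yz(1) using c z \<phi>.hom_nat_pow[OF s_closed] by (simp add: \<tau>'_def)
      also have "\<dots> = \<zero>\<^bsub>\<Xi>\<^esub>" using \<phi>_zero[of y] Suc.prems(3) P.Icarr by blast
      finally have zero: "\<phi> c \<otimes>\<^bsub>\<Xi>\<^esub> \<tau>' (Suc m) [^]\<^bsub>\<Xi>\<^esub> n \<oplus>\<^bsub>\<Xi>\<^esub> \<phi> z = \<zero>\<^bsub>\<Xi>\<^esub>" .
      have "\<phi> c = \<zero>\<^bsub>\<Xi>\<^esub>"
      proof (rule \<Xi>.bounded_polys_independent[OF p_prime char L_sub \<tau>'_c _ M[OF m] _ c(2) z(2) zero])
        show "\<tau>' (Suc m) [^]\<^bsub>\<Xi>\<^esub> p \<in> L m" using \<tau>'_step L_incl(2) by simp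
        show "n < p" using Suc.prems(2) by simp
      qed
      then have cP: "c \<in> P" using \<phi>_zero[OF c(1)] by simp
      have "z = y \<oplus>\<^bsub>T\<^esub> \<ominus>\<^bsub>T\<^esub> (c \<otimes>\<^bsub>T\<^esub> s (Suc m) [^]\<^bsub>T\<^esub> n)"
        unfolding yz(1) using c z by (simp add: T.a_ac T.r_neg2 T.r_neg1 T.r_neg)
      moreover have "c \<otimes>\<^bsub>T\<^esub> s (Suc m) [^]\<^bsub>T\<^esub> n \<in> P" by (rule P.I_r_closed[OF cP]) simp
      ultimately have zP: "z \<in> P" using P.a_closed[OF Suc.prems(3) P.a_inv_closed] by simp
      have "z \<in> Idl\<^bsub>T\<^esub> (P \<inter> U m)" using Suc.IH[OF yz(3) _ zP] Suc.prems(2) by simp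
      moreover have "c \<in> Idl\<^bsub>T\<^esub> (P \<inter> U m)" using T.genideal_self[OF PU] cP yz(2) by blast
      ultimately show ?case
        unfolding yz(1) by (intro I.a_closed I.I_r_closed) auto
    qed
  qed
  have descend_step: "P \<inter> U (Suc m) \<subseteq> Idl\<^bsub>T\<^esub> (P \<inter> U m)" if m: "M \<le> m" for m
  proof
    fix y assume y: "y \<in> P \<inter> U (Suc m)"
    have "s (Suc m) [^]\<^bsub>T\<^esub> p \<in> U m" using s_power U_incl(2) by simp
    then have "y \<in> bounded_polys T (U m) (s (Suc m)) p"
      using y U_Suc_subset[of m] by (intro T.simple_extension_power_decomposition[OF U_subring s_closed p_pos]) auto
    then show "y \<in> Idl\<^bsub>T\<^esub> (P \<inter> U m)" using descend[OF m] y by blast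
  qed
  have PU: "P \<inter> U m \<subseteq> carrier T" for m using P.Icarr by auto
  have all: "P \<inter> U m \<subseteq> Idl\<^bsub>T\<^esub> (P \<inter> U M)" if "M \<le> m" for m
    using that
  proof (induction m rule: dec_induct)
    case base
    show ?case by (rule T.genideal_self[OF PU])
  next
    case (step m)
    then show ?case
      using descend_step[of m]
        T.genideal_minimal[OF T.genideal_ideal[OF PU] step.IH] by blast
  qed
  obtain F where F: "F \<subseteq> P" "finite F" "P \<inter> U M \<subseteq> Idl\<^bsub>T\<^esub> F"
    using polynomial_ideal_finitely_generated[OF noeth A.M_cring T.cring_axioms inl_hom s_closed P.ideal_axioms, of M]
    unfolding U_def by blast
  have FT: "F \<subseteq> carrier T" using F(1) P.Icarr by auto
  interpret IF: ideal "Idl\<^bsub>T\<^esub> F" T by (rule T.genideal_ideal[OF FT])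
  have "P \<subseteq> Idl\<^bsub>T\<^esub> F"
  proof
    fix y assume y: "y \<in> P"
    obtain m u where u: "u \<in> Units T" "u \<in> U m" "u \<otimes>\<^bsub>T\<^esub> y \<in> U m"
      using clear_denominators[OF P.Icarr[OF y]] by blast
    have "u \<otimes>\<^bsub>T\<^esub> y \<in> P" by (rule P.I_l_closed[OF y T.Units_closed[OF u(1)]])
    moreover have "u \<otimes>\<^bsub>T\<^esub> y \<in> U (max m M)" using u(3) U_mono[of m "max m M"] by auto
    ultimately have "u \<otimes>\<^bsub>T\<^esub> y \<in> Idl\<^bsub>T\<^esub> (P \<inter> U M)" using all[of "max m M"] by auto
    then have "u \<otimes>\<^bsub>T\<^esub> y \<in> Idl\<^bsub>T\<^esub> F" using T.genideal_minimal[OF IF.is_ideal F(3)] by blast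
    then have "inv\<^bsub>T\<^esub> u \<otimes>\<^bsub>T\<^esub> (u \<otimes>\<^bsub>T\<^esub> y) \<in> Idl\<^bsub>T\<^esub> F" by (rule IF.I_l_closed) (use u in simp)
    moreover have "inv\<^bsub>T\<^esub> u \<otimes>\<^bsub>T\<^esub> (u \<otimes>\<^bsub>T\<^esub> y) = y"
      using T.m_assoc[OF T.Units_inv_closed[OF u(1)] T.Units_closed[OF u(1)] P.Icarr[OF y]] T.Units_l_inv[OF u(1)]
        P.Icarr[OF y] by simp
    ultimately show "y \<in> Idl\<^bsub>T\<^esub> F" by simp
  qed
  moreover have "Idl\<^bsub>T\<^esub> F \<subseteq> P" by (rule T.genideal_minimal[OF P.ideal_axioms F(1)])
  ultimately show "finitely_generated_ideal T P"
    using FT F(2) unfolding finitely_generated_ideal_def by blast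
qed

end

theorem theorem3p6:
  fixes k :: "('k, 'c) ring_scheme" and A :: "('k, 'a, 'd) module_scheme" and p :: nat
  assumes "perfect_field_of_char p k"
    and "algebra k A"
  shows "(noetherian_ring A \<and>
          (\<forall>P. primeideal P A \<longrightarrow>
             (\<forall>x \<in> sharp p (Qt (A Quot P)).
                (ring.algebraic (Qt (A Quot P)) over (residue_map A P ` carrier k)) x)))
         \<longleftrightarrow> noetherian_ring (A_infty p k A)"
proof -
  interpret extended_algebra p k A
    by (intro extended_algebra.intro perfect_closure.intro assms)
  show ?thesis
    unfolding A_infty_eq
    using noetherian_descends sharp_algebraic_of_noetherian noetherian_of_sharp_algebraic by blast
qed

end
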